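(* Let $1<p<\infty$ and $\varphi\in L^\infty(G)$. If the Toeplitz operator $T_\varphi$ is semi-Fredholm on $H^p(G)$, then its symbol $\varphi$ is invertible in the algebra $L^\infty(G)$.
   Context: $G$ is a nontrivial connected compact abelian group with normalized Haar measure $m$; $X$ is its (discrete) character group, written multiplicatively, with unit character $\mathbf 1$. $T\subset X$ is a fixed subsemigroup (positive cone) with $\mathbf 1\in T$, $T\cap T^{-1}=\{\mathbf 1\}$, $X=T^{-1}T$; it defines a (in general partial) order on $X$ by $\xi\le\chi$ iff $\chi\xi^{-1}\in T$. Fourier transform: $\widehat f(\chi)=\int_G f\overline{\chi}\,dm$. $H^p(G)=\{f\in L^p(G):\widehat f(\chi)=0 \text{ for all }\chi\in X\setminus T\}$ with the $L^p$ norm. $Pol(G)$ and $Pol_T(G)$ are the linear spans of $X$ and of $T$. The Riesz projection $P_T:Pol(G)\to Pol_T(G)$ is $P_T(\sum_{\chi\in M}c_\chi\chi)=\sum_{\chi\in M\cap T}c_\chi\chi$; standing assumption: $P_T$ is bounded in the $L^p$ norm, so that it extends to a bounded projection $P_T:L^p(G)\to H^p(G)$ (automatic, by Bochner–Helson, if $T\cup T^{-1}=X$). The Toeplitz operator on $H^p(G)$ is $T_\varphi f=P_T(\varphi f)$. A bounded operator $A$ on a Banach space $Y$ is in $\Phi_+(Y)$ if its image is closed and its kernel is finite-dimensional; it is in $\Phi_-(Y)$ if $Y/\operatorname{Im}A$ is finite-dimensional; it is semi-Fredholm if it belongs to $\Phi_+(Y)\cup\Phi_-(Y)$. *)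

theory Defs
  imports "HOL-Analysis.Analysis"
begin

section \<open>Compact abelian groups with their normalized Haar measure\<close>

text \<open>
  The group is written additively and is not assumed second countable, so regularity of the
  Haar measure is part of its specification. Together the axioms determine \<open>haar\<close> uniquely.
\<close>

class compact_ab_group = topological_ab_group_add + t2_space +
  fixes haar :: "'a measure"
  assumes compact_group: "compact (UNIV :: 'a set)"
    and sets_haar: "sets haar = sets borel"
    and emeasure_haar_UNIV: "emeasure haar UNIV = 1"
    and haar_translation: "A \<in> sets borel \<Longrightarrow> emeasure haar ((+) a ` A) = emeasure haar A"
    and haar_outer_regular:
      "A \<in> sets borel \<Longrightarrow> emeasure haar A = (INF U\<in>{U. open U \<and> A \<subseteq> U}. emeasure haar U)"
    and haar_inner_regular:
      "open U \<Longrightarrow> emeasure haar U = (SUP K\<in>{K. compact K \<and> K \<subseteq> U}. emeasure haar K)"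

lemma space_haar [simp]: "space haar = (UNIV :: 'a :: compact_ab_group set)"
  using sets_eq_imp_space_eq[OF sets_haar] by simp

lemma measurable_haar [simp]:
  "borel_measurable (haar :: 'a :: compact_ab_group measure) = borel_measurable borel"
  by (rule measurable_cong_sets) (simp_all add: sets_haar)


section \<open>Measurable functions modulo equality almost everywhere\<close>

definition ae_rel :: "('a::compact_ab_group \<Rightarrow> complex) \<Rightarrow> ('a \<Rightarrow> complex) \<Rightarrow> bool" where
  "ae_rel f g \<longleftrightarrow> f \<in> borel_measurable borel \<and> g \<in> borel_measurable borel \<and> (AE x in haar. f x = g x)"

lemma part_equivp_ae_rel: "part_equivp ae_rel"
proof (rule part_equivpI)
  show "\<exists>f :: 'a \<Rightarrow> complex. ae_rel f f"
    by (rule exI[of _ "\<lambda>_. 0"]) (simp add: ae_rel_def)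
  show "symp (ae_rel :: ('a \<Rightarrow> complex) \<Rightarrow> _)"
    by (auto simp: symp_def ae_rel_def eq_commute)
  show "transp (ae_rel :: ('a \<Rightarrow> complex) \<Rightarrow> _)"
    unfolding transp_def ae_rel_def by (auto elim: AE_mp)
qed

quotient_type (overloaded) 'a L0 = "'a::compact_ab_group \<Rightarrow> complex" / partial: ae_rel
  by (rule part_equivp_ae_rel)

instantiation L0 :: (compact_ab_group) comm_ring_1
begin

lift_definition zero_L0 :: "'a L0" is "\<lambda>_. 0" by (simp add: ae_rel_def)
lift_definition one_L0 :: "'a L0" is "\<lambda>_. 1" by (simp add: ae_rel_def)
lift_definition plus_L0 :: "'a L0 \<Rightarrow> 'a L0 \<Rightarrow> 'a L0" is "\<lambda>f g x. f x + g x"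
  unfolding ae_rel_def by (auto elim: eventually_elim2)
lift_definition minus_L0 :: "'a L0 \<Rightarrow> 'a L0 \<Rightarrow> 'a L0" is "\<lambda>f g x. f x - g x"
  unfolding ae_rel_def by (auto elim: eventually_elim2)
lift_definition times_L0 :: "'a L0 \<Rightarrow> 'a L0 \<Rightarrow> 'a L0" is "\<lambda>f g x. f x * g x"
  unfolding ae_rel_def by (auto elim: eventually_elim2)
lift_definition uminus_L0 :: "'a L0 \<Rightarrow> 'a L0" is "\<lambda>f x. - f x"
  unfolding ae_rel_def by auto

instance
proof
  show "(0 :: 'a L0) \<noteq> 1"
  proof (transfer, rule notI)
    assume "ae_rel (\<lambda>_::'a. 0) (\<lambda>_. 1)"
    then have "AE x in (haar :: 'a measure). False"
      by (simp add: ae_rel_def)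
    then obtain N where "{x. \<not> False} \<subseteq> N" "emeasure (haar :: 'a measure) N = 0"
      by (auto elim!: AE_E)
    then have "emeasure (haar :: 'a measure) UNIV = 0"
      by (simp add: top.extremum_unique)
    then show False
      by (simp add: emeasure_haar_UNIV)
  qed
qed (transfer; simp add: ae_rel_def algebra_simps)+

end

lift_definition scale_L0 :: "complex \<Rightarrow> 'a::compact_ab_group L0 \<Rightarrow> 'a L0" is "\<lambda>c f x. c * f x"
  unfolding ae_rel_def by auto

text \<open>The class of a Borel function; the alternative is never used.\<close>

lift_definition L0_of :: "('a::compact_ab_group \<Rightarrow> complex) \<Rightarrow> 'a L0"
  is "\<lambda>f. if f \<in> borel_measurable borel then f else (\<lambda>_. 0)"
  by (simp add: ae_rel_def)

lift_definition in_Lp :: "real \<Rightarrow> 'a::compact_ab_group L0 \<Rightarrow> bool"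
  is "\<lambda>p f. integrable haar (\<lambda>x. cmod (f x) powr p)"
  unfolding ae_rel_def by (intro integrable_cong_AE) (auto elim: eventually_mono)

definition Lp :: "real \<Rightarrow> 'a::compact_ab_group L0 set" where
  "Lp p = {f. in_Lp p f}"

lift_definition Lp_norm :: "real \<Rightarrow> 'a::compact_ab_group L0 \<Rightarrow> real"
  is "\<lambda>p f. (LINT x|haar. cmod (f x) powr p) powr (1 / p)"
  unfolding ae_rel_def
  by (intro arg_cong[where f = "\<lambda>r. r powr _"] integral_cong_AE) (auto elim: eventually_mono)

lift_definition in_Linf :: "'a::compact_ab_group L0 \<Rightarrow> bool"
  is "\<lambda>f. \<exists>C. AE x in haar. cmod (f x) \<le> C"
  unfolding ae_rel_def by (intro iff_exI) (auto elim: eventually_elim2)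

definition Linf :: "'a::compact_ab_group L0 set" where
  "Linf = {f. in_Linf f}"

definition invertible_in_Linf :: "'a::compact_ab_group L0 \<Rightarrow> bool" where
  "invertible_in_Linf f \<longleftrightarrow> f \<in> Linf \<and> (\<exists>g\<in>Linf. f * g = 1)"


global_interpretation L0: vector_space "scale_L0 :: complex \<Rightarrow> 'a::compact_ab_group L0 \<Rightarrow> 'a L0"
  by standard (transfer; simp add: ae_rel_def algebra_simps)+


section \<open>Semi-Fredholm operators\<close>

text \<open>
  The Banach spaces at hand are complex linear subspaces \<open>Y\<close> of \<open>'a L0\<close>, with a norm
  \<open>N\<close> on \<open>Y\<close>; operators are maps on the whole type, of which only the restriction to \<open>Y\<close>
  matters.
\<close>

definition bounded_op :: "'a::compact_ab_group L0 set \<Rightarrow> 'a L0 set \<Rightarrow> ('a L0 \<Rightarrow> real) \<Rightarrow> ('a L0 \<Rightarrow> 'a L0) \<Rightarrow> bool" where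
  "bounded_op Y Z N A \<longleftrightarrow>
     (\<forall>f\<in>Y. A f \<in> Z) \<and>
     (\<forall>f\<in>Y. \<forall>g\<in>Y. A (f + g) = A f + A g) \<and>
     (\<forall>c. \<forall>f\<in>Y. A (scale_L0 c f) = scale_L0 c (A f)) \<and>
     (\<exists>C. \<forall>f\<in>Y. N (A f) \<le> C * N f)"

definition finite_dim :: "'a::compact_ab_group L0 set \<Rightarrow> bool" where
  "finite_dim Z \<longleftrightarrow> (\<exists>B. finite B \<and> Z \<subseteq> L0.span B)"

text \<open>\<open>Y/Z\<close> is spanned by the cosets of finitely many elements of \<open>Y\<close>.\<close>

definition finite_dim_quotient :: "'a::compact_ab_group L0 set \<Rightarrow> 'a L0 set \<Rightarrow> bool" where
  "finite_dim_quotient Y Z \<longleftrightarrow> (\<exists>B. finite B \<and> B \<subseteq> Y \<and> (\<forall>y\<in>Y. \<exists>b\<in>L0.span B. y - b \<in> Z))"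

definition Phi_plus :: "'a::compact_ab_group L0 set \<Rightarrow> ('a L0 \<Rightarrow> real) \<Rightarrow> ('a L0 \<Rightarrow> 'a L0) set" where
  "Phi_plus Y N = {A. bounded_op Y Y N A \<and>
     closedin (Metric_space.mtopology Y (\<lambda>f g. N (f - g))) (A ` Y) \<and>
     finite_dim {f \<in> Y. A f = 0}}"

definition Phi_minus :: "'a::compact_ab_group L0 set \<Rightarrow> ('a L0 \<Rightarrow> real) \<Rightarrow> ('a L0 \<Rightarrow> 'a L0) set" where
  "Phi_minus Y N = {A. bounded_op Y Y N A \<and> finite_dim_quotient Y (A ` Y)}"

definition semi_Fredholm :: "'a::compact_ab_group L0 set \<Rightarrow> ('a L0 \<Rightarrow> real) \<Rightarrow> ('a L0 \<Rightarrow> 'a L0) \<Rightarrow> bool" where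
  "semi_Fredholm Y N A \<longleftrightarrow> A \<in> Phi_plus Y N \<union> Phi_minus Y N"


section \<open>Characters, Hardy spaces and Toeplitz operators\<close>

definition characters :: "('a::compact_ab_group \<Rightarrow> complex) set" where
  "characters = {\<gamma>. continuous_on UNIV \<gamma> \<and> (\<forall>x. cmod (\<gamma> x) = 1) \<and> (\<forall>x y. \<gamma> (x + y) = \<gamma> x * \<gamma> y)}"

definition positive_cone :: "('a::compact_ab_group \<Rightarrow> complex) set \<Rightarrow> bool" where
  "positive_cone T \<longleftrightarrow>
     T \<subseteq> characters \<and>
     (\<lambda>_. 1) \<in> T \<and>
     (\<forall>\<xi>\<in>T. \<forall>\<gamma>\<in>T. (\<lambda>x. \<xi> x * \<gamma> x) \<in> T) \<and>
     T \<inter> (\<lambda>\<gamma> x. inverse (\<gamma> x)) ` T = {\<lambda>_. 1} \<and>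
     characters = {\<lambda>x. inverse (\<xi> x) * \<gamma> x | \<xi> \<gamma>. \<xi> \<in> T \<and> \<gamma> \<in> T}"

definition fourier :: "'a::compact_ab_group L0 \<Rightarrow> ('a \<Rightarrow> complex) \<Rightarrow> complex" where
  "fourier f \<gamma> = (LINT x|haar. rep_L0 f x * cnj (\<gamma> x))"

lemma fourier_L0_of:
  assumes "f \<in> borel_measurable borel" "\<gamma> \<in> characters"
  shows "fourier (L0_of f) \<gamma> = (LINT x|haar. f x * cnj (\<gamma> x))"
proof -
  have "ae_rel (rep_L0 (L0_of f)) f"
    using assms(1) Quotient3_rep_abs[OF Quotient3_L0, of f]
    by (simp add: L0_of.abs_eq L0_of_def ae_rel_def)
  moreover have "\<gamma> \<in> borel_measurable borel"
    using assms(2) by (auto simp: characters_def intro: borel_measurable_continuous_onI)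
  then have "(\<lambda>x. cnj (\<gamma> x)) \<in> borel_measurable borel"
    by (rule borel_measurable_continuous_on[rotated]) (intro continuous_intros)
  ultimately show ?thesis
    unfolding fourier_def ae_rel_def by (intro integral_cong_AE) (auto elim: eventually_mono)
qed

definition Hp :: "real \<Rightarrow> ('a::compact_ab_group \<Rightarrow> complex) set \<Rightarrow> 'a L0 set" where
  "Hp p T = {f \<in> Lp p. \<forall>\<gamma>\<in>characters - T. fourier f \<gamma> = 0}"

definition trig_poly :: "('a::compact_ab_group \<Rightarrow> complex) set \<Rightarrow> (('a \<Rightarrow> complex) \<Rightarrow> complex) \<Rightarrow> 'a L0" where
  "trig_poly M c = (\<Sum>\<gamma>\<in>M. scale_L0 (c \<gamma>) (L0_of \<gamma>))"

text \<open>
  On trigonometric polynomials the Riesz projection sends \<open>trig_poly M c\<close> to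
  \<open>trig_poly (M \<inter> T) c\<close>. The next definition says that it is bounded in the \<open>L\<^sup>p\<close> norm.
\<close>

definition riesz_bounded :: "real \<Rightarrow> ('a::compact_ab_group \<Rightarrow> complex) set \<Rightarrow> bool" where
  "riesz_bounded p T \<longleftrightarrow>
     (\<exists>C. \<forall>M c. finite M \<and> M \<subseteq> characters \<longrightarrow>
        Lp_norm p (trig_poly (M \<inter> T) c) \<le> C * Lp_norm p (trig_poly M c))"

text \<open>
  For \<open>1 \<le> p < \<infinity>\<close> and under \<open>riesz_bounded p T\<close> the bounded extension exists, and its values on
  \<open>Lp p\<close> are determined, since trigonometric polynomials are dense. The choice therefore only
  affects irrelevant values outside \<open>Lp p\<close>.
\<close>

definition riesz_projection ::
  "real \<Rightarrow> ('a::compact_ab_group \<Rightarrow> complex) set \<Rightarrow> 'a L0 \<Rightarrow> 'a L0" where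
  "riesz_projection p T = (SOME P. bounded_op (Lp p) (Hp p T) (Lp_norm p) P \<and>
     (\<forall>M c. finite M \<and> M \<subseteq> characters \<longrightarrow> P (trig_poly M c) = trig_poly (M \<inter> T) c))"

definition toeplitz ::
  "real \<Rightarrow> ('a::compact_ab_group \<Rightarrow> complex) set \<Rightarrow> 'a L0 \<Rightarrow> 'a L0 \<Rightarrow> 'a L0" where
  "toeplitz p T \<phi> f = riesz_projection p T (\<phi> * f)"

end

theory Submission
  imports Defs "HOL-Computational_Algebra.Fundamental_Theorem_Algebra"
begin

text \<open>
  Write \<open>\<langle>f, g\<rangle>\<close> for the integral of \<open>f * cnj g\<close> and let \<open>q\<close> be the exponent conjugate to \<open>p\<close>.
  If \<open>\<bar>\<langle>h, g\<rangle>\<bar> \<le> C * \<parallel>\<phi> h\<parallel>\<^sub>p * \<parallel>g\<parallel>\<^sub>q\<close> for all trigonometric polynomials, then by density it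
  holds for the indicator of \<open>{\<bar>\<phi>\<bar> < \<epsilon>}\<close>, which is therefore null for small \<open>\<epsilon>\<close>.

  To obtain the inequality, multiply \<open>h\<close> and \<open>g\<close> by a character \<open>\<psi>\<close>. This changes neither side, and
  it moves \<open>h\<close> into \<open>H\<^sup>p\<close> for infinitely many \<open>\<psi>\<close>, as a nontrivial element of the cone has
  distinct powers. If \<open>T\<^sub>\<phi>\<close> is in \<open>\<Phi>\<^sub>+\<close>, the open mapping theorem bounds \<open>\<psi> h\<close>, up to an
  element of the kernel, by \<open>\<phi> h\<close>; the kernel is finite-dimensional, so by the Riemann-Lebesgue lemma
  its contribution to the pairing disappears as \<open>\<psi>\<close> varies. If \<open>T\<^sub>\<phi>\<close> is in \<open>\<Phi>\<^sub>-\<close>, the same argument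
  applied to \<open>P\<^sub>T (\<psi> g) = T\<^sub>\<phi> f + b\<close>, with \<open>b\<close> in a finite-dimensional space, gives the inequality for
  \<open>cnj \<phi>\<close> with \<open>p\<close> and \<open>q\<close> exchanged.

  That trigonometric polynomials are dense, so that \<open>P\<^sub>T\<close> extends to \<open>L\<^sup>p\<close>, rests on the fact that
  characters separate points. Given \<open>a \<noteq> 0\<close>, take a real even function \<open>r\<close> with
  \<open>r 0 = 1\<close>, \<open>r a = 0\<close> and convolve with \<open>2 * r x - r (x - a) - r (x + a)\<close>. The square of this compact
  self-adjoint operator has a nonzero eigenvalue with a finite-dimensional translation-invariant
  eigenspace, which contains a character \<open>c\<close>; and \<open>c a = 1\<close> would put \<open>c\<close> into the kernel.
\<close>

section \<open>Lebesgue norms\<close>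

text \<open>The pairing replaces duality: for \<open>Phi_minus\<close> the symbol is moved across
  the pairing, so that no adjoint operator, no dual of \<open>Hp p T\<close> and no projection on
  \<open>Lp q\<close> enters. Two bounds of different quality occur. The constant of the pairing
  inequality must be independent of both polynomials; it comes from the Baire argument and the norm
  of the projection. The bound on the coefficients in the finite-dimensional space may depend on the
  polynomials, but not on the shifting character: only then can the shift be fixed first and make
  that contribution small for all admissible coefficients. Decompositions are needed only up to a
  small error in norm, so for \<open>Phi_minus\<close> the Baire half of the open mapping theorem is
  enough. \<open>Phi_plus\<close> also needs exact preimages, because a difference has to lie in the
  kernel. The spectral argument stays among continuous functions: convolution bounds the sup norm by
  the L2 norm, so images of a maximizing sequence converge uniformly along a subsequence. Maximizing
  \<open>sq_norm (K u)\<close> leads to an eigenvalue of the square without a discussion of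
  signs.\<close>

definition pnorm :: "'b measure \<Rightarrow> real \<Rightarrow> ('b \<Rightarrow> complex) \<Rightarrow> real" where
  "pnorm M p f = (LINT x|M. cmod (f x) powr p) powr (1 / p)"

text \<open>Measurability is included because it does not follow from that of the modulus.\<close>

definition p_integrable :: "'b measure \<Rightarrow> real \<Rightarrow> ('b \<Rightarrow> complex) \<Rightarrow> bool" where
  "p_integrable M p f \<longleftrightarrow> f \<in> borel_measurable M \<and> integrable M (\<lambda>x. cmod (f x) powr p)"

lemma pnorm_nonneg [simp]: "0 \<le> pnorm M p f"
  by (simp add: pnorm_def)

lemma pnorm_le_iff:
  assumes "0 < p" "0 \<le> A"
  shows "pnorm M p f \<le> A \<longleftrightarrow> (LINT x|M. cmod (f x) powr p) \<le> A powr p"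
proof -
  let ?I = "LINT x|M. cmod (f x) powr p"
  have I: "0 \<le> ?I" by simp
  have "pnorm M p f \<le> A \<longleftrightarrow> pnorm M p f powr p \<le> A powr p"
    using assms by (metis pnorm_nonneg powr_mono2 powr_less_mono2 not_le less_imp_le)
  also have "pnorm M p f powr p = ?I"
    using I assms by (simp add: pnorm_def powr_powr)
  finally show ?thesis .
qed

section \<open>Minkowski and Hoelder inequalities\<close>

lemma powr_convex_nonneg:
  fixes s t u v p :: real
  assumes "1 \<le> p" "0 \<le> s" "0 \<le> t" "0 \<le> u" "0 \<le> v" "u + v = 1"
  shows "(u * s + v * t) powr p \<le> u * s powr p + v * t powr p"
proof -
  \<comment> \<open>When one of the two points is 0, the claim reduces to this inequality for the
    weight of the other.\<close>
  have le: "w powr p \<le> w" if "0 \<le> w" "w \<le> 1" for w :: real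
    using powr_mono'[of 1 p w] that assms by simp
  consider "s = 0" | "t = 0" | "s > 0" "t > 0" using assms by linarith
  then show ?thesis
  proof cases
    case 1 then show ?thesis
      using assms le[of v] by (simp add: powr_mult mult_right_mono)
  next
    case 2 then show ?thesis
      using assms le[of u] by (simp add: powr_mult mult_right_mono)
  next
    case 3
    then show ?thesis
      using powr_convex[OF assms(1)] assms unfolding convex_on_def by simp
  qed
qed

text \<open>\<open>(a + b) / (A + B)\<close> is the convex combination of \<open>a / A\<close> and
  \<open>b / B\<close> with weights proportional to \<open>A\<close> and \<open>B\<close>.
  Integrated with \<open>A\<close> and \<open>B\<close> above the two norms, this pointwise bound
  becomes the triangle inequality.\<close>

lemma powr_add_le:
  fixes a b A B p :: real
  assumes "1 \<le> p" "0 \<le> a" "0 \<le> b" "0 < A" "0 < B"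
  shows "(a + b) powr p \<le> (A + B) powr p * (A / (A + B) * (a powr p / A powr p) + B / (A + B) * (b powr p / B powr p))"
proof -
  have "A / (A + B) * (a / A) + B / (A + B) * (b / B) = (a + b) / (A + B)"
    using assms by (simp add: add_divide_distrib)
  then have "(a + b) powr p = (A + B) powr p * (A / (A + B) * (a / A) + B / (A + B) * (b / B)) powr p"
    using assms by (simp add: powr_divide)
  also have "\<dots> \<le> (A + B) powr p * (A / (A + B) * (a / A) powr p + B / (A + B) * (b / B) powr p)"
    using assms by (intro mult_left_mono powr_convex_nonneg) (auto simp: add_divide_distrib[symmetric])
  finally show ?thesis using assms by (simp add: powr_divide)
qed

text \<open>\<open>A\<close> and \<open>B\<close> lie strictly above the norms, so that one can
  divide by them even if a norm is 0; \<open>pnorm_add\<close> then lets them shrink.\<close>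

lemma p_integrable_add_aux:
  assumes f: "p_integrable M p f" and g: "p_integrable M p g" and p: "1 \<le> p"
  shows "p_integrable M p (\<lambda>x. f x + g x)"
    and "pnorm M p f < A \<Longrightarrow> pnorm M p g < B \<Longrightarrow> pnorm M p (\<lambda>x. f x + g x) \<le> A + B"
proof -
  have meas [measurable]: "f \<in> borel_measurable M" "g \<in> borel_measurable M"
    using f g by (auto simp: p_integrable_def)
  define R where "R A B x = (A + B) powr p * (A / (A + B) * (cmod (f x) powr p / A powr p) + B / (A + B) * (cmod (g x) powr p / B powr p))" for A B x
  have Rint: "integrable M (R A B)" for A B
    using f g unfolding R_def p_integrable_def by auto
  have le: "cmod (f x + g x) powr p \<le> R A B x" if "0 < A" "0 < B" for A B x
  proof -
    have "cmod (f x + g x) powr p \<le> (cmod (f x) + cmod (g x)) powr p"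
      using p by (intro powr_mono2 norm_triangle_ineq) auto
    also have "\<dots> \<le> R A B x"
      unfolding R_def using p that by (intro powr_add_le) auto
    finally show ?thesis .
  qed
  have int: "integrable M (\<lambda>x. cmod (f x + g x) powr p)"
    by (rule Bochner_Integration.integrable_bound[OF Rint[of 1 1]])
       (use le[of 1 1] in \<open>auto intro!: AE_I2 intro: order.trans[OF _ abs_ge_self]\<close>)
  then show "p_integrable M p (\<lambda>x. f x + g x)"
    by (auto simp: p_integrable_def)
  assume AB: "pnorm M p f < A" "pnorm M p g < B"
  then have pos: "0 < A" "0 < B"
    using pnorm_nonneg[of M p f] pnorm_nonneg[of M p g] by linarith+
  have fA: "(LINT x|M. cmod (f x) powr p) \<le> A powr p"
    and gB: "(LINT x|M. cmod (g x) powr p) \<le> B powr p"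
    using AB pos p by (auto simp flip: pnorm_le_iff)
  have "(LINT x|M. cmod (f x + g x) powr p) \<le> (LINT x|M. R A B x)"
    by (intro integral_mono int Rint le pos)
  also have "\<dots> = (A + B) powr p * (A / (A + B) * ((LINT x|M. cmod (f x) powr p) / A powr p) + B / (A + B) * ((LINT x|M. cmod (g x) powr p) / B powr p))"
    using f g unfolding R_def p_integrable_def by simp
  also have "\<dots> \<le> (A + B) powr p * (A / (A + B) * 1 + B / (A + B) * 1)"
    using fA gB pos by (intro mult_left_mono add_mono) (auto simp: divide_simps)
  also have "\<dots> = (A + B) powr p"
    using pos by (simp add: add_divide_distrib[symmetric])
  finally show "pnorm M p (\<lambda>x. f x + g x) \<le> A + B"
    using pos p by (subst pnorm_le_iff) auto
qed

lemmas p_integrable_add = p_integrable_add_aux(1)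

lemma pnorm_add:
  assumes f: "p_integrable M p f" and g: "p_integrable M p g" and p: "1 \<le> p"
  shows "pnorm M p (\<lambda>x. f x + g x) \<le> pnorm M p f + pnorm M p g"
proof (rule field_le_epsilon)
  fix e :: real assume "0 < e"
  then have "pnorm M p (\<lambda>x. f x + g x) \<le> (pnorm M p f + e/2) + (pnorm M p g + e/2)"
    by (intro p_integrable_add_aux(2)[OF assms]) auto
  then show "pnorm M p (\<lambda>x. f x + g x) \<le> pnorm M p f + pnorm M p g + e"
    by simp
qed

lemma p_integrable_cmult:
  assumes "p_integrable M p f"
  shows "p_integrable M p (\<lambda>x. c * f x)"
  using assms by (auto simp: p_integrable_def norm_mult powr_mult)

lemma pnorm_cmult:
  assumes "0 < p"
  shows "pnorm M p (\<lambda>x. c * f x) = cmod c * pnorm M p f"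
  using assms by (simp add: pnorm_def norm_mult powr_mult powr_powr)

text \<open>Young's inequality for the factors divided by \<open>A\<close> and \<open>B\<close>.
  Integrated, it bounds the left-hand side by \<open>A * B\<close> for all \<open>A\<close> and
  \<open>B\<close> above the norms, which then tend to the norms.\<close>

lemma Hoelder:
  assumes f: "p_integrable M p f" and g: "p_integrable M q g" and pq: "1 < p" "1 < q" "1/p + 1/q = 1"
  shows "integrable M (\<lambda>x. f x * g x)"
    and "(LINT x|M. cmod (f x * g x)) \<le> pnorm M p f * pnorm M q g"
proof -
  have meas [measurable]: "f \<in> borel_measurable M" "g \<in> borel_measurable M"
    using f g by (auto simp: p_integrable_def)
  define R where "R A B x = A * B * ((cmod (f x) powr p / A powr p) / p + (cmod (g x) powr q / B powr q) / q)" for A B x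
  have Rint: "integrable M (R A B)" for A B
    using f g unfolding R_def p_integrable_def by auto
  have le: "cmod (f x * g x) \<le> R A B x" if "0 < A" "0 < B" for A B x
  proof -
    have "cmod (f x * g x) = A * B * ((cmod (f x) / A) * (cmod (g x) / B))"
      using that by (simp add: norm_mult)
    also have "\<dots> \<le> A * B * ((cmod (f x) / A) powr p / p + (cmod (g x) / B) powr q / q)"
      using that pq by (intro mult_left_mono Youngs_inequality) auto
    finally show ?thesis using that by (simp add: R_def powr_divide)
  qed
  show int: "integrable M (\<lambda>x. f x * g x)"
    by (rule Bochner_Integration.integrable_bound[OF Rint[of 1 1]])
       (use le[of 1 1] in \<open>auto intro!: AE_I2 intro: order.trans[OF _ abs_ge_self]\<close>)
  have main: "(LINT x|M. cmod (f x * g x)) \<le> A * B" if AB: "pnorm M p f < A" "pnorm M q g < B" for A B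
  proof -
    have pos: "0 < A" "0 < B"
      using AB pnorm_nonneg[of M p f] pnorm_nonneg[of M q g] by linarith+
    have fA: "(LINT x|M. cmod (f x) powr p) \<le> A powr p"
      and gB: "(LINT x|M. cmod (g x) powr q) \<le> B powr q"
      using AB pos pq by (auto simp flip: pnorm_le_iff)
    have "(LINT x|M. cmod (f x * g x)) \<le> (LINT x|M. R A B x)"
      by (intro integral_mono integrable_norm int Rint le pos)
    also have "\<dots> = A * B * (((LINT x|M. cmod (f x) powr p) / A powr p) / p + ((LINT x|M. cmod (g x) powr q) / B powr q) / q)"
      using f g unfolding R_def p_integrable_def by simp
    also have "\<dots> \<le> A * B * (1 / p + 1 / q)"
      using fA gB pos pq by (intro mult_left_mono add_mono divide_right_mono) (auto simp: divide_simps)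
    finally show ?thesis using pq by simp
  qed
  show "(LINT x|M. cmod (f x * g x)) \<le> pnorm M p f * pnorm M q g"
  proof (rule tendsto_lowerbound)
    show "((\<lambda>e. (pnorm M p f + e) * (pnorm M q g + e)) \<longlongrightarrow> pnorm M p f * pnorm M q g) (at_right 0)"
      by (auto intro!: tendsto_eq_intros)
    show "\<forall>\<^sub>F e in at_right 0. (LINT x|M. cmod (f x * g x)) \<le> (pnorm M p f + e) * (pnorm M q g + e)"
      using eventually_at_right_less[of "0::real"] by eventually_elim (auto intro!: main)
  qed simp
qed

lemma p_integrable_bounded:
  assumes [measurable]: "f \<in> borel_measurable M" and "finite_measure M" "AE x in M. cmod (f x) \<le> C" "0 \<le> p"
  shows "p_integrable M p f"
proof -
  interpret finite_measure M by fact
  have "integrable M (\<lambda>x. cmod (f x) powr p)"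
    by (rule integrable_const_bound[where B = "C powr p"])
       (use assms(3,4) in \<open>auto elim!: eventually_mono intro!: powr_mono2\<close>)
  then show ?thesis by (auto simp: p_integrable_def)
qed

lemma pnorm_bounded_mult:
  assumes f: "p_integrable M p f" and [measurable]: "g \<in> borel_measurable M"
    and g: "AE x in M. cmod (g x) \<le> C" and p: "0 < p" and C: "0 \<le> C"
  shows "p_integrable M p (\<lambda>x. g x * f x)" "pnorm M p (\<lambda>x. g x * f x) \<le> C * pnorm M p f"
proof -
  have [measurable]: "f \<in> borel_measurable M"
    using f by (auto simp: p_integrable_def)
  have le: "AE x in M. cmod (g x * f x) powr p \<le> C powr p * cmod (f x) powr p"
    using g by eventually_elim (use p C in \<open>auto simp: norm_mult powr_mult intro!: mult_right_mono powr_mono2\<close>)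
  have int: "integrable M (\<lambda>x. C powr p * cmod (f x) powr p)"
    using f by (auto simp: p_integrable_def)
  have int': "integrable M (\<lambda>x. cmod (g x * f x) powr p)"
    by (rule Bochner_Integration.integrable_bound[OF int]) (use le in auto)
  then show "p_integrable M p (\<lambda>x. g x * f x)" by (auto simp: p_integrable_def)
  have "(LINT x|M. cmod (g x * f x) powr p) \<le> (LINT x|M. C powr p * cmod (f x) powr p)"
    by (intro integral_mono_AE int int' le)
  also have "\<dots> \<le> (C * pnorm M p f) powr p"
    using p C pnorm_le_iff[of p "pnorm M p f" M f] by (auto simp: powr_mult intro!: mult_left_mono)
  finally show "pnorm M p (\<lambda>x. g x * f x) \<le> C * pnorm M p f"
    using p C by (subst pnorm_le_iff) auto
qed

lemma pnorm_1_le: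
  assumes f: "p_integrable M p f" and M: "emeasure M (space M) = 1" and p: "1 < p"
  shows "integrable M f" "(LINT x|M. cmod (f x)) \<le> pnorm M p f"
proof -
  interpret finite_measure M by (rule finite_measureI) (simp add: M)
  define q where "q = p / (p - 1)"
  have q: "1 < q" "1/p + 1/q = 1" using p by (auto simp: q_def field_simps)
  have one: "p_integrable M q (\<lambda>_. 1)" by (rule p_integrable_bounded[where C = 1]) (use q in \<open>auto intro: finite_measure_axioms\<close>)
  have "pnorm M q (\<lambda>_. 1) = 1"
    using M q by (simp add: pnorm_def measure_def)
  with Hoelder[OF f one p q] show "integrable M f" "(LINT x|M. cmod (f x)) \<le> pnorm M p f" by auto
qed

section \<open>Definiteness and completeness\<close>

lemma pnorm_powr: "0 < p \<Longrightarrow> pnorm M p f powr p = (LINT x|M. cmod (f x) powr p)"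
  by (simp add: pnorm_def powr_powr)

lemma pnorm_eq_0:
  assumes "p_integrable M p f" "0 < p" "pnorm M p f = 0"
  shows "AE x in M. f x = 0"
proof -
  have "(LINT x|M. cmod (f x) powr p) = 0"
    using assms pnorm_powr[of p M f] by simp
  then have "AE x in M. cmod (f x) powr p = 0"
    using assms by (subst (asm) integral_nonneg_eq_0_iff_AE) (auto simp: p_integrable_def)
  then show ?thesis by eventually_elim auto
qed

lemma p_integrable_nn_integral:
  assumes "f \<in> borel_measurable M" "0 < p" "(\<integral>\<^sup>+x. ennreal (cmod (f x) powr p) \<partial>M) \<le> ennreal (C powr p)" "0 \<le> C"
  shows "p_integrable M p f" "pnorm M p f \<le> C"
proof -
  have int: "integrable M (\<lambda>x. cmod (f x) powr p)"
    using assms by (intro integrableI_nonneg) (auto simp: order.strict_trans1)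
  then show "p_integrable M p f" using assms by (auto simp: p_integrable_def)
  show "pnorm M p f \<le> C"
    using assms int by (subst pnorm_le_iff) (auto simp: nn_integral_eq_integral)
qed

text \<open>On a probability space the L1 norm is at most the norm of exponent \<open>p\<close>, so
  the moduli of the increments have summable integrals and the sequence converges almost everywhere.
  Fatou's lemma for \<open>f m - f n\<close>, as \<open>m\<close> grows, bounds the distance to the
  limit.\<close>

lemma Riesz_Fischer_fast:
  fixes f :: "nat \<Rightarrow> 'b \<Rightarrow> complex"
  assumes M: "emeasure M (space M) = 1" and p: "1 < p" and f: "\<And>n. p_integrable M p (f n)"
    and fast: "\<And>m n. n \<le> m \<Longrightarrow> pnorm M p (\<lambda>x. f m x - f n x) \<le> (1/2)^n"
  obtains g where "p_integrable M p g" "\<And>n. pnorm M p (\<lambda>x. g x - f n x) \<le> (1/2)^n"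
proof -
  have lpd: "p_integrable M p (\<lambda>x. f m x - f n x)" for m n
    using p_integrable_add[OF f[of m] p_integrable_cmult[OF f[of n], of "-1"]] p by simp
  have [measurable]: "f n \<in> borel_measurable M" for n
    using f by (auto simp: p_integrable_def)
  define d where "d n x = cmod (f (Suc n) x - f n x)" for n x
  have [measurable]: "d n \<in> borel_measurable M" for n unfolding d_def by measurable
  have dle: "(\<integral>\<^sup>+x. ennreal (d n x) \<partial>M) \<le> ennreal ((1/2)^n)" for n
  proof -
    have "(\<integral>\<^sup>+x. ennreal (d n x) \<partial>M) = ennreal (LINT x|M. d n x)"
      using pnorm_1_le(1)[OF lpd M p] unfolding d_def by (intro nn_integral_eq_integral integrable_norm) auto
    also have "\<dots> \<le> ennreal ((1/2)^n)"
      using order.trans[OF pnorm_1_le(2)[OF lpd M p] fast[of n "Suc n"]]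
      unfolding d_def by (intro ennreal_leI) auto
    finally show ?thesis .
  qed
  have "(\<integral>\<^sup>+x. (\<Sum>n. ennreal (d n x)) \<partial>M) = (\<Sum>n. \<integral>\<^sup>+x. ennreal (d n x) \<partial>M)"
    by (rule nn_integral_suminf) simp
  also have "\<dots> \<le> (\<Sum>n. ennreal ((1/2)^n))"
    by (intro suminf_le dle) auto
  also have "\<dots> = ennreal (\<Sum>n. (1/2)^n)"
    by (intro suminf_ennreal_eq) (auto simp: summable_sums)
  also have "\<dots> < \<infinity>" by simp
  finally have "AE x in M. (\<Sum>n. ennreal (d n x)) \<noteq> \<infinity>"
    by (intro nn_integral_noteq_infinite) auto
  then have conv: "AE x in M. convergent (\<lambda>n. f n x)"
  proof eventually_elim
    fix x assume "(\<Sum>n. ennreal (d n x)) \<noteq> \<infinity>"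
    then have "summable (\<lambda>n. d n x)"
      by (intro summable_suminf_not_top) (auto simp: d_def)
    then have "summable (\<lambda>n. f (Suc n) x - f n x)"
      unfolding d_def by (rule summable_norm_cancel)
    then show "convergent (\<lambda>n. f n x)"
      using sum_lessThan_telescope[of "\<lambda>n. f n x"]
      by (simp add: summable_iff_convergent convergent_diff_const_right_iff)
  qed
  \<comment> \<open>\<open>lim\<close> yields some value also where the sequence diverges, which is
    a null set.\<close>
  define g where "g x = lim (\<lambda>n. f n x)" for x
  have [measurable]: "g \<in> borel_measurable M"
    unfolding g_def by (rule borel_measurable_lim_metric) simp
  have lim: "AE x in M. (\<lambda>n. f n x) \<longlonglongrightarrow> g x"
    using conv by eventually_elim (auto simp: g_def convergent_LIMSEQ_iff)
  have main: "p_integrable M p (\<lambda>x. g x - f n x) \<and> pnorm M p (\<lambda>x. g x - f n x) \<le> (1/2)^n" for n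
  proof -
    have "(\<integral>\<^sup>+x. ennreal (cmod (g x - f n x) powr p) \<partial>M)
        = (\<integral>\<^sup>+x. liminf (\<lambda>m. ennreal (cmod (f m x - f n x) powr p)) \<partial>M)"
    proof (rule nn_integral_cong_AE, use lim in eventually_elim)
      fix x assume "(\<lambda>m. f m x) \<longlonglongrightarrow> g x"
      then have "(\<lambda>m. ennreal (cmod (f m x - f n x) powr p)) \<longlonglongrightarrow> ennreal (cmod (g x - f n x) powr p)"
        using p by (intro tendsto_ennrealI tendsto_powr' tendsto_intros) auto
      then show "ennreal (cmod (g x - f n x) powr p) = liminf (\<lambda>m. ennreal (cmod (f m x - f n x) powr p))"
        by (metis lim_imp_Liminf sequentially_bot)
    qed
    also have "\<dots> \<le> liminf (\<lambda>m. \<integral>\<^sup>+x. ennreal (cmod (f m x - f n x) powr p) \<partial>M)"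
      by (rule nn_integral_liminf) simp
    also have "\<dots> \<le> ennreal (((1/2)^n) powr p)"
    proof (rule order.trans[OF Liminf_mono Liminf_const[THEN eq_refl]])
      show "\<forall>\<^sub>F m in sequentially. (\<integral>\<^sup>+x. ennreal (cmod (f m x - f n x) powr p) \<partial>M) \<le> ennreal (((1/2)^n) powr p)"
        using eventually_ge_at_top[of n]
      proof eventually_elim
        case (elim m)
        have "(\<integral>\<^sup>+x. ennreal (cmod (f m x - f n x) powr p) \<partial>M) = ennreal (LINT x|M. cmod (f m x - f n x) powr p)"
          using lpd by (intro nn_integral_eq_integral) (auto simp: p_integrable_def)
        also have "\<dots> \<le> ennreal (((1/2)^n) powr p)"
          using fast[OF elim] p by (intro ennreal_leI) (subst (asm) pnorm_le_iff, auto)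
        finally show ?case .
      qed
    qed simp
    finally show ?thesis using p_integrable_nn_integral[of "\<lambda>x. g x - f n x" M p "(1/2)^n"] p by auto
  qed
  then have "p_integrable M p g"
    using p_integrable_add[OF main[of 0, THEN conjunct1] f[of 0]] p by simp
  then show ?thesis using main that by blast
qed

section \<open>Haar measure\<close>

lemma finite_measure_haar: "finite_measure (haar :: 'a::compact_ab_group measure)"
  by (rule finite_measureI) (simp add: emeasure_haar_UNIV)

interpretation haar: finite_measure "haar :: 'a::compact_ab_group measure"
  by (rule finite_measure_haar)

interpretation haar_pair: pair_sigma_finite "haar :: 'a::compact_ab_group measure" "haar :: 'a measure"
  by unfold_locales

lemma measure_haar_UNIV [simp]: "measure (haar :: 'a::compact_ab_group measure) UNIV = 1"
  by (simp add: measure_def emeasure_haar_UNIV)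

lemma borel_measurable_continuous_UNIV:
  "continuous_on UNIV f \<Longrightarrow> f \<in> borel_measurable borel"
  by (rule borel_measurable_continuous_onI)

lemma continuous_bounded:
  fixes f :: "'a::compact_ab_group \<Rightarrow> 'b::real_normed_vector"
  assumes "continuous_on UNIV f"
  obtains B where "0 < B" "\<And>x. norm (f x) \<le> B"
proof -
  have "bounded (range f)"
    using compact_continuous_image[OF assms compact_group] by (rule compact_imp_bounded)
  then show ?thesis using that unfolding bounded_pos by auto
qed

lemma continuous_integrable:
  fixes f :: "'a::compact_ab_group \<Rightarrow> 'b::{banach, second_countable_topology}"
  assumes "continuous_on UNIV f"
  shows "integrable haar f"
proof -
  obtain B where "\<And>x. norm (f x) \<le> B" using continuous_bounded[OF assms] by blast
  then show ?thesis
    using borel_measurable_continuous_UNIV[OF assms] by (intro haar.integrable_const_bound) auto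
qed

section \<open>Translation invariance and positivity on open sets\<close>

lemma distr_haar_translate: "distr haar haar ((+) a) = (haar :: 'a::compact_ab_group measure)"
proof (rule measure_eqI)
  fix A assume "A \<in> sets (distr haar haar ((+) a :: 'a \<Rightarrow> 'a))"
  then have A: "A \<in> sets borel" by (simp add: sets_haar)
  have meas: "(+) a \<in> measurable haar (haar :: 'a measure)"
    by (rule measurableI) (auto simp: sets_haar intro!: measurable_sets_borel borel_measurable_continuous_onI continuous_intros)
  have "(+) a -` A = (+) (-a) ` A"
    by (auto intro!: image_eqI[where x = "a + _"])
  then show "emeasure (distr haar haar ((+) a)) A = emeasure haar A"
    using A meas haar_translation[OF A, of "-a"] emeasure_distr[OF meas, of A]
    by (simp only: sets_haar space_haar Int_UNIV_right)
qed simp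

lemma integral_translate:
  fixes f :: "'a::compact_ab_group \<Rightarrow> 'b::{banach, second_countable_topology}"
  assumes "f \<in> borel_measurable borel"
  shows "(LINT x|haar. f (a + x)) = (LINT x|haar. f x)"
proof -
  have meas: "(+) a \<in> measurable haar (haar :: 'a measure)"
    by (rule measurableI) (auto simp: sets_haar intro!: measurable_sets_borel borel_measurable_continuous_onI continuous_intros)
  have "(LINT x|haar. f x) = (LINT x|distr haar haar ((+) a). f x)"
    by (simp add: distr_haar_translate)
  also have "\<dots> = (LINT x|haar. f (a + x))"
    using assms by (intro integral_distr meas) simp
  finally show ?thesis ..
qed

text \<open>Finitely many translates of \<open>U\<close> cover the compact group, and all of them
  have the measure of \<open>U\<close>.\<close>

lemma haar_open_pos:
  assumes "open U" "U \<noteq> {}"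
  shows "emeasure haar (U :: 'a::compact_ab_group set) > 0"
proof (rule ccontr)
  assume "\<not> ?thesis"
  then have 0: "emeasure haar U = 0" by simp
  obtain u where u: "u \<in> U" using assms by blast
  have op: "open ((+) a ` U)" for a
  proof -
    have "(+) a ` U = (+) (-a) -` U" by (auto intro!: image_eqI[where x = "-a + _"])
    moreover have "open ((+) (-a) -` U)"
      by (rule open_vimage[OF assms(1)]) (intro continuous_intros)
    ultimately show ?thesis by simp
  qed
  have "(UNIV :: 'a set) \<subseteq> (\<Union>a. (+) a ` U)"
  proof
    fix x show "x \<in> (\<Union>a. (+) a ` U)"
      using u by (intro UN_I[of "x - u"] image_eqI[of _ _ u]) auto
  qed
  then obtain A where A: "finite A" "UNIV \<subseteq> (\<Union>a\<in>A. (+) a ` U)"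
    using compactE_image[OF compact_group, of UNIV "\<lambda>a. (+) a ` U"] op by (metis (no_types, lifting))
  have "emeasure haar (UNIV :: 'a set) \<le> emeasure haar (\<Union>a\<in>A. (+) a ` U)"
    using A op by (intro emeasure_mono) (auto simp: sets_haar)
  also have "\<dots> \<le> (\<Sum>a\<in>A. emeasure haar ((+) a ` U))"
    using A op by (intro emeasure_subadditive_finite) (auto simp: sets_haar)
  also have "\<dots> = 0" using assms by (simp add: haar_translation 0)
  finally show False by (simp add: emeasure_haar_UNIV)
qed

lemma continuous_integral_square_0:
  fixes f :: "'a::compact_ab_group \<Rightarrow> complex"
  assumes f: "continuous_on UNIV f" and 0: "(LINT x|haar. (cmod (f x))\<^sup>2) = 0"
  shows "f x = 0"
proof (rule ccontr)
  assume "f x \<noteq> 0"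
  let ?U = "{x. f x \<noteq> 0}"
  have "open ?U"
    using f open_Collect_neq[of f "\<lambda>_. 0"] by simp
  moreover have "?U \<noteq> {}" using \<open>f x \<noteq> 0\<close> by blast
  ultimately have pos: "emeasure haar ?U > 0" by (rule haar_open_pos)
  have "AE x in haar. (cmod (f x))\<^sup>2 = 0"
    using 0 by (subst (asm) integral_nonneg_eq_0_iff_AE) (auto intro!: continuous_integrable continuous_intros f)
  then have "AE x in haar. x \<notin> ?U" by (auto elim: eventually_mono)
  with \<open>open ?U\<close> have "emeasure haar ?U = 0"
    by (subst (asm) AE_iff_measurable[where N = ?U]) (auto simp: sets_haar)
  with pos show False by simp
qed

text \<open>Since \<open>x\<close> ranges over a compact space, continuity of
  \<open>k (x + h)\<close> in the pair \<open>(h, x)\<close> is uniform in \<open>x\<close> near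
  \<open>h = 0\<close>.\<close>

lemma uniformly_continuous_group:
  fixes k :: "'a::compact_ab_group \<Rightarrow> complex"
  assumes k: "continuous_on UNIV k" and e: "0 < e"
  obtains U where "open U" "0 \<in> U" "\<And>h x. h \<in> U \<Longrightarrow> cmod (k (x + h) - k x) \<le> e"
proof -
  have "continuous_on (UNIV \<times> UNIV) (\<lambda>(h, x). k (x + h))"
    unfolding case_prod_beta by (rule continuous_on_compose2[OF k]) (auto intro!: continuous_intros)
  from continuous_on_prod_compactE[OF this compact_group UNIV_I[of 0] e]
  obtain U where U: "0 \<in> U" "open U"
    "\<forall>h\<in>U \<inter> UNIV. \<forall>x\<in>UNIV. dist (case (h, x) of (h, x) \<Rightarrow> k (x + h)) (case (0, x) of (h, x) \<Rightarrow> k (x + h)) \<le> e" .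
  show ?thesis
  proof (rule that[OF U(2,1)])
    fix h x assume "h \<in> U"
    then show "cmod (k (x + h) - k x) \<le> e"
      using U(3)[rule_format, of h x] by (simp add: dist_norm)
  qed
qed

text \<open>
  The step function \<open>k (z - y (i x))\<close> replaces Stone-Weierstrass on the product: it makes the
  kernel \<open>k (z - x)\<close> measurable for the product sigma-algebra, although the group need not be
  second countable, and it makes convolution by \<open>k\<close> compact.
\<close>

lemma finite_net:
  fixes k :: "'a::compact_ab_group \<Rightarrow> complex"
  assumes k: "continuous_on UNIV k" and e: "0 < e"
  obtains N :: nat and y :: "nat \<Rightarrow> 'a" and i :: "'a \<Rightarrow> nat"
  where "i \<in> measurable borel (count_space UNIV)" "\<And>x. i x < N"
    "\<And>x z. cmod (k (z - x) - k (z - y (i x))) \<le> e"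
proof -
  obtain U where U: "open U" "0 \<in> U" "\<And>h x. h \<in> U \<Longrightarrow> cmod (k (x + h) - k x) \<le> e"
    using uniformly_continuous_group[OF assms] by blast
  define V where "V a = (\<lambda>x. a - x) -` U" for a
  have op: "open (V a)" for a
    unfolding V_def by (rule open_vimage[OF U(1)]) (intro continuous_intros)
  have "(UNIV :: 'a set) \<subseteq> (\<Union>a. V a)"
    using U by (auto simp: V_def intro!: exI[where x = _])
  then obtain A where A: "finite A" "UNIV \<subseteq> (\<Union>a\<in>A. V a)"
    using compactE_image[OF compact_group, of UNIV V] op by (metis (no_types, lifting))
  obtain l where l: "A = set l" using finite_list[OF A(1)] by blast
  define N where "N = length l"
  \<comment> \<open>Taking the least index turns the open cover into a partition into Borel
    sets.\<close>
  define i where "i x = (LEAST j. j < N \<and> x \<in> V (l ! j))" for x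
  have ex: "\<exists>j. j < N \<and> x \<in> V (l ! j)" for x
    using A(2) by (force simp: l N_def in_set_conv_nth)
  have i: "i x < N \<and> x \<in> V (l ! i x)" for x
    unfolding i_def by (rule LeastI_ex[OF ex])
  have [measurable]: "V (l ! j) \<in> sets borel" for j
    using op by simp
  have "i \<in> measurable borel (count_space UNIV)"
    unfolding i_def by measurable
  moreover have "cmod (k (z - x) - k (z - l ! i x)) \<le> e" for x z
  proof -
    have "l ! i x - x \<in> U" using i[of x] by (auto simp: V_def)
    from U(3)[OF this, of "z - l ! i x"] show ?thesis by (simp add: algebra_simps)
  qed
  ultimately show ?thesis using that[of i N "\<lambda>j. l ! j"] i by blast
qed

lemma kernel_measurable:
  fixes k :: "'a::compact_ab_group \<Rightarrow> complex"
  assumes k: "continuous_on UNIV k"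
  shows "(\<lambda>(x, y). k (x - y)) \<in> borel_measurable (haar \<Otimes>\<^sub>M haar)"
proof -
  have "\<exists>N y i. i \<in> measurable borel (count_space UNIV) \<and> (\<forall>x. i x < (N::nat)) \<and>
      (\<forall>x z. cmod (k (z - x) - k (z - y (i x))) \<le> 1 / Suc n)" for n
    by (rule finite_net[OF k, of "1 / Suc n"]) auto
  then obtain y i where i: "\<And>n. i n \<in> measurable borel (count_space UNIV)"
    and le: "\<And>n x z. cmod (k (z - x) - k (z - y n (i n x :: nat))) \<le> 1 / Suc n"
    by metis
  show ?thesis
  proof (rule borel_measurable_LIMSEQ_metric)
    fix n
    have [measurable]: "i n \<in> measurable haar (count_space UNIV)"
      using i[of n] by (simp add: measurable_def sets_haar)
    have [measurable]: "(\<lambda>x. k (x - y n j)) \<in> borel_measurable haar" for j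
      unfolding measurable_haar
      by (intro borel_measurable_continuous_onI continuous_on_compose2[OF k] continuous_intros) auto
    \<comment> \<open>For a fixed index the function depends on the first coordinate alone, and the
      index is a countably valued measurable function of the second alone.\<close>
    show "(\<lambda>z. k (fst z - y n (i n (snd z)))) \<in> borel_measurable (haar \<Otimes>\<^sub>M haar)"
      by (rule measurable_compose_countable[where g = "\<lambda>z. i n (snd z)" and f = "\<lambda>j z. k (fst z - y n j)"]) measurable
  next
    fix z :: "'a \<times> 'a"
    have "(\<lambda>n. k (fst z - y n (i n (snd z))) - k (fst z - snd z)) \<longlonglongrightarrow> 0"
    proof (rule Lim_null_comparison)
      show "\<forall>\<^sub>F n in sequentially. cmod (k (fst z - y n (i n (snd z))) - k (fst z - snd z)) \<le> 1 / Suc n"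
        using le by (auto simp: norm_minus_commute)
      show "(\<lambda>n. 1 / real (Suc n)) \<longlonglongrightarrow> 0" by (rule LIMSEQ_Suc[OF lim_1_over_n])
    qed
    then show "(\<lambda>n. k (fst z - y n (i n (snd z)))) \<longlonglongrightarrow> (case z of (x, y) \<Rightarrow> k (x - y))"
      by (simp add: case_prod_beta LIM_zero_iff)
  qed
qed

section \<open>The spaces \<open>Lp\<close>\<close>

abbreviation bmeas :: "('a::topological_space \<Rightarrow> complex) \<Rightarrow> bool" where
  "bmeas f \<equiv> f \<in> borel_measurable borel"

lemma L0_of_abs: "bmeas f \<Longrightarrow> L0_of f = abs_L0 f"
  by (simp add: L0_of.abs_eq L0_of_def)

lemma ae_rel_refl: "bmeas f \<Longrightarrow> ae_rel f f"
  by (simp add: ae_rel_def)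

text \<open>Every class has a Borel representative. Statements about \<open>L0\<close> are reduced
  to statements about functions by this rule and the rewrite rules for \<open>L0_of\<close>
  below.\<close>

lemma L0_of_cases:
  obtains f where "bmeas f" "F = L0_of f"
proof -
  have "ae_rel (rep_L0 F) (rep_L0 F)" "abs_L0 (rep_L0 F) = F"
    using Quotient3_rep_reflp[OF Quotient3_L0] Quotient3_abs_rep[OF Quotient3_L0] by auto
  then show ?thesis using that[of "rep_L0 F"] L0_of_abs[of "rep_L0 F"] by (auto simp: ae_rel_def)
qed

lemma L0_of_eq_iff:
  assumes "bmeas f" "bmeas g"
  shows "L0_of f = L0_of g \<longleftrightarrow> (AE x in haar. f x = g x)"
  using assms Quotient3_rel[OF Quotient3_L0, of f g] by (simp add: L0_of_abs ae_rel_def)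

lemma L0_of_0: "0 = L0_of (\<lambda>_. 0)" and L0_of_1: "1 = L0_of (\<lambda>_. 1)"
  by (simp_all add: L0_of_abs zero_L0_def one_L0_def)

lemma L0_of_add: "bmeas f \<Longrightarrow> bmeas g \<Longrightarrow> L0_of f + L0_of g = L0_of (\<lambda>x. f x + g x)"
  by (simp add: L0_of_abs plus_L0.abs_eq ae_rel_refl)

lemma L0_of_diff: "bmeas f \<Longrightarrow> bmeas g \<Longrightarrow> L0_of f - L0_of g = L0_of (\<lambda>x. f x - g x)"
  by (simp add: L0_of_abs minus_L0.abs_eq ae_rel_refl)

lemma L0_of_mult: "bmeas f \<Longrightarrow> bmeas g \<Longrightarrow> L0_of f * L0_of g = L0_of (\<lambda>x. f x * g x)"
  by (simp add: L0_of_abs times_L0.abs_eq ae_rel_refl)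

lemma L0_of_scale: "bmeas f \<Longrightarrow> scale_L0 c (L0_of f) = L0_of (\<lambda>x. c * f x)"
  by (simp add: L0_of_abs scale_L0.abs_eq ae_rel_refl)

lemma L0_of_sum:
  assumes "\<And>i. i \<in> I \<Longrightarrow> bmeas (f i)"
  shows "(\<Sum>i\<in>I. L0_of (f i)) = L0_of (\<lambda>x. \<Sum>i\<in>I. f i x)"
  using assms by (induction I rule: infinite_finite_induct) (simp_all add: L0_of_0 L0_of_add)

lemma in_Lp_L0_of: "bmeas f \<Longrightarrow> in_Lp p (L0_of f) \<longleftrightarrow> p_integrable haar p f"
  by (simp add: L0_of_abs in_Lp.abs_eq ae_rel_refl p_integrable_def)

lemma Lp_norm_L0_of: "bmeas f \<Longrightarrow> Lp_norm p (L0_of f) = pnorm haar p f"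
  by (simp add: L0_of_abs Lp_norm.abs_eq ae_rel_refl pnorm_def)

lemma in_Linf_L0_of: "bmeas f \<Longrightarrow> in_Linf (L0_of f) \<longleftrightarrow> (\<exists>C. AE x in haar. cmod (f x) \<le> C)"
  by (simp add: L0_of_abs in_Linf.abs_eq ae_rel_refl)

lemma Lp_cases:
  assumes "F \<in> Lp p"
  obtains f where "bmeas f" "p_integrable haar p f" "F = L0_of f"
  using assms by (metis L0_of_cases Lp_def in_Lp_L0_of mem_Collect_eq)

lemma L0_of_in_Lp: "bmeas f \<Longrightarrow> L0_of f \<in> Lp p \<longleftrightarrow> p_integrable haar p f"
  by (simp add: Lp_def in_Lp_L0_of)

lemma p_integrable_bmeas: "p_integrable haar p f \<Longrightarrow> bmeas f"
  by (simp add: p_integrable_def)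

lemma Lp_0 [simp]: "0 \<in> Lp p"
  by (simp add: L0_of_0 L0_of_in_Lp p_integrable_def)

lemma Lp_add: "1 \<le> p \<Longrightarrow> f \<in> Lp p \<Longrightarrow> g \<in> Lp p \<Longrightarrow> f + g \<in> Lp p"
  by (elim Lp_cases) (simp add: L0_of_add L0_of_in_Lp p_integrable_add)

lemma Lp_scale: "f \<in> Lp p \<Longrightarrow> scale_L0 c f \<in> Lp p"
  by (elim Lp_cases) (simp add: L0_of_scale L0_of_in_Lp p_integrable_cmult)

lemma scale_minus_one: "scale_L0 (-1) f = - f"
  by (metis L0.scale_minus_left L0.scale_one)

lemma Lp_uminus: "f \<in> Lp p \<Longrightarrow> - f \<in> Lp p"
  using Lp_scale[of f p "-1"] by (simp add: scale_minus_one)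

lemma Lp_diff: "1 \<le> p \<Longrightarrow> f \<in> Lp p \<Longrightarrow> g \<in> Lp p \<Longrightarrow> f - g \<in> Lp p"
  using Lp_add[of p f "-g"] by (simp add: Lp_uminus)

lemma Lp_subspace: "1 \<le> p \<Longrightarrow> L0.subspace (Lp p)"
  by (auto simp: L0.subspace_def Lp_add Lp_scale)

lemma Lp_norm_nonneg [simp]: "0 \<le> Lp_norm p f"
  by (rule L0_of_cases[of f]) (simp add: Lp_norm_L0_of)

lemma Lp_norm_0 [simp]: "Lp_norm p 0 = 0"
  by (simp add: L0_of_0 Lp_norm_L0_of pnorm_def)

lemma Lp_norm_add: "1 \<le> p \<Longrightarrow> f \<in> Lp p \<Longrightarrow> g \<in> Lp p \<Longrightarrow> Lp_norm p (f + g) \<le> Lp_norm p f + Lp_norm p g"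
  by (elim Lp_cases) (simp add: L0_of_add Lp_norm_L0_of pnorm_add)

lemma Lp_norm_scale: "0 < p \<Longrightarrow> Lp_norm p (scale_L0 c f) = cmod c * Lp_norm p f"
  by (rule L0_of_cases[of f]) (simp add: Lp_norm_L0_of L0_of_scale pnorm_cmult)

lemma Lp_norm_uminus: "0 < p \<Longrightarrow> Lp_norm p (- f) = Lp_norm p f"
  using Lp_norm_scale[of p "-1" f] by (simp add: scale_minus_one)

lemma Lp_norm_minus_commute: "0 < p \<Longrightarrow> Lp_norm p (f - g) = Lp_norm p (g - f)"
  by (metis Lp_norm_uminus minus_diff_eq)

lemma Lp_norm_diff: "1 \<le> p \<Longrightarrow> f \<in> Lp p \<Longrightarrow> g \<in> Lp p \<Longrightarrow> Lp_norm p (f - g) \<le> Lp_norm p f + Lp_norm p g"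
  using Lp_norm_add[of p f "-g"] by (simp add: Lp_uminus Lp_norm_uminus)

lemma Lp_norm_eq_0: "0 < p \<Longrightarrow> f \<in> Lp p \<Longrightarrow> Lp_norm p f = 0 \<longleftrightarrow> f = 0"
proof (elim Lp_cases, safe)
  fix f' assume "0 < p" "bmeas f'" "p_integrable haar p f'" "Lp_norm p (L0_of f') = 0"
  then show "L0_of f' = 0"
    using pnorm_eq_0[of haar p f'] by (simp add: Lp_norm_L0_of L0_of_0 L0_of_eq_iff)
qed (simp add: Lp_norm_L0_of pnorm_def flip: L0_of_0)

lemma Lp_norm_sum:
  assumes "1 \<le> p" "\<And>i. i \<in> I \<Longrightarrow> f i \<in> Lp p"
  shows "Lp_norm p (\<Sum>i\<in>I. f i) \<le> (\<Sum>i\<in>I. Lp_norm p (f i))"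
  using assms(2)
proof (induction I rule: infinite_finite_induct)
  case (insert i I)
  have "(\<Sum>i\<in>I. f i) \<in> Lp p"
    using insert.prems by (intro L0.subspace_sum[OF Lp_subspace[OF assms(1)]]) auto
  then have "Lp_norm p (f i + (\<Sum>i\<in>I. f i)) \<le> Lp_norm p (f i) + Lp_norm p (\<Sum>i\<in>I. f i)"
    using insert.prems assms(1) by (intro Lp_norm_add) auto
  then show ?case using insert by auto
qed auto

lemma Linf_mult:
  assumes "\<phi> \<in> Linf"
  obtains C where "0 \<le> C" "\<And>p f. 0 < p \<Longrightarrow> f \<in> Lp p \<Longrightarrow> \<phi> * f \<in> Lp p"
    "\<And>p f. 0 < p \<Longrightarrow> f \<in> Lp p \<Longrightarrow> Lp_norm p (\<phi> * f) \<le> C * Lp_norm p f"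
proof -
  obtain h where h: "bmeas h" "\<phi> = L0_of h" by (rule L0_of_cases)
  with assms obtain C where C: "AE x in haar. cmod (h x) \<le> C"
    by (auto simp: Linf_def in_Linf_L0_of)
  then have C': "AE x in haar. cmod (h x) \<le> max C 0" by (auto elim: eventually_mono)
  have *: "\<phi> * f \<in> Lp p \<and> Lp_norm p (\<phi> * f) \<le> max C 0 * Lp_norm p f" if p: "0 < p" and "f \<in> Lp p" for p f
  proof -
    obtain f' where f': "bmeas f'" "p_integrable haar p f'" "f = L0_of f'" using \<open>f \<in> Lp p\<close> by (rule Lp_cases)
    show ?thesis
      using pnorm_bounded_mult[OF f'(2) _ C' p] h f' by (simp add: L0_of_mult L0_of_in_Lp Lp_norm_L0_of)
  qed
  show ?thesis by (rule that[of "max C 0"]) (use * in auto)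
qed

section \<open>Integral and conjugation on classes of functions\<close>

lemma bmeas_cnj [simp]: "bmeas f \<Longrightarrow> bmeas (\<lambda>x. cnj (f x))"
  by (rule borel_measurable_continuous_on[where f = cnj]) (intro continuous_intros)

lift_definition integral_L0 :: "'a::compact_ab_group L0 \<Rightarrow> complex" is "\<lambda>f. LINT x|haar. f x"
  unfolding ae_rel_def by (intro integral_cong_AE) auto

lift_definition cnj_L0 :: "'a::compact_ab_group L0 \<Rightarrow> 'a L0" is "\<lambda>f x. cnj (f x)"
  unfolding ae_rel_def by auto

lemma integral_L0_of: "bmeas f \<Longrightarrow> integral_L0 (L0_of f) = (LINT x|haar. f x)"
  by (simp add: L0_of_abs integral_L0.abs_eq ae_rel_refl)

lemma cnj_L0_of: "bmeas f \<Longrightarrow> cnj_L0 (L0_of f) = L0_of (\<lambda>x. cnj (f x))"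
  by (simp add: L0_of_abs cnj_L0.abs_eq ae_rel_refl)

lemma cnj_L0_add: "cnj_L0 (f + g) = cnj_L0 f + cnj_L0 g"
  by (rule L0_of_cases[of f], rule L0_of_cases[of g]) (simp add: L0_of_add cnj_L0_of)

lemma cnj_L0_mult: "cnj_L0 (f * g) = cnj_L0 f * cnj_L0 g"
  by (rule L0_of_cases[of f], rule L0_of_cases[of g]) (simp add: L0_of_mult cnj_L0_of)

lemma cnj_L0_scale: "cnj_L0 (scale_L0 c f) = scale_L0 (cnj c) (cnj_L0 f)"
  by (rule L0_of_cases[of f]) (simp add: L0_of_scale cnj_L0_of)

lemma cnj_cnj_L0 [simp]: "cnj_L0 (cnj_L0 f) = f"
  by (rule L0_of_cases[of f]) (simp add: cnj_L0_of)

lemma cnj_L0_0 [simp]: "cnj_L0 0 = 0"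
  by (simp add: L0_of_0 cnj_L0_of)

lemma cnj_L0_sum: "cnj_L0 (\<Sum>i\<in>I. f i) = (\<Sum>i\<in>I. cnj_L0 (f i))"
  by (induction I rule: infinite_finite_induct) (auto simp: cnj_L0_add)

lemma Lp_cnj: "cnj_L0 f \<in> Lp p \<longleftrightarrow> f \<in> Lp p"
  by (rule L0_of_cases[of f]) (simp add: cnj_L0_of L0_of_in_Lp p_integrable_def)

lemma Lp_norm_cnj [simp]: "Lp_norm p (cnj_L0 f) = Lp_norm p f"
  by (rule L0_of_cases[of f]) (simp add: cnj_L0_of Lp_norm_L0_of pnorm_def)

lemma scale_L0_mult_left: "scale_L0 c f * g = scale_L0 c (f * g)"
  and scale_L0_mult_right: "f * scale_L0 c g = scale_L0 c (f * g)"
  by (rule L0_of_cases[of f], rule L0_of_cases[of g], simp add: L0_of_scale L0_of_mult algebra_simps)+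

lemma p_integrable_1_iff: "p_integrable haar 1 f \<longleftrightarrow> bmeas f \<and> integrable haar f"
  by (auto simp: p_integrable_def integrable_norm_iff)

lemma integral_L0_add:
  "f \<in> Lp 1 \<Longrightarrow> g \<in> Lp 1 \<Longrightarrow> integral_L0 (f + g) = integral_L0 f + integral_L0 g"
  by (elim Lp_cases) (simp add: L0_of_add integral_L0_of p_integrable_1_iff)

lemma integral_L0_diff:
  "f \<in> Lp 1 \<Longrightarrow> g \<in> Lp 1 \<Longrightarrow> integral_L0 (f - g) = integral_L0 f - integral_L0 g"
  by (elim Lp_cases) (simp add: L0_of_diff integral_L0_of p_integrable_1_iff)

lemma integral_L0_scale: "integral_L0 (scale_L0 c f) = c * integral_L0 f"
  by (rule L0_of_cases[of f]) (simp add: L0_of_scale integral_L0_of)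

lemma integral_L0_0 [simp]: "integral_L0 0 = 0"
  by (simp add: L0_of_0 integral_L0_of)

lemma integral_L0_sum:
  assumes "\<And>i. i \<in> I \<Longrightarrow> f i \<in> Lp 1"
  shows "integral_L0 (\<Sum>i\<in>I. f i) = (\<Sum>i\<in>I. integral_L0 (f i))"
  using assms
  by (induction I rule: infinite_finite_induct)
     (auto simp: integral_L0_add L0.subspace_sum[OF Lp_subspace[of 1]])

lemma Lp_imp_L1:
  assumes "1 < p" "f \<in> Lp p"
  shows "f \<in> Lp 1" "Lp_norm 1 f \<le> Lp_norm p f"
proof -
  obtain f' where f': "bmeas f'" "p_integrable haar p f'" "f = L0_of f'" using assms(2) by (rule Lp_cases)
  have "emeasure haar (space haar) = 1" by (simp add: emeasure_haar_UNIV)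
  from pnorm_1_le[OF f'(2) this assms(1)] f' show "f \<in> Lp 1" "Lp_norm 1 f \<le> Lp_norm p f"
    by (simp_all add: L0_of_in_Lp p_integrable_1_iff Lp_norm_L0_of) (simp add: pnorm_def)
qed

lemma integral_L0_norm: "f \<in> Lp 1 \<Longrightarrow> cmod (integral_L0 f) \<le> Lp_norm 1 f"
  by (elim Lp_cases) (simp add: integral_L0_of Lp_norm_L0_of pnorm_def)

lemma Hoelder_L0:
  assumes "f \<in> Lp p" "g \<in> Lp q" "1 < p" "1 < q" "1/p + 1/q = 1"
  shows "f * g \<in> Lp 1" "cmod (integral_L0 (f * g)) \<le> Lp_norm p f * Lp_norm q g"
proof -
  obtain f' where f': "bmeas f'" "p_integrable haar p f'" "f = L0_of f'" using assms(1) by (rule Lp_cases)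
  obtain g' where g': "bmeas g'" "p_integrable haar q g'" "g = L0_of g'" using assms(2) by (rule Lp_cases)
  note H = Hoelder[OF f'(2) g'(2) assms(3-5)]
  have fg: "f * g = L0_of (\<lambda>x. f' x * g' x)" using f' g' by (simp add: L0_of_mult)
  have m: "bmeas (\<lambda>x. f' x * g' x)" using f' g' by simp
  show "f * g \<in> Lp 1" using H m by (simp add: fg L0_of_in_Lp p_integrable_1_iff)
  show "cmod (integral_L0 (f * g)) \<le> Lp_norm p f * Lp_norm q g"
    using order.trans[OF integral_norm_bound H(2)] m f' g' unfolding fg by (simp add: integral_L0_of Lp_norm_L0_of)
qed

text \<open>A subsequence with geometrically small increments converges by
  \<open>Riesz_Fischer_fast\<close>, and a Cauchy sequence converges to the limit of its
  subsequence.\<close>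

lemma Lp_complete:
  fixes f :: "nat \<Rightarrow> 'a::compact_ab_group L0"
  assumes p: "1 < p" and f: "\<And>n. f n \<in> Lp p"
    and cauchy: "\<And>e. 0 < e \<Longrightarrow> \<exists>N. \<forall>m\<ge>N. \<forall>n\<ge>N. Lp_norm p (f m - f n) < e"
  obtains g where "g \<in> Lp p" "(\<lambda>n. Lp_norm p (f n - g)) \<longlonglongrightarrow> 0"
proof -
  have "\<exists>N. \<forall>m\<ge>N. \<forall>n\<ge>N. Lp_norm p (f m - f n) < (1/2)^k" for k :: nat
    by (rule cauchy) simp
  then obtain N where N: "\<And>k m n. m \<ge> N k \<Longrightarrow> n \<ge> N k \<Longrightarrow> Lp_norm p (f m - f n) < (1/2)^k"
    by metis
  \<comment> \<open>The sum serves as a running maximum: \<open>r m\<close> is at least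
    \<open>N k\<close> whenever \<open>k \<le> m\<close>.\<close>
  define r where "r k = (\<Sum>i\<le>k. N i)" for k
  have rN: "N k \<le> r m" if "k \<le> m" for k m
    unfolding r_def using that by (intro member_le_sum) auto
  have "\<exists>f'. bmeas f' \<and> p_integrable haar p f' \<and> f n = L0_of f'" for n
    using f[of n] by (elim Lp_cases) blast
  then obtain f' where f': "\<And>n. bmeas (f' n)" "\<And>n. p_integrable haar p (f' n)" "\<And>n. f n = L0_of (f' n)"
    by metis
  have fast: "pnorm haar p (\<lambda>x. f' (r m) x - f' (r n) x) \<le> (1/2)^n" if "n \<le> m" for m n
    using N[of n "r m" "r n"] rN[OF that] rN[of n n] f' by (simp add: L0_of_diff Lp_norm_L0_of)
  have "emeasure haar (space haar) = 1" by (simp add: emeasure_haar_UNIV)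
  from Riesz_Fischer_fast[OF this p f'(2) fast]
  obtain g' where g': "p_integrable haar p g'" "\<And>n. pnorm haar p (\<lambda>x. g' x - f' (r n) x) \<le> (1/2)^n" by blast
  define g where "g = L0_of g'"
  have g: "g \<in> Lp p" using g' by (simp add: g_def L0_of_in_Lp p_integrable_bmeas)
  have gn: "Lp_norm p (g - f (r n)) \<le> (1/2)^n" for n
    using g'(2)[of n] f'(1,3) p_integrable_bmeas[OF g'(1)] by (simp add: g_def L0_of_diff Lp_norm_L0_of)
  have "(\<lambda>n. Lp_norm p (f n - g)) \<longlonglongrightarrow> 0"
  proof (rule LIMSEQ_I)
    fix e :: real assume e: "0 < e"
    obtain k where k: "(1/2)^k < e/2" using real_arch_pow_inv[of "e/2" "1/2"] e by auto
    have "norm (Lp_norm p (f n - g) - 0) < e" if n: "n \<ge> N k" for n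
    proof -
      have "f n - g = (f n - f (r k)) - (g - f (r k))" by simp
      then have "Lp_norm p (f n - g) \<le> Lp_norm p (f n - f (r k)) + Lp_norm p (g - f (r k))"
        using p by (metis Lp_norm_diff Lp_diff f g less_imp_le)
      also have "\<dots> < e"
        using N[OF n rN[of k k]] gn[of k] k by auto
      finally show ?thesis by simp
    qed
    then show "\<exists>no. \<forall>n\<ge>no. norm (Lp_norm p (f n - g) - 0) < e" by blast
  qed
  with g show ?thesis using that by blast
qed

text \<open>Nonempty open sets have positive measure, so a class contains at most one continuous
  function. This carries linear relations in \<open>L0\<close> back to continuous functions.\<close>

lemma L0_of_continuous_eq:
  assumes f: "continuous_on UNIV f" and g: "continuous_on UNIV g" and eq: "L0_of f = L0_of g"
  shows "f = g"
proof
  fix x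
  have [measurable]: "bmeas f" "bmeas g" using f g by (auto intro: borel_measurable_continuous_UNIV)
  have "AE x in haar. f x = g x" using eq by (simp add: L0_of_eq_iff)
  then have "AE x in haar. (cmod (f x - g x))\<^sup>2 = 0" by eventually_elim simp
  then have "(LINT x|haar. (cmod (f x - g x))\<^sup>2) = 0"
    by (intro integral_eq_zero_AE) simp
  with continuous_integral_square_0[of "\<lambda>x. f x - g x" x] f g show "f x = g x"
    by (auto intro: continuous_intros)
qed

section \<open>Convolution by a hermitian kernel\<close>

abbreviation cont :: "('a::topological_space \<Rightarrow> complex) \<Rightarrow> bool" where
  "cont f \<equiv> continuous_on UNIV f"

definition sq_norm :: "('a::compact_ab_group \<Rightarrow> complex) \<Rightarrow> real" where
  "sq_norm u = (LINT x|haar. (cmod (u x))\<^sup>2)"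

definition inner_L2 :: "('a::compact_ab_group \<Rightarrow> complex) \<Rightarrow> ('a \<Rightarrow> complex) \<Rightarrow> complex" where
  "inner_L2 u v = (LINT x|haar. u x * cnj (v x))"

lemma sq_norm_nonneg [simp]: "0 \<le> sq_norm u"
  by (simp add: sq_norm_def)

lemma sq_norm_eq_0: "cont u \<Longrightarrow> sq_norm u = 0 \<Longrightarrow> u x = 0"
  unfolding sq_norm_def by (rule continuous_integral_square_0)

lemma inner_L2_integrable: "cont u \<Longrightarrow> cont v \<Longrightarrow> integrable haar (\<lambda>x. u x * cnj (v x))"
  by (intro continuous_integrable continuous_intros)

lemma inner_L2_self: "cont u \<Longrightarrow> inner_L2 u u = of_real (sq_norm u)"
  unfolding inner_L2_def sq_norm_def
  by (subst integral_complex_of_real[symmetric]) (simp only: complex_norm_square)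

lemma inner_L2_commute: "inner_L2 v u = cnj (inner_L2 u v)"
  by (simp add: inner_L2_def mult.commute flip: Bochner_Integration.integral_cnj)

lemma inner_L2_diff_left: "cont u \<Longrightarrow> cont v \<Longrightarrow> cont w \<Longrightarrow> inner_L2 (\<lambda>x. u x - v x) w = inner_L2 u w - inner_L2 v w"
  unfolding inner_L2_def by (simp add: left_diff_distrib inner_L2_integrable)

lemma inner_L2_cmult_left: "inner_L2 (\<lambda>x. c * u x) w = c * inner_L2 u w"
  by (simp add: inner_L2_def mult.assoc)

lemma inner_L2_cmult_right: "inner_L2 u (\<lambda>x. c * w x) = cnj c * inner_L2 u w"
  by (subst inner_L2_commute, subst inner_L2_cmult_left, subst inner_L2_commute) simp

lemma inner_L2_sum_left:
  assumes "\<And>i. i \<in> I \<Longrightarrow> cont (u i)" "cont w"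
  shows "inner_L2 (\<lambda>x. \<Sum>i\<in>I. u i x) w = (\<Sum>i\<in>I. inner_L2 (u i) w)"
  unfolding inner_L2_def using assms by (simp add: sum_distrib_right inner_L2_integrable)

text \<open>Needed twice: with \<open>c\<close> a Fourier coefficient for Bessel's inequality, and
  with \<open>c\<close> the eigenvalue for approximate eigenvectors.\<close>

lemma sq_norm_diff_cmult:
  assumes "cont u" "cont v"
  shows "sq_norm (\<lambda>x. u x - c * v x) = sq_norm u - 2 * Re (cnj c * inner_L2 u v) + (cmod c)\<^sup>2 * sq_norm v"
proof -
  have "of_real (sq_norm (\<lambda>x. u x - c * v x)) = inner_L2 (\<lambda>x. u x - c * v x) (\<lambda>x. u x - c * v x)"
    using assms by (subst inner_L2_self) (auto intro!: continuous_intros)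
  also have "\<dots> = inner_L2 u (\<lambda>x. u x - c * v x) - c * inner_L2 v (\<lambda>x. u x - c * v x)"
    using assms by (subst inner_L2_diff_left) (auto intro!: continuous_intros simp: inner_L2_cmult_left)
  also have "inner_L2 u (\<lambda>x. u x - c * v x) = inner_L2 u u - cnj c * inner_L2 u v"
    using assms
    by (subst (1 2 3) inner_L2_commute)
       (simp add: inner_L2_diff_left inner_L2_cmult_left continuous_on_mult_left)
  also have "inner_L2 v (\<lambda>x. u x - c * v x) = inner_L2 v u - cnj c * inner_L2 v v"
    using assms
    by (subst (1 2 3) inner_L2_commute)
       (simp add: inner_L2_diff_left inner_L2_cmult_left continuous_on_mult_left)
  finally have "of_real (sq_norm (\<lambda>x. u x - c * v x)) = inner_L2 u u - cnj c * inner_L2 u v - c * (inner_L2 v u - cnj c * inner_L2 v v)" .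
  also have "\<dots> = of_real (sq_norm u) - (cnj c * inner_L2 u v + cnj (cnj c * inner_L2 u v)) + (c * cnj c) * of_real (sq_norm v)"
    using assms by (simp add: inner_L2_self inner_L2_commute[of v u] algebra_simps)
  also have "\<dots> = of_real (sq_norm u - 2 * Re (cnj c * inner_L2 u v) + (cmod c)\<^sup>2 * sq_norm v)"
    by (simp only: complex_add_cnj complex_norm_square[symmetric]) simp
  finally show ?thesis by (simp only: of_real_eq_iff)
qed

lemma sq_norm_cmult: "sq_norm (\<lambda>x. c * u x) = (cmod c)\<^sup>2 * sq_norm u"
  by (simp add: sq_norm_def norm_mult power_mult_distrib)

lemma sq_norm_bound:
  assumes "cont u" "\<And>x. cmod (u x) \<le> B"
  shows "sq_norm u \<le> B\<^sup>2"
proof -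
  have "sq_norm u \<le> (LINT x|(haar::'a measure). B\<^sup>2)"
    unfolding sq_norm_def using assms
    by (intro integral_mono continuous_integrable) (auto intro!: continuous_intros power_mono)
  then show ?thesis by simp
qed

lemma sq_norm_add_le:
  assumes "cont u" "cont v"
  shows "sq_norm (\<lambda>x. u x + v x) \<le> 2 * sq_norm u + 2 * sq_norm v"
proof -
  have "(cmod (a + b))\<^sup>2 \<le> 2 * (cmod a)\<^sup>2 + 2 * (cmod b)\<^sup>2" for a b
  proof -
    have "(cmod (a + b))\<^sup>2 \<le> (cmod a + cmod b)\<^sup>2"
      by (intro power_mono norm_triangle_ineq) auto
    also have "\<dots> \<le> 2 * (cmod a)\<^sup>2 + 2 * (cmod b)\<^sup>2"
      using sum_squares_bound[of "cmod a" "cmod b"] by (simp add: power2_sum)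
    finally show ?thesis .
  qed
  then have "sq_norm (\<lambda>x. u x + v x) \<le> (LINT x|haar. 2 * (cmod (u x))\<^sup>2 + 2 * (cmod (v x))\<^sup>2)"
    unfolding sq_norm_def using assms
    by (intro integral_mono continuous_integrable) (auto intro!: continuous_intros)
  also have "\<dots> = 2 * sq_norm u + 2 * sq_norm v"
    unfolding sq_norm_def using assms
    by (subst Bochner_Integration.integral_add) (auto intro!: continuous_integrable continuous_intros)
  finally show ?thesis .
qed

text \<open>Cauchy-Schwarz against the constant 1, which has norm 1.\<close>

lemma integral_norm_le_sqn:
  assumes "cont u"
  shows "(LINT x|haar. cmod (u x)) \<le> sqrt (sq_norm u)"
proof -
  have "p_integrable haar 2 u"
    using assms by (auto simp: p_integrable_def intro!: continuous_integrable continuous_intros borel_measurable_continuous_UNIV)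
  from pnorm_1_le(2)[OF this] have "(LINT x|haar. cmod (u x)) \<le> pnorm haar 2 u"
    by (simp add: emeasure_haar_UNIV)
  also have "\<dots> = sqrt (sq_norm u)"
    by (simp add: pnorm_def sq_norm_def powr_half_sqrt)
  finally show ?thesis .
qed

lemma cont_reflect: "cont k \<Longrightarrow> cont (\<lambda>y. k (x - y :: 'a::compact_ab_group))"
  by (rule continuous_on_compose2[of UNIV k]) (auto intro!: continuous_intros)

lemma cont_translate: "cont k \<Longrightarrow> cont (\<lambda>y. k (y + x :: 'a::compact_ab_group))"
  by (rule continuous_on_compose2[of UNIV k]) (auto intro!: continuous_intros)

lemma sq_norm_translate:
  assumes "cont u"
  shows "sq_norm (\<lambda>x. u (x + b)) = sq_norm u"
proof -
  have "(\<lambda>x. (cmod (u x))\<^sup>2) \<in> borel_measurable borel"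
    using assms by (intro borel_measurable_continuous_onI continuous_intros)
  from integral_translate[OF this, of b] show ?thesis
    by (simp add: sq_norm_def add.commute)
qed

lemma norm_integral_le:
  fixes f :: "'b \<Rightarrow> complex"
  assumes "integrable M f" "integrable M g" "\<And>x. cmod (f x) \<le> g x"
  shows "cmod (LINT x|M. f x) \<le> (LINT x|M. g x)"
  using assms by (intro order.trans[OF integral_norm_bound integral_mono] integrable_norm) auto

text \<open>In the second assumption \<open>g\<close> colours the indices with finitely many colours
  such that functions of equal colour are uniformly \<open>e\<close>-close. This is total
  boundedness for the sup norm, so there is a Cauchy subsequence, which converges uniformly.\<close>

lemma subsequence_uniform_Cauchy:
  fixes v :: "nat \<Rightarrow> 'a::compact_ab_group \<Rightarrow> complex"
  assumes v: "\<And>n. cont (v n)"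
    and tb: "\<And>e. 0 < e \<Longrightarrow> \<exists>g :: nat \<Rightarrow> 'c. finite (range g) \<and> (\<forall>m n x. g m = g n \<longrightarrow> cmod (v m x - v n x) \<le> e)"
  obtains r w where "strict_mono (r :: nat \<Rightarrow> nat)" "cont w" "uniform_limit UNIV (\<lambda>n. v (r n)) w sequentially"
proof -
  define V where "V n = Bcontfun (v n)" for n
  have bc: "v n \<in> bcontfun" for n
    using v[of n] continuous_bounded[OF v[of n]] by (auto simp: bcontfun_def bounded_iff)
  then have V: "apply_bcontfun (V n) = v n" for n
    by (simp add: V_def Bcontfun_inverse)
  have "Met_TC.mtotally_bounded (range V)"
    unfolding Met_TC.mtotally_bounded_def
  proof (intro allI impI)
    fix e :: real assume e: "0 < e"
    obtain g :: "nat \<Rightarrow> 'c" where g: "finite (range g)" "\<And>m n x. g m = g n \<Longrightarrow> cmod (v m x - v n x) \<le> e / 2"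
      using tb[of "e/2"] e by auto
    define rep where "rep c = (SOME n. g n = c)" for c
    have rep: "g (rep (g n)) = g n" for n
      unfolding rep_def by (rule someI_ex) auto
    let ?K = "(\<lambda>c. V (rep c)) ` range g"
    have "V n \<in> ball (V (rep (g n))) e" for n
    proof -
      have "dist (V (rep (g n))) (V n) \<le> e / 2"
        by (rule dist_bound) (use g(2)[OF rep] in \<open>auto simp: V dist_norm\<close>)
      then show ?thesis using e by simp
    qed
    then have "range V \<subseteq> (\<Union>x\<in>?K. Met_TC.mball x e)"
      by auto
    then show "\<exists>K. finite K \<and> K \<subseteq> range V \<and> range V \<subseteq> (\<Union>x\<in>K. Met_TC.mball x e)"
      using g(1) by (intro exI[of _ ?K]) auto
  qed
  then obtain r where r: "strict_mono r" "Cauchy (V \<circ> r)"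
    unfolding Met_TC.mtotally_bounded_sequentially MCauchy_iff_Cauchy by blast
  have "\<forall>e>0. \<exists>N. \<forall>m n x. N \<le> m \<and> N \<le> n \<and> True \<longrightarrow> dist (v (r m) x) (v (r n) x) < e"
  proof (intro allI impI)
    fix e :: real assume "0 < e"
    with r(2) obtain N where N: "\<forall>m\<ge>N. \<forall>n\<ge>N. dist (V (r m)) (V (r n)) < e"
      unfolding Cauchy_def comp_def by blast
    have "dist (v (r m) x) (v (r n) x) < e" if "m \<ge> N" "n \<ge> N" for m n x
      using dist_bounded[of "V (r m)" x "V (r n)"] N that by (force simp: V)
    then show "\<exists>N. \<forall>m n x. N \<le> m \<and> N \<le> n \<and> True \<longrightarrow> dist (v (r m) x) (v (r n) x) < e" by blast
  qed
  then obtain w where "\<forall>e>0. \<exists>N. \<forall>n x. N \<le> n \<and> True \<longrightarrow> dist (v (r n) x) (w x) < e"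
    using uniformly_convergent_eq_cauchy[of "\<lambda>_. True" "\<lambda>n. v (r n)"] by blast
  then have w: "uniform_limit UNIV (\<lambda>n. v (r n)) w sequentially"
    by (auto simp: uniform_limit_sequentially_iff)
  then have "cont w"
    by (rule uniform_limit_theorem[rotated]) (simp_all add: v)
  with r(1) w show ?thesis using that by blast
qed

locale hermitian_kernel =
  fixes k :: "'a::compact_ab_group \<Rightarrow> complex" and B :: real
  assumes k: "cont k" and herm: "k (- x) = cnj (k x)" and B: "cmod (k x) \<le> B" "0 < B"
begin

definition K :: "('a \<Rightarrow> complex) \<Rightarrow> 'a \<Rightarrow> complex" where
  "K u x = (LINT y|haar. k (x - y) * u y)"

lemma K_integrable: "cont u \<Longrightarrow> integrable haar (\<lambda>y. k (x - y) * u y)"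
  by (intro continuous_integrable continuous_intros cont_reflect k)

text \<open>Convolution turns an L2 bound into a uniform bound. Limits of images under
  \<open>K\<close> can thus be taken uniformly and remain continuous.\<close>

lemma K_bound:
  assumes u: "cont u"
  shows "cmod (K u x) \<le> B * sqrt (sq_norm u)"
proof -
  have "cmod (K u x) \<le> (LINT y|haar. B * cmod (u y))"
    unfolding K_def
    by (rule norm_integral_le[OF K_integrable[OF u]])
       (use B u in \<open>auto intro!: continuous_integrable continuous_intros mult_right_mono simp: norm_mult\<close>)
  also have "\<dots> \<le> B * sqrt (sq_norm u)"
    using integral_norm_le_sqn[OF u] B by simp
  finally show ?thesis .
qed

lemma K_diff: "cont u \<Longrightarrow> cont v \<Longrightarrow> K (\<lambda>x. u x - v x) x = K u x - K v x"
  unfolding K_def by (simp add: right_diff_distrib K_integrable)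

lemma K_cmult: "K (\<lambda>x. c * u x) x = c * K u x"
  unfolding K_def by (simp add: mult.left_commute)

lemma K_cont:
  assumes u: "cont u"
  shows "cont (K u)"
  unfolding continuous_on_eq_continuous_within
proof
  fix x :: 'a
  \<comment> \<open>The summand 1 keeps the divisor positive if \<open>u\<close> is 0.\<close>
  let ?C = "sqrt (sq_norm u) + 1"
  have C: "?C > 0" by (simp add: add_nonneg_pos)
  show "continuous (at x within UNIV) (K u)"
    unfolding continuous_within tendsto_iff
  proof (intro allI impI)
    fix e :: real assume e: "0 < e"
    then have "e / (2 * ?C) > 0" using C by simp
    then obtain U where U: "open U" "0 \<in> U" "\<And>h x. h \<in> U \<Longrightarrow> cmod (k (x + h) - k x) \<le> e / (2 * ?C)"
      using uniformly_continuous_group[OF k] by blast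
    have le: "dist (K u (x + h)) (K u x) < e" if h: "h \<in> U" for h
    proof -
      have "K u (x + h) - K u x = (LINT y|haar. k (x + h - y) * u y - k (x - y) * u y)"
        unfolding K_def by (rule Bochner_Integration.integral_diff[symmetric]) (intro K_integrable u)+
      also have "cmod \<dots> \<le> (LINT y|haar. e / (2 * ?C) * cmod (u y))"
      proof (rule norm_integral_le)
        show "integrable haar (\<lambda>y. k (x + h - y) * u y - k (x - y) * u y)"
          by (intro Bochner_Integration.integrable_diff K_integrable u)
        show "integrable haar (\<lambda>y. e / (2 * ?C) * cmod (u y))"
          using u by (intro continuous_integrable continuous_intros)
        fix y
        have "cmod (k (x + h - y) - k (x - y)) \<le> e / (2 * ?C)"
          using U(3)[OF h, of "x - y"] by (simp only: diff_add_eq)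
        then have "cmod (k (x + h - y) - k (x - y)) * cmod (u y) \<le> e / (2 * ?C) * cmod (u y)"
          by (intro mult_right_mono) auto
        then show "cmod (k (x + h - y) * u y - k (x - y) * u y) \<le> e / (2 * ?C) * cmod (u y)"
          by (simp only: norm_mult left_diff_distrib[symmetric])
      qed
      also have "\<dots> \<le> e / (2 * ?C) * sqrt (sq_norm u)"
        using integral_norm_le_sqn[OF u] C e
        by (subst integral_mult_right_zero) (intro mult_left_mono divide_nonneg_nonneg, auto)
      also have "\<dots> \<le> e / (2 * ?C) * ?C"
        using C e by (intro mult_left_mono) auto
      also have "\<dots> = e / 2" using C by (simp add: field_simps)
      also have "\<dots> < e" using e by simp
      finally show ?thesis by (simp add: dist_norm)
    qed
    have "open ((\<lambda>z. z - x) -` U)" by (rule open_vimage[OF U(1)]) (intro continuous_intros)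
    moreover have "x \<in> (\<lambda>z. z - x) -` U" using U(2) by simp
    ultimately have "\<forall>\<^sub>F z in nhds x. z - x \<in> U"
      by (auto simp: eventually_nhds intro!: exI[of _ "(\<lambda>z. z - x) -` U"])
    then have "\<forall>\<^sub>F z in at x. z - x \<in> U"
      unfolding eventually_at_filter by eventually_elim simp
    then show "\<forall>\<^sub>F z in at x. dist (K u z) (K u x) < e"
      by eventually_elim (use le[of "_ - x"] in auto)
  qed
qed

text \<open>By invariance of the measure \<open>K\<close> commutes with translations, so its
  eigenspaces are translation-invariant.\<close>

lemma K_translate:
  assumes "cont u"
  shows "K (\<lambda>y. u (y + b)) x = K u (x + b)"
proof -
  have m: "(\<lambda>y. k (x + b - y) * u y) \<in> borel_measurable borel"
    using assms by (intro borel_measurable_continuous_UNIV continuous_intros cont_reflect k)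
  have "K u (x + b) = (LINT y|haar. k (x + b - (b + y)) * u (b + y))"
    unfolding K_def using integral_translate[OF m, of b] by simp
  also have "\<dots> = K (\<lambda>y. u (y + b)) x"
    unfolding K_def by (simp add: algebra_simps)
  finally show ?thesis ..
qed

text \<open>Fubini's theorem and \<open>herm\<close>. The integrand is bounded, and
  \<open>kernel_measurable\<close> makes it measurable for the product sigma-algebra.\<close>

lemma K_symmetric:
  assumes u: "cont u" and v: "cont v"
  shows "inner_L2 (K u) v = inner_L2 u (K v)"
proof -
  obtain C where C: "0 < C" "\<And>x. cmod (u x) \<le> C" using continuous_bounded[OF u] by blast
  obtain D where D: "0 < D" "\<And>x. cmod (v x) \<le> D" using continuous_bounded[OF v] by blast
  have [measurable]: "u \<in> borel_measurable haar" "(\<lambda>x. cnj (v x)) \<in> borel_measurable haar"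
    using u v by (auto intro: borel_measurable_continuous_UNIV)
  note [measurable] = kernel_measurable[OF k]
  have m: "(\<lambda>z. k (fst z - snd z) * u (snd z) * cnj (v (fst z))) \<in> borel_measurable (haar \<Otimes>\<^sub>M haar)"
    using kernel_measurable[OF k] by (intro borel_measurable_times) (auto simp: case_prod_beta)
  have fin: "finite_measure ((haar :: 'a measure) \<Otimes>\<^sub>M haar)"
    by (intro finite_measure_pair_measure finite_measure_haar)
  have int: "integrable (haar \<Otimes>\<^sub>M haar) (\<lambda>(x, y). k (x - y) * u y * cnj (v x))"
    unfolding case_prod_beta
  proof (rule finite_measure.integrable_const_bound[OF fin _ m])
    show "AE z in haar \<Otimes>\<^sub>M haar. cmod (k (fst z - snd z) * u (snd z) * cnj (v (fst z))) \<le> B * C * D"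
      using B C D by (auto simp: norm_mult intro!: mult_mono AE_I2)
  qed
  have "inner_L2 (K u) v = (LINT x|haar. (LINT y|haar. k (x - y) * u y * cnj (v x)))"
    by (simp add: inner_L2_def K_def)
  also have "\<dots> = (LINT y|haar. (LINT x|haar. k (x - y) * u y * cnj (v x)))"
    by (rule haar_pair.Fubini_integral[OF int, symmetric])
  also have "\<dots> = (LINT y|haar. u y * (LINT x|haar. k (x - y) * cnj (v x)))"
    by (intro Bochner_Integration.integral_cong refl, subst integral_mult_right_zero[symmetric])
       (simp only: mult_ac)
  also have "\<dots> = (LINT y|haar. u y * (LINT x|haar. cnj (k (y - x) * v x)))"
  proof -
    have "k (x - y) = cnj (k (y - x))" for x y using herm[of "y - x"] by simp
    then have "k (x - y) * cnj (v x) = cnj (k (y - x) * v x)" for x y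
      unfolding complex_cnj_mult by (rule arg_cong)
    then show ?thesis by (simp only:)
  qed
  also have "\<dots> = inner_L2 u (K v)"
    unfolding inner_L2_def K_def by (simp only: Bochner_Integration.integral_cnj)
  finally show ?thesis .
qed

text \<open>Replacing the kernel by the step function of \<open>finite_net\<close> puts every
  \<open>K (u n)\<close> within \<open>e / 4\<close> of a combination of the same \<open>N\<close>
  functions \<open>k (x - y j)\<close>. The coefficients are bounded by 1, so rounding them to a
  grid leaves finitely many patterns, and these are the colours for
  \<open>subsequence_uniform_Cauchy\<close>.\<close>

lemma K_compact:
  assumes u: "\<And>n::nat. cont (u n)" and le: "\<And>n. sq_norm (u n) \<le> 1"
  obtains r w where "strict_mono (r :: nat \<Rightarrow> nat)" "cont w" "uniform_limit UNIV (\<lambda>n. K (u (r n))) w sequentially"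
proof (rule subsequence_uniform_Cauchy[of "\<lambda>n. K (u n)"])
  have L1: "(LINT x|haar. cmod (u n x)) \<le> 1" for n
    using integral_norm_le_sqn[OF u[of n]] le[of n] by (meson order.trans real_sqrt_le_1_iff)
  fix e :: real assume e: "0 < e"
  then have e4: "e / 4 > 0" by simp
  obtain N y i where i: "i \<in> measurable borel (count_space UNIV)" "\<And>x. i x < N"
      "\<And>x z. cmod (k (z - x) - k (z - y (i x :: nat))) \<le> e / 4"
    by (rule finite_net[OF k e4], rule that)
  have [measurable]: "i \<in> measurable haar (count_space UNIV)"
    using i(1) by (simp add: measurable_def sets_haar)
  \<comment> \<open>The mesh: coefficients with the same rounding differ by at most
    \<open>2 * d\<close>, so the \<open>N\<close> terms contribute at most
    \<open>N * B * 2 * d \<le> e / 2\<close>. With two approximation errors of \<open>e / 4\<close>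
    this makes \<open>e\<close>.\<close>
  define d where "d = e / (4 * (real N + 1) * B)"
  have d: "d > 0" using e B by (simp add: d_def)
  define c where "c n j = (LINT y'|haar. indicator {y'. i y' = j} y' * u n y')" for n j
  have mi: "{y'. i y' = j} \<in> sets haar" for j
  proof -
    have "i -` {j} \<inter> space haar \<in> sets haar"
      by (rule measurable_sets[OF \<open>i \<in> measurable haar (count_space UNIV)\<close>]) simp
    then show ?thesis by (simp add: vimage_def)
  qed
  have iint: "integrable haar (\<lambda>y'. indicator {y'. i y' = j} y' * (f y' :: complex))" if "cont f" for j f
  proof -
    have "(\<lambda>y'. indicator {y'. i y' = j} y' * f y') = (\<lambda>y'. indicat_real {y'. i y' = j} y' *\<^sub>R f y')"
      by (auto simp: indicator_def)
    then show ?thesis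
      using integrable_mult_indicator[OF mi continuous_integrable[OF that], of j] by simp
  qed
  have cle: "cmod (c n j) \<le> 1" for n j
  proof -
    have "cmod (c n j) \<le> (LINT x|haar. cmod (u n x))"
      unfolding c_def
      by (rule norm_integral_le[OF iint[OF u]])
         (auto intro!: continuous_integrable continuous_intros u simp: indicator_def)
    with L1[of n] show ?thesis by simp
  qed
  have approx: "cmod (K (u n) x - (\<Sum>j<N. k (x - y j) * c n j)) \<le> e / 4" for n x
  proof -
    have "(\<Sum>j<N. k (x - y j) * c n j) = (LINT y'|haar. (\<Sum>j<N. k (x - y j) * (indicator {y'. i y' = j} y' * u n y')))"
      unfolding c_def by (subst Bochner_Integration.integral_sum) (auto intro!: integrable_mult_right iint u)
    also have "\<dots> = (LINT y'|haar. k (x - y (i y')) * u n y')"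
    proof (rule Bochner_Integration.integral_cong[OF refl])
      fix y'
      have "(\<Sum>j<N. k (x - y j) * (indicator {y'. i y' = j} y' * u n y')) = (\<Sum>j<N. if j = i y' then k (x - y j) * u n y' else 0)"
        by (intro sum.cong) (auto simp: indicator_def)
      then show "(\<Sum>j<N. k (x - y j) * (indicator {y'. i y' = j} y' * u n y')) = k (x - y (i y')) * u n y'"
        using i(2) by simp
    qed
    finally have eq: "(\<Sum>j<N. k (x - y j) * c n j) = (LINT y'|haar. k (x - y (i y')) * u n y')" .
    have int: "integrable haar (\<lambda>y'. k (x - y (i y')) * u n y')"
    proof (rule Bochner_Integration.integrable_bound)
      show "integrable haar (\<lambda>y'. B * cmod (u n y'))"
        by (intro continuous_integrable continuous_intros u)
      show "(\<lambda>y'. k (x - y (i y')) * u n y') \<in> borel_measurable haar"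
        using u[of n] measurable_compose[OF \<open>i \<in> measurable haar (count_space UNIV)\<close>, of "\<lambda>j. k (x - y j)" borel]
        by (intro borel_measurable_times) (auto intro: borel_measurable_continuous_UNIV)
    qed (use B in \<open>auto simp: norm_mult intro!: mult_right_mono\<close>)
    have "K (u n) x - (\<Sum>j<N. k (x - y j) * c n j) = (LINT y'|haar. (k (x - y') - k (x - y (i y'))) * u n y')"
      unfolding eq K_def using int K_integrable[OF u] by (simp add: left_diff_distrib)
    also have "cmod \<dots> \<le> (LINT y'|haar. e / 4 * cmod (u n y'))"
    proof (rule norm_integral_le)
      show "integrable haar (\<lambda>y'. (k (x - y') - k (x - y (i y'))) * u n y')"
        unfolding left_diff_distrib by (intro Bochner_Integration.integrable_diff K_integrable u int)
      show "integrable haar (\<lambda>y'. e / 4 * cmod (u n y'))"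
        by (intro continuous_integrable continuous_intros u)
      show "cmod ((k (x - y') - k (x - y (i y'))) * u n y') \<le> e / 4 * cmod (u n y')" for y'
        unfolding norm_mult by (intro mult_right_mono i(3)) auto
    qed
    also have "\<dots> \<le> e / 4" using L1[of n] e by simp
    finally show ?thesis .
  qed
  \<comment> \<open>The colour of \<open>n\<close>: real and imaginary parts of its coefficients,
    rounded down to multiples of \<open>d\<close>.\<close>
  define g where "g n = map (\<lambda>j. (\<lfloor>Re (c n j) / d\<rfloor>, \<lfloor>Im (c n j) / d\<rfloor>)) [0..<N]" for n
  let ?Z = "{-\<lceil>1/d\<rceil> - 1..\<lceil>1/d\<rceil>}"
  have flr: "\<lfloor>t / d\<rfloor> \<in> ?Z" if "\<bar>t\<bar> \<le> 1" for t
  proof -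
    have "t / d \<le> 1 / d" "- (1 / d) \<le> t / d" using that d by (auto simp: field_simps)
    then show ?thesis by (auto simp: le_floor_iff floor_le_iff) linarith+
  qed
  have "range g \<subseteq> {xs. set xs \<subseteq> ?Z \<times> ?Z \<and> length xs = N}"
    using flr order.trans[OF abs_Re_le_cmod cle] order.trans[OF abs_Im_le_cmod cle]
    by (auto simp: g_def)
  then have "finite (range g)"
    by (rule finite_subset) (intro finite_lists_length_eq finite_cartesian_product finite_atLeastAtMost_int)
  moreover have "cmod (K (u m) x - K (u n) x) \<le> e" if eq: "g m = g n" for m n x
  proof -
    have cd: "cmod (c m j - c n j) \<le> 2 * d" if "j < N" for j
    proof -
      have "g m ! j = g n ! j" using eq by simp
      then have "\<lfloor>Re (c m j) / d\<rfloor> = \<lfloor>Re (c n j) / d\<rfloor>" "\<lfloor>Im (c m j) / d\<rfloor> = \<lfloor>Im (c n j) / d\<rfloor>"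
        using that by (auto simp: g_def)
      then have "\<bar>Re (c m j) / d - Re (c n j) / d\<bar> \<le> 1" "\<bar>Im (c m j) / d - Im (c n j) / d\<bar> \<le> 1"
        by linarith+
      then have "\<bar>Re (c m j - c n j)\<bar> \<le> d" "\<bar>Im (c m j - c n j)\<bar> \<le> d"
        using d by (auto simp: diff_divide_distrib[symmetric] abs_divide divide_le_eq)
      then show ?thesis using cmod_le[of "c m j - c n j"] by linarith
    qed
    have "cmod ((\<Sum>j<N. k (x - y j) * c m j) - (\<Sum>j<N. k (x - y j) * c n j)) = cmod (\<Sum>j<N. k (x - y j) * (c m j - c n j))"
      by (simp add: sum_subtractf right_diff_distrib)
    also have "\<dots> \<le> (\<Sum>j<N. B * (2 * d))"
      by (rule sum_norm_le) (use cd B d in \<open>auto simp: norm_mult intro!: mult_mono\<close>)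
    also have "\<dots> = real N / (real N + 1) * (e / 2)"
    proof -
      have "n * (B * (2 * (e / (4 * a * B)))) = n / a * (e / 2)" if "a > 0" for n a :: real
        using that B(2) by (simp add: field_simps)
      from this[of "real N + 1" "real N"] show ?thesis by (simp only: d_def sum_constant card_lessThan)
    qed
    also have "\<dots> \<le> 1 * (e / 2)" using e by (intro mult_right_mono) auto
    finally have mid: "cmod ((\<Sum>j<N. k (x - y j) * c m j) - (\<Sum>j<N. k (x - y j) * c n j)) \<le> e / 2"
      by simp
    have "K (u m) x - K (u n) x = (K (u m) x - (\<Sum>j<N. k (x - y j) * c m j))
        + ((\<Sum>j<N. k (x - y j) * c m j) - (\<Sum>j<N. k (x - y j) * c n j))
        - (K (u n) x - (\<Sum>j<N. k (x - y j) * c n j))" by simp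
    also have "cmod \<dots> \<le> e / 4 + e / 2 + e / 4"
      by (intro order.trans[OF norm_triangle_ineq4] add_mono order.trans[OF norm_triangle_ineq] approx mid)
    finally show ?thesis using e by simp
  qed
  ultimately show "\<exists>g :: nat \<Rightarrow> (int \<times> int) list. finite (range g) \<and> (\<forall>m n x. g m = g n \<longrightarrow> cmod (K (u m) x - K (u n) x) \<le> e)"
    by blast
qed (use that K_cont u in auto)

end

section \<open>Orthonormal systems and Bessel's inequality\<close>

definition orthonormal :: "('a::compact_ab_group \<Rightarrow> complex) set \<Rightarrow> bool" where
  "orthonormal F \<longleftrightarrow> finite F \<and> (\<forall>e\<in>F. cont e) \<and> (\<forall>e\<in>F. \<forall>f\<in>F. inner_L2 e f = (if e = f then 1 else 0))"

text \<open>Pythagoras, by induction over subfamilies \<open>G\<close> of \<open>F\<close>: the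
  residual with respect to \<open>G\<close> is orthogonal to \<open>G\<close> and has the same inner
  products as \<open>g\<close> with the rest of \<open>F\<close>. As \<open>sq_norm h\<close> is
  nonnegative, the last equation contains Bessel's inequality.\<close>

lemma orthonormal_residual:
  assumes F: "orthonormal F" and g: "cont g"
  defines "h \<equiv> \<lambda>x. g x - (\<Sum>e\<in>F. inner_L2 g e * e x)"
  shows "cont h" "e \<in> F \<Longrightarrow> inner_L2 h e = 0" "sq_norm h = sq_norm g - (\<Sum>e\<in>F. (cmod (inner_L2 g e))\<^sup>2)"
proof -
  have cF: "\<And>e. e \<in> F \<Longrightarrow> cont e" and fin: "finite F"
    and on: "\<And>e f. e \<in> F \<Longrightarrow> f \<in> F \<Longrightarrow> inner_L2 e f = (if e = f then 1 else 0)"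
    using F by (auto simp: orthonormal_def)
  have res: "cont (\<lambda>x. g x - (\<Sum>e\<in>G. inner_L2 g e * e x))" if "G \<subseteq> F" for G
    using that g cF by (intro continuous_intros) auto
  have inner_L2_res: "inner_L2 (\<lambda>x. g x - (\<Sum>e\<in>G. inner_L2 g e * e x)) f = (if f \<in> G then 0 else inner_L2 g f)" if "G \<subseteq> F" "f \<in> F" for G f
  proof -
    have "finite G" using that fin finite_subset by blast
    have "inner_L2 (\<lambda>x. g x - (\<Sum>e\<in>G. inner_L2 g e * e x)) f = inner_L2 g f - inner_L2 (\<lambda>x. \<Sum>e\<in>G. inner_L2 g e * e x) f"
      using that g cF by (intro inner_L2_diff_left continuous_intros) auto
    also have "inner_L2 (\<lambda>x. \<Sum>e\<in>G. inner_L2 g e * e x) f = (\<Sum>e\<in>G. inner_L2 g e * inner_L2 e f)"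
      using that cF by (subst inner_L2_sum_left) (auto intro!: continuous_intros simp: inner_L2_cmult_left)
    also have "\<dots> = (\<Sum>e\<in>G. if e = f then inner_L2 g f else 0)"
      using that on by (intro sum.cong) auto
    finally show ?thesis using \<open>finite G\<close> by simp
  qed
  show "cont h" unfolding h_def by (rule res) simp
  show "e \<in> F \<Longrightarrow> inner_L2 h e = 0" unfolding h_def using inner_L2_res[of F e] by simp
  have "sq_norm (\<lambda>x. g x - (\<Sum>e\<in>G. inner_L2 g e * e x)) = sq_norm g - (\<Sum>e\<in>G. (cmod (inner_L2 g e))\<^sup>2)" if "G \<subseteq> F" for G
    using finite_subset[OF that fin] that
  proof (induction G rule: finite_induct)
    case (insert f G)
    let ?h = "\<lambda>x. g x - (\<Sum>e\<in>G. inner_L2 g e * e x)"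
    have f: "f \<in> F" "G \<subseteq> F" using insert by auto
    have "sq_norm f = 1"
      using on[OF f(1) f(1)] inner_L2_self[OF cF[OF f(1)]] by simp
    have "sq_norm (\<lambda>x. g x - (\<Sum>e\<in>insert f G. inner_L2 g e * e x)) = sq_norm (\<lambda>x. ?h x - inner_L2 g f * f x)"
      using insert by (simp add: algebra_simps)
    also have "\<dots> = sq_norm ?h - 2 * Re (cnj (inner_L2 g f) * inner_L2 ?h f) + (cmod (inner_L2 g f))\<^sup>2 * sq_norm f"
      by (rule sq_norm_diff_cmult[OF res[OF f(2)] cF[OF f(1)]])
    also have "inner_L2 ?h f = inner_L2 g f" using inner_L2_res[OF f(2,1)] insert by simp
    also have "Re (cnj (inner_L2 g f) * inner_L2 g f) = (cmod (inner_L2 g f))\<^sup>2"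
      by (metis complex_norm_square mult.commute Re_complex_of_real of_real_power)
    finally show ?case
      using insert f \<open>sq_norm f = 1\<close> by simp
  qed simp
  from this[of F] show "sq_norm h = sq_norm g - (\<Sum>e\<in>F. (cmod (inner_L2 g e))\<^sup>2)"
    by (simp add: h_def)
qed

lemma uniform_limitD_le:
  assumes "uniform_limit UNIV f w sequentially" "0 < e"
  shows "\<forall>\<^sub>F n in sequentially. \<forall>x. cmod (f n x - w x) \<le> e"
  using uniform_limitD[OF assms] by (auto simp: dist_norm elim!: eventually_mono intro: less_imp_le)

section \<open>Eigenvectors of the square of the convolution operator\<close>

context hermitian_kernel
begin

text \<open>Let \<open>S\<close> be the supremum of \<open>sq_norm (K u)\<close> on the unit ball
  and \<open>q n\<close> a maximizing sequence with \<open>K (q n)\<close> converging uniformly to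
  \<open>w\<close>. Symmetry of \<open>K\<close> gives that \<open>K (K (q n)) - S * q n\<close>
  tends to 0. Hence \<open>S * q n\<close> tends to \<open>v = K w\<close> in the L2 norm, and
  applying \<open>K\<close> gives \<open>K v = S * w\<close>, so
  \<open>K (K v) = S * v\<close>.\<close>

lemma eigenvector_exists:
  assumes "k z \<noteq> 0"
  obtains S v where "0 < S" "cont v" "v \<noteq> (\<lambda>_. 0)" "\<And>x. K (K v) x = of_real S * v x"
proof -
  define D where "D = {u :: 'a \<Rightarrow> complex. cont u \<and> sq_norm u \<le> 1}"
  define S where "S = (SUP u\<in>D. sq_norm (K u))"
  have leB: "sq_norm (K u) \<le> B\<^sup>2" if "u \<in> D" for u
  proof (rule sq_norm_bound)
    have "sqrt (sq_norm u) \<le> 1" using that by (auto simp: D_def)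
    then have "B * sqrt (sq_norm u) \<le> B" using B(2) by simp
    then show "cmod (K u x) \<le> B" for x
      using K_bound[of u x] that by (auto simp: D_def intro: order.trans)
  qed (use that K_cont in \<open>auto simp: D_def\<close>)
  then have bdd: "bdd_above ((\<lambda>u. sq_norm (K u)) ` D)" by (auto intro!: bdd_aboveI)
  have leS: "sq_norm (K u) \<le> S * sq_norm u" if u: "cont u" for u
  proof (cases "sq_norm u = 0")
    case True
    have "cmod (K u x) \<le> 0" for x using K_bound[OF u, of x] True by simp
    from sq_norm_bound[OF K_cont[OF u] this] show ?thesis using True by simp
  next
    case False
    then have pos: "sq_norm u > 0" using sq_norm_nonneg[of u] by linarith
    define c where "c = complex_of_real (1 / sqrt (sq_norm u))"
    have c: "(cmod c)\<^sup>2 = 1 / sq_norm u" using pos by (simp add: c_def norm_divide power_divide)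
    have "(\<lambda>x. c * u x) \<in> D"
      using u pos by (auto simp: D_def sq_norm_cmult c intro!: continuous_intros)
    from cSUP_upper[OF this bdd] have "sq_norm (K (\<lambda>x. c * u x)) \<le> S" by (simp add: S_def)
    also have "K (\<lambda>x. c * u x) = (\<lambda>x. c * K u x)" by (rule ext) (rule K_cmult)
    finally show ?thesis using pos by (simp add: sq_norm_cmult c field_simps)
  qed
  \<comment> \<open>The kernel is its own test function: by \<open>herm\<close>,
    \<open>K k 0\<close> is the squared norm of \<open>k\<close>.\<close>
  have S: "S > 0"
  proof (rule ccontr)
    assume "\<not> S > 0"
    then have "sq_norm (K k) \<le> 0"
      using leS[OF k] by (meson mult_nonpos_nonneg not_less order.trans sq_norm_nonneg)
    then have "sq_norm (K k) = 0" using sq_norm_nonneg[of "K k"] by linarith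
    then have "K k 0 = 0" by (rule sq_norm_eq_0[OF K_cont[OF k]])
    moreover have "K k 0 = of_real (sq_norm k)"
      unfolding K_def using herm inner_L2_self[OF k] by (simp add: inner_L2_def mult.commute)
    ultimately have "sq_norm k = 0" by simp
    from sq_norm_eq_0[OF k this, of z] assms show False by simp
  qed
  have "D \<noteq> {}" by (auto simp: D_def sq_norm_def intro!: exI[of _ "\<lambda>_. 0"])
  have "\<exists>u\<in>D. S - 1 / real (Suc n) < sq_norm (K u)" for n
    using less_cSUP_iff[OF \<open>D \<noteq> {}\<close> bdd, of "S - 1 / real (Suc n)"] by (simp add: S_def)
  then obtain u where u: "\<And>n. u n \<in> D" "\<And>n. S - 1 / real (Suc n) < sq_norm (K (u n))"
    by metis
  have uc: "cont (u n)" and u1: "sq_norm (u n) \<le> 1" for n using u(1)[of n] by (auto simp: D_def)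
  obtain r w where r: "strict_mono r" and w: "cont w" "uniform_limit UNIV (\<lambda>n. K (u (r n))) w sequentially"
    using K_compact[of u, OF uc u1] by blast
  define q where "q n = u (r n)" for n
  have qc: "cont (q n)" and q1: "sq_norm (q n) \<le> 1" for n by (auto simp: q_def uc u1)
  have qS: "S - 1 / real (Suc n) < sq_norm (K (q n))" for n
  proof -
    have "1 / real (Suc (r n)) \<le> 1 / real (Suc n)"
      using seq_suble[OF r, of n] by (intro divide_left_mono) auto
    with u(2)[of "r n"] show ?thesis by (simp add: q_def)
  qed
  have wlim: "uniform_limit UNIV (\<lambda>n. K (q n)) w sequentially" using w by (simp add: q_def)
  define v where "v = K w"
  have v: "cont v" unfolding v_def by (rule K_cont[OF w(1)])
  \<comment> \<open>Expanding the square gives at most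
    \<open>S * s - 2 * S * s + S * S = S * (S - s)\<close> with
    \<open>s = sq_norm (K (q n))\<close>, and \<open>s\<close> is within \<open>1 / Suc n\<close> of
    the supremum.\<close>
  have KKq: "sq_norm (\<lambda>x. K (K (q n)) x - of_real S * q n x) \<le> S / real (Suc n)" for n
  proof -
    have c: "cont (K (q n))" "cont (K (K (q n)))" by (auto intro: K_cont qc)
    have ipq: "inner_L2 (K (K (q n))) (q n) = of_real (sq_norm (K (q n)))"
      using K_symmetric[OF c(1) qc[of n]] inner_L2_self[OF c(1)] by simp
    have "sq_norm (\<lambda>x. K (K (q n)) x - of_real S * q n x)
       = sq_norm (K (K (q n))) - 2 * (S * sq_norm (K (q n))) + S\<^sup>2 * sq_norm (q n)"
      using sq_norm_diff_cmult[OF c(2) qc[of n], of "of_real S"] S by (simp add: ipq)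
    also have "\<dots> \<le> S * sq_norm (K (q n)) - 2 * (S * sq_norm (K (q n))) + S\<^sup>2 * 1"
      using leS[OF c(1)] q1[of n] S by (intro add_mono diff_mono mult_left_mono) auto
    also have "\<dots> = S * (S - sq_norm (K (q n)))" by (simp add: power2_eq_square algebra_simps)
    also have "\<dots> \<le> S * (1 / real (Suc n))"
      using qS[of n] S by (intro mult_left_mono) auto
    finally show ?thesis by (simp only: times_divide_eq_right mult_1_right)
  qed
  have small: "\<forall>\<^sub>F n in sequentially. sq_norm (\<lambda>x. v x - of_real S * q n x) \<le> e" if e: "0 < e" for e
  proof -
    \<comment> \<open>Chosen so that \<open>K_bound\<close> yields
      \<open>sq_norm \<le> e / 4\<close> for \<open>v - K (K (q n))\<close>. With the factor 2 of
      \<open>sq_norm_add_le\<close> this is half of \<open>e\<close>, and \<open>KKq\<close>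
      supplies the other half.\<close>
    define d where "d = sqrt (e / 4) / B"
    have d: "d > 0" using e B(2) by (simp add: d_def)
    have "(\<lambda>n. 2 * (S / real (Suc n))) \<longlonglongrightarrow> 2 * 0"
      by (intro tendsto_intros LIMSEQ_Suc[OF lim_const_over_n])
    then have "\<forall>\<^sub>F n in sequentially. 2 * (S / real (Suc n)) < e / 2"
      by (rule order_tendstoD) (use e in simp)
    with uniform_limitD_le[OF wlim d] show ?thesis
    proof eventually_elim
      case (elim n)
      have c: "cont (K (q n))" "cont (K (K (q n)))" by (auto intro: K_cont qc)
      have wq: "cont (\<lambda>x. w x - K (q n) x)" by (intro continuous_intros w c)
      have "sq_norm (\<lambda>x. w x - K (q n) x) \<le> d\<^sup>2"
        using elim(1) by (intro sq_norm_bound wq) (simp add: norm_minus_commute)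
      then have "sqrt (sq_norm (\<lambda>x. w x - K (q n) x)) \<le> d"
        using d by (metis real_le_lsqrt less_imp_le)
      then have "B * sqrt (sq_norm (\<lambda>x. w x - K (q n) x)) \<le> B * d" using B(2) by simp
      also have "B * d = sqrt (e / 4)" using B(2) by (simp add: d_def)
      finally have bd: "B * sqrt (sq_norm (\<lambda>x. w x - K (q n) x)) \<le> sqrt (e / 4)" .
      have "sq_norm (\<lambda>x. v x - K (K (q n)) x) \<le> (sqrt (e / 4))\<^sup>2"
      proof (rule sq_norm_bound)
        show "cont (\<lambda>x. v x - K (K (q n)) x)" by (intro continuous_intros v c)
        show "cmod (v x - K (K (q n)) x) \<le> sqrt (e / 4)" for x
          using order.trans[OF K_bound[OF wq, of x] bd] K_diff[OF w(1) c(1), of x]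
          by (simp add: v_def)
      qed
      then have a: "sq_norm (\<lambda>x. v x - K (K (q n)) x) \<le> e / 4" using e by simp
      have "sq_norm (\<lambda>x. v x - of_real S * q n x)
          = sq_norm (\<lambda>x. (v x - K (K (q n)) x) + (K (K (q n)) x - of_real S * q n x))" by simp
      also have "\<dots> \<le> 2 * sq_norm (\<lambda>x. v x - K (K (q n)) x) + 2 * sq_norm (\<lambda>x. K (K (q n)) x - of_real S * q n x)"
        by (intro sq_norm_add_le continuous_intros v c qc)
      also have "\<dots> \<le> 2 * (e / 4) + 2 * (S / real (Suc n))"
        using a KKq[of n] by (intro add_mono mult_left_mono) auto
      finally show ?case using elim(2) by simp
    qed
  qed
  \<comment> \<open>Both are limits of \<open>S * K (q n)\<close>: one because \<open>K\<close>
    sends L2 convergence to uniform convergence, the other by the choice of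
    \<open>w\<close>.\<close>
  have Kv: "K v x = of_real S * w x" for x
  proof -
    have "cmod (K v x - of_real S * w x) \<le> e" if e: "0 < e" for e
    proof -
      have "(e / (2 * B))\<^sup>2 > 0" "e / (2 * S) > 0" using e B(2) S by auto
      from eventually_conj[OF small[OF this(1)] uniform_limitD_le[OF wlim this(2)]]
      obtain n where n: "sq_norm (\<lambda>x. v x - of_real S * q n x) \<le> (e / (2 * B))\<^sup>2"
          "\<And>x. cmod (K (q n) x - w x) \<le> e / (2 * S)"
        by (auto simp: eventually_sequentially)
      have c: "cont (\<lambda>x. of_real S * q n x)" by (intro continuous_intros qc)
      have c': "cont (\<lambda>x. v x - of_real S * q n x)" by (intro continuous_intros qc v)
      have "sqrt (sq_norm (\<lambda>x. v x - of_real S * q n x)) \<le> e / (2 * B)"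
        using n(1) e B(2) by (intro real_le_lsqrt) auto
      then have "B * sqrt (sq_norm (\<lambda>x. v x - of_real S * q n x)) \<le> B * (e / (2 * B))" using B(2) by (intro mult_left_mono) auto
      also have "B * (e / (2 * B)) = e / 2" using B(2) by simp
      finally have 1: "cmod (K v x - of_real S * K (q n) x) \<le> e / 2"
        using K_bound[OF c', of x] K_diff[OF v c, of x] by (simp add: K_cmult)
      have "cmod (of_real S * K (q n) x - of_real S * w x) = S * cmod (K (q n) x - w x)"
        using S by (simp add: norm_mult flip: right_diff_distrib)
      also have "\<dots> \<le> S * (e / (2 * S))" using S n(2) by (intro mult_left_mono) auto
      also have "\<dots> = e / 2" using S by simp
      finally have 2: "cmod (of_real S * K (q n) x - of_real S * w x) \<le> e / 2" .
      have "K v x - of_real S * w x = (K v x - of_real S * K (q n) x) + (of_real S * K (q n) x - of_real S * w x)"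
        by simp
      also have "cmod \<dots> \<le> e / 2 + e / 2"
        by (rule order.trans[OF norm_triangle_ineq add_mono[OF 1 2]])
      finally show ?thesis by simp
    qed
    then have "cmod (K v x - of_real S * w x) \<le> 0" by (rule field_le_epsilon) simp
    then show ?thesis by simp
  qed
  \<comment> \<open>If \<open>v\<close> vanished, so would \<open>w\<close>. Then
    \<open>sq_norm (K (q n))\<close> would be at most \<open>S / 4\<close> for some \<open>n\<close>
    for which maximality makes it exceed \<open>3 * S / 4\<close>.\<close>
  have "v \<noteq> (\<lambda>_. 0)"
  proof
    assume v0: "v = (\<lambda>_. 0)"
    have "w x = 0" for x using Kv[of x] S by (simp add: v0 K_def)
    have "S / 4 > 0" "sqrt (S / 4) > 0" using S by auto
    have "(\<lambda>n. 1 / real (Suc n)) \<longlonglongrightarrow> 0" by (rule LIMSEQ_Suc[OF lim_1_over_n])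
    then have "\<forall>\<^sub>F n in sequentially. 1 / real (Suc n) < S / 4"
      by (rule order_tendstoD) (use S in simp)
    from eventually_conj[OF this uniform_limitD_le[OF wlim \<open>sqrt (S / 4) > 0\<close>]]
    obtain n where n: "1 / real (Suc n) < S / 4" "\<And>x. cmod (K (q n) x - w x) \<le> sqrt (S / 4)"
      by (auto simp: eventually_sequentially)
    have "sq_norm (K (q n)) \<le> (sqrt (S / 4))\<^sup>2"
      using n(2) \<open>\<And>x. w x = 0\<close> by (intro sq_norm_bound K_cont qc) auto
    then show False using qS[of n] n(1) S by simp
  qed
  moreover have "K (K v) x = of_real S * v x" for x
  proof -
    have "K v = (\<lambda>x. of_real S * w x)" using Kv by auto
    then show ?thesis by (simp add: K_cmult v_def)
  qed
  ultimately show ?thesis using that S v by blast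
qed

text \<open>A Hilbert-Schmidt estimate. For fixed \<open>x\<close> the numbers \<open>K e x\<close>
  are, up to conjugation, the coefficients of \<open>cnj (k (x - y))\<close> as a function of
  \<open>y\<close>, so Bessel bounds the sum of their squares by the square of \<open>B\<close>.
  Integrating over \<open>x\<close> turns each square into \<open>sq_norm (K e) = S\<close>. This
  makes the eigenspace finite-dimensional.\<close>

lemma orthonormal_bound:
  assumes F: "orthonormal F" and S: "0 < S" and eig: "\<And>e x. e \<in> F \<Longrightarrow> K (K e) x = of_real S * e x"
  shows "real (card F) * S \<le> B\<^sup>2"
proof -
  have cF: "\<And>e. e \<in> F \<Longrightarrow> cont e" and fin: "finite F"
    using F by (auto simp: orthonormal_def)
  have pw: "(\<Sum>e\<in>F. (cmod (K e x))\<^sup>2) \<le> B\<^sup>2" for x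
  proof -
    define g where "g y = cnj (k (x - y))" for y
    have g: "cont g" unfolding g_def by (intro continuous_intros cont_reflect k)
    have Ke: "cmod (K e x) = cmod (inner_L2 g e)" if "e \<in> F" for e
    proof -
      have "K e x = cnj (inner_L2 g e)"
        unfolding K_def inner_L2_def g_def Bochner_Integration.integral_cnj[symmetric] by simp
      then show ?thesis by simp
    qed
    have "0 \<le> sq_norm g - (\<Sum>e\<in>F. (cmod (inner_L2 g e))\<^sup>2)"
      by (subst orthonormal_residual(3)[OF F g, symmetric]) (rule sq_norm_nonneg)
    moreover have "sq_norm g \<le> B\<^sup>2" using B g by (intro sq_norm_bound) (auto simp: g_def)
    ultimately show ?thesis by (simp add: Ke)
  qed
  have int: "integrable haar (\<lambda>x. (cmod (K e x))\<^sup>2)" if "e \<in> F" for e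
    by (intro continuous_integrable continuous_intros K_cont cF that)
  have "sq_norm (K e) = S" if e: "e \<in> F" for e
  proof -
    have "complex_of_real (sq_norm (K e)) = inner_L2 (K (K e)) e"
      using e cF by (simp add: K_symmetric K_cont flip: inner_L2_self)
    also have "K (K e) = (\<lambda>x. of_real S * e x)" using eig[OF e] by auto
    also have "inner_L2 \<dots> e = of_real S"
      using F e by (simp add: inner_L2_cmult_left orthonormal_def)
    finally show ?thesis by (simp only: of_real_eq_iff)
  qed
  then have "real (card F) * S = (\<Sum>e\<in>F. sq_norm (K e))" by simp
  also have "\<dots> = (LINT x|haar. (\<Sum>e\<in>F. (cmod (K e x))\<^sup>2))"
    unfolding sq_norm_def using int by (intro Bochner_Integration.integral_sum[symmetric])
  also have "\<dots> \<le> (LINT x|(haar::'a measure). B\<^sup>2)"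
    by (intro integral_mono pw Bochner_Integration.integrable_sum int) auto
  finally show ?thesis by simp
qed

end

section \<open>Characters separate points\<close>

text \<open>Translation by \<open>b\<close> acts on the finite-dimensional space \<open>V\<close>.
  Among nonzero polynomials \<open>p\<close> with \<open>p(shift) v = 0\<close> take one of least
  degree; with a root \<open>z\<close> and \<open>p = (X - z) q\<close>, the vector
  \<open>q(shift) v\<close> is nonzero by minimality and has eigenvalue \<open>z\<close>.\<close>

lemma shift_eigenvector:
  fixes V F :: "('a::compact_ab_group \<Rightarrow> complex) set" and b :: 'a
  assumes cV: "\<And>u. u \<in> V \<Longrightarrow> cont u"
    and add: "\<And>u w. u \<in> V \<Longrightarrow> w \<in> V \<Longrightarrow> (\<lambda>x. u x + w x) \<in> V"
    and cmult: "\<And>u c. u \<in> V \<Longrightarrow> (\<lambda>x. c * u x) \<in> V"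
    and shift: "\<And>u b. u \<in> V \<Longrightarrow> (\<lambda>x. u (x + b)) \<in> V"
    and v: "v \<in> V" "v \<noteq> (\<lambda>_. 0)"
    and F: "finite F" "F \<subseteq> V" "\<And>u. u \<in> V \<Longrightarrow> \<exists>c. \<forall>x. u x = (\<Sum>e\<in>F. c e * e x)"
  shows "\<exists>u\<in>V. u \<noteq> (\<lambda>_. 0) \<and> (\<exists>\<mu>. \<forall>x. u (x + b) = \<mu> * u x)"
proof -
  \<comment> \<open>The \<open>i\<close>-fold multiple of \<open>b\<close> in the group.\<close>
  define t where "t i = (((+) b) ^^ i) 0" for i
  have t0: "t 0 = 0" and tS: "t (Suc i) = b + t i" for i by (auto simp: t_def)
  \<comment> \<open>This is \<open>p(shift) v\<close>, evaluated at \<open>x\<close>.\<close>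
  define pT where "pT p x = (\<Sum>i\<le>degree p. coeff p i * v (x + t i))" for p :: "complex poly" and x
  have pT: "pT p x = (\<Sum>i\<le>N. coeff p i * v (x + t i))" if "degree p \<le> N" for p N x
    unfolding pT_def using that
    by (intro sum.mono_neutral_left) (auto simp: coeff_eq_0)
  have zero: "(\<lambda>_. 0) \<in> V" using cmult[OF v(1), of 0] by simp
  have sumV: "(\<lambda>x. \<Sum>i\<in>I. f i x) \<in> V" if "\<And>i. i \<in> I \<Longrightarrow> f i \<in> V" for I and f :: "nat \<Rightarrow> _"
    using that by (induction I rule: infinite_finite_induct) (auto intro: zero add)
  have pTV: "pT p \<in> V" for p
    unfolding pT_def[abs_def] by (intro sumV cmult shift v(1))
  have ex: "\<exists>p. p \<noteq> 0 \<and> (\<forall>x. pT p x = 0)"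
  proof -
    define n where "n = card F"
    \<comment> \<open>The translates are viewed in \<open>L0\<close>, where linear independence is
      available; \<open>L0_of_continuous_eq\<close> leads back to functions.\<close>
    define w where "w i = L0_of (\<lambda>x. v (x + t i))" for i
    have bm: "bmeas (\<lambda>x. v (x + t i))" for i
      using cV[OF shift[OF v(1)]] by (rule borel_measurable_continuous_UNIV)
    have eq: "\<forall>x. pT p x = 0" if d: "degree p \<le> n" and "(\<Sum>i\<le>n. scale_L0 (coeff p i) (w i)) = 0" for p
    proof -
      have "L0_of (pT p) = L0_of (\<lambda>x. \<Sum>i\<le>n. coeff p i * v (x + t i))"
        using pT[OF d] by presburger
      also have "\<dots> = (\<Sum>i\<le>n. scale_L0 (coeff p i) (w i))"
        unfolding w_def using bm by (simp add: L0_of_scale L0_of_sum)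
      also have "\<dots> = L0_of (\<lambda>_. 0)" using that(2) by (simp add: L0_of_0)
      finally have "pT p = (\<lambda>_. 0)"
        by (intro L0_of_continuous_eq cV pTV zero)
      then show ?thesis by simp
    qed
    show ?thesis
    \<comment> \<open>If two translates coincide, \<open>X^i - X^j\<close> annihilates
      \<open>v\<close>. Otherwise \<open>n + 1\<close> distinct vectors lie in the span of at most
      \<open>n\<close>, and a dependence supplies the coefficients of \<open>p\<close>.\<close>
    proof (cases "inj_on w {..n}")
      case False
      then obtain i j where ij: "i \<le> n" "j \<le> n" "i \<noteq> j" "w i = w j" by (auto simp: inj_on_def)
      define p :: "complex poly" where "p = monom 1 i - monom 1 j"
      have c: "coeff p l = (if l = i then 1 else 0) - (if l = j then 1 else 0)" for l
        by (auto simp: p_def)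
      have "p \<noteq> 0" using c[of i] ij by auto
      moreover have "degree p \<le> n" by (rule degree_le) (use ij c in auto)
      moreover have "(\<Sum>l\<le>n. scale_L0 (coeff p l) (w l)) = 0"
      proof -
        have "(\<Sum>l\<le>n. scale_L0 (coeff p l) (w l)) = (\<Sum>l\<le>n. (if l = i then w l else 0) - (if l = j then w l else 0))"
          using ij by (intro sum.cong) (auto simp: c)
        also have "\<dots> = 0" using ij by (simp add: sum_subtractf)
        finally show ?thesis .
      qed
      ultimately show ?thesis using eq by blast
    next
      case True
      have sub: "w ` {..n} \<subseteq> L0.span (L0_of ` F)"
      proof
        fix y assume "y \<in> w ` {..n}"
        then obtain i where i: "y = w i" by blast
        from F(3)[OF shift[OF v(1)], of "t i"] obtain c where c: "\<And>x. v (x + t i) = (\<Sum>e\<in>F. c e * e x)" by blast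
        have "w i = (\<Sum>e\<in>F. scale_L0 (c e) (L0_of e))"
        proof -
          have bF: "bmeas e" if "e \<in> F" for e
            using that F(2) cV by (intro borel_measurable_continuous_UNIV) auto
          then show ?thesis
            unfolding w_def c by (simp add: L0_of_scale L0_of_sum)
        qed
        then show "y \<in> L0.span (L0_of ` F)"
          unfolding i by (auto intro: L0.span_sum L0.span_scale L0.span_base)
      qed
      have "L0.dependent (w ` {..n})"
      proof (rule ccontr)
        assume "\<not> ?thesis"
        from L0.independent_span_bound[OF _ this sub] F(1)
        have "card (w ` {..n}) \<le> card (L0_of ` F)" by simp
        also have "\<dots> \<le> n" unfolding n_def by (rule card_image_le[OF F(1)])
        finally show False using card_image[OF True] by simp
      qed
      then obtain u y where u: "y \<in> w ` {..n}" "u y \<noteq> 0" "(\<Sum>v\<in>w ` {..n}. scale_L0 (u v) v) = 0"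
        by (auto simp: L0.dependent_finite)
      define p where "p = (\<Sum>i\<le>n. monom (u (w i)) i)"
      have c: "coeff p l = (if l \<le> n then u (w l) else 0)" for l
        by (auto simp: p_def coeff_sum)
      obtain l where "l \<le> n" "y = w l" using u(1) by blast
      then have "coeff p l \<noteq> 0" using u(2) c by simp
      then have "p \<noteq> 0" by auto
      moreover have "degree p \<le> n" by (rule degree_le) (auto simp: c)
      moreover have "(\<Sum>l\<le>n. scale_L0 (coeff p l) (w l)) = 0"
        using u(3) by (simp add: sum.reindex[OF True] c)
      ultimately show ?thesis using eq by blast
    qed
  qed
  obtain p where p: "p \<noteq> 0" "\<And>x. pT p x = 0"
    and least: "\<And>q. q \<noteq> 0 \<Longrightarrow> (\<forall>x. pT q x = 0) \<Longrightarrow> degree p \<le> degree q"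
    using ex_has_least_nat[of "\<lambda>p. p \<noteq> 0 \<and> (\<forall>x. pT p x = 0)" _ degree] ex by metis
  have "degree p \<noteq> 0"
  proof
    assume "degree p = 0"
    then obtain c where c: "p = [:c:]" by (rule degree_eq_zeroE)
    then have "c \<noteq> 0" using p(1) by auto
    have "v x = 0" for x using p(2)[of x] \<open>c \<noteq> 0\<close> by (simp add: c pT_def t0)
    then show False using v(2) by auto
  qed
  then have "\<not> constant (poly p)" by (simp add: constant_degree)
  from fundamental_theorem_of_algebra[OF this] obtain z where z: "poly p z = 0" ..
  then obtain q where q: "p = [:-z, 1:] * q" by (auto simp: poly_eq_0_iff_dvd elim: dvdE)
  have "q \<noteq> 0" using p(1) q by auto
  have "degree p = Suc (degree q)" unfolding q using \<open>q \<noteq> 0\<close> by (subst degree_mult_eq) auto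
  then have "pT q \<noteq> (\<lambda>_. 0)" using least[OF \<open>q \<noteq> 0\<close>] by auto
  moreover have "pT q (x + b) = z * pT q x" for x
  proof -
    let ?N = "degree q"
    \<comment> \<open>Coefficientwise, \<open>(X - z) q\<close> is the shifted \<open>q\<close>
      minus \<open>z\<close> times \<open>q\<close>; applied to \<open>v\<close> it vanishes, which
      is the eigenvalue equation.\<close>
    have cp: "coeff p i = - z * coeff q i + (case i of 0 \<Rightarrow> 0 | Suc j \<Rightarrow> coeff q j)" for i
      unfolding q by (simp add: coeff_pCons)
    have "0 = (\<Sum>i\<le>Suc ?N. coeff p i * v (x + t i))"
      using p(2)[of x] pT[of p "Suc ?N" x] \<open>degree p = Suc (degree q)\<close> by simp
    also have "\<dots> = - z * (\<Sum>i\<le>Suc ?N. coeff q i * v (x + t i))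
        + (\<Sum>i\<le>Suc ?N. (case i of 0 \<Rightarrow> 0 | Suc j \<Rightarrow> coeff q j) * v (x + t i))"
      unfolding cp by (simp only: distrib_right sum.distrib sum_distrib_left mult.assoc)
    also have "(\<Sum>i\<le>Suc ?N. coeff q i * v (x + t i)) = pT q x"
      by (rule pT[symmetric]) simp
    also have "(\<Sum>i\<le>Suc ?N. (case i of 0 \<Rightarrow> 0 | Suc j \<Rightarrow> coeff q j) * v (x + t i)) = pT q (x + b)"
      unfolding sum.atMost_Suc_shift pT_def by (simp add: tS add.assoc)
    finally show ?thesis by simp
  qed
  ultimately show ?thesis using pTV by blast
qed

context hermitian_kernel
begin

text \<open>Take a nonzero translation-invariant subspace \<open>V\<close> of the eigenspace with
  least dimension. For each \<open>b\<close>, translation by \<open>b\<close> has an eigenvector in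
  \<open>V\<close>; as translations commute, the corresponding eigenspace in \<open>V\<close> is
  again invariant and therefore all of \<open>V\<close>. So translations act on \<open>V\<close> by
  scalars \<open>c b\<close>, and every \<open>u\<close> in \<open>V\<close> is \<open>u 0\<close>
  times \<open>c\<close>.\<close>

theorem character_exists:
  assumes "k z \<noteq> 0"
  obtains c S where "c \<in> characters" "0 < S" "\<And>x. K (K c) x = of_real S * c x"
proof -
  obtain S v where S: "0 < S" and v: "cont v" "v \<noteq> (\<lambda>_. 0)" "\<And>x. K (K v) x = of_real S * v x"
    using eigenvector_exists[OF assms] by blast
  define E where "E = {u. cont u \<and> (\<forall>x. K (K u) x = of_real S * u x)}"
  define inv where "inv V \<longleftrightarrow> V \<subseteq> E \<and> (\<exists>u\<in>V. u \<noteq> (\<lambda>_. 0)) \<and>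
     (\<forall>u\<in>V. \<forall>w\<in>V. (\<lambda>x. u x + w x) \<in> V) \<and> (\<forall>c. \<forall>u\<in>V. (\<lambda>x. c * u x) \<in> V) \<and>
     (\<forall>b. \<forall>u\<in>V. (\<lambda>x. u (x + b)) \<in> V)" for V
  have KKadd: "K (K (\<lambda>x. u x + w x)) x = K (K u) x + K (K w) x" if "cont u" "cont w" for u w x
  proof -
    have "K (\<lambda>x. u x + w x) = (\<lambda>x. K u x + K w x)" if "cont u" "cont w" for u w
      using that unfolding K_def by (simp add: distrib_left K_integrable)
    then show ?thesis using that by (simp add: K_cont)
  qed
  have KKc: "K (K (\<lambda>x. c * u x)) x = c * K (K u) x" for u c x
  proof -
    have "K (\<lambda>x. c * u x) = (\<lambda>x. c * K u x)" for u by (rule ext) (rule K_cmult)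
    then show ?thesis by simp
  qed
  have KKt: "K (K (\<lambda>x. u (x + b))) x = K (K u) (x + b)" if "cont u" for u b x
  proof -
    have "K (\<lambda>x. u (x + b)) = (\<lambda>x. K u (x + b))" if "cont u" for u using K_translate[OF that] by auto
    then show ?thesis using that by (simp add: K_cont)
  qed
  have "inv E"
    unfolding inv_def
  proof (intro conjI ballI allI)
    show "\<exists>u\<in>E. u \<noteq> (\<lambda>_. 0)" using v by (auto simp: E_def)
  qed (auto simp: E_def KKadd KKc KKt distrib_left intro!: continuous_intros cont_translate)
  \<comment> \<open>\<open>n\<close> is the largest size of an orthonormal system in
    \<open>V\<close>. This stands in for the dimension, and \<open>orthonormal_bound\<close>
    guarantees that it exists.\<close>
  define on where "on V n \<longleftrightarrow> (\<exists>F\<subseteq>V. orthonormal F \<and> card F = n) \<and> (\<forall>F\<subseteq>V. orthonormal F \<longrightarrow> card F \<le> n)" for V :: "('a \<Rightarrow> complex) set" and n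
  have ex_on: "\<exists>n. on V n" if "V \<subseteq> E" for V
  proof -
    have "card F \<le> nat \<lceil>B\<^sup>2 / S\<rceil>" if "F \<subseteq> V" "orthonormal F" for F
    proof -
      have "real (card F) * S \<le> B\<^sup>2"
        using that \<open>V \<subseteq> E\<close> by (intro orthonormal_bound S) (auto simp: E_def)
      then have "real (card F) \<le> B\<^sup>2 / S" using S by (simp add: field_simps)
      then show ?thesis by linarith
    qed
    then obtain F where "F \<subseteq> V \<and> orthonormal F" "\<And>G. G \<subseteq> V \<and> orthonormal G \<Longrightarrow> card G \<le> card F"
      using ex_has_greatest_nat[of "\<lambda>F. F \<subseteq> V \<and> orthonormal F" "{}" card "Suc (nat \<lceil>B\<^sup>2 / S\<rceil>)"]
      by (force simp: orthonormal_def less_Suc_eq_le)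
    then show ?thesis unfolding on_def by blast
  qed
  define n where "n = (LEAST n. \<exists>V. inv V \<and> on V n)"
  have "\<exists>n V. inv V \<and> on V n" using \<open>inv E\<close> ex_on[OF order.refl] by blast
  then have "\<exists>V. inv V \<and> on V n" unfolding n_def by (rule LeastI_ex)
  then obtain V where V: "inv V" "on V n" by blast
  have VE: "V \<subseteq> E" and nz: "\<exists>u\<in>V. u \<noteq> (\<lambda>_. 0)"
    and Vadd: "\<And>u w. u \<in> V \<Longrightarrow> w \<in> V \<Longrightarrow> (\<lambda>x. u x + w x) \<in> V"
    and Vc: "\<And>u c. u \<in> V \<Longrightarrow> (\<lambda>x. c * u x) \<in> V"
    and Vt: "\<And>u b. u \<in> V \<Longrightarrow> (\<lambda>x. u (x + b)) \<in> V"
    using V(1) unfolding inv_def by blast+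
  have Vcont: "cont u" if "u \<in> V" for u using that VE by (auto simp: E_def)
  have V0: "(\<lambda>_. 0) \<in> V" using nz Vc[of _ 0] by auto
  have Vsum: "(\<lambda>x. \<Sum>e\<in>G. f e * e x) \<in> V" if "G \<subseteq> V" for G f
    using that by (induction G rule: infinite_finite_induct) (auto intro!: V0 Vadd Vc)
  \<comment> \<open>A maximal orthonormal system spans: a nonzero residual could be normalized and
    added to it.\<close>
  have expand: "u x = (\<Sum>e\<in>F. inner_L2 u e * e x)" if F: "F \<subseteq> V" "orthonormal F" "card F = n" and u: "u \<in> V" for F u x
  proof (rule ccontr)
    assume neq: "u x \<noteq> (\<Sum>e\<in>F. inner_L2 u e * e x)"
    define h where "h = (\<lambda>x. u x - (\<Sum>e\<in>F. inner_L2 u e * e x))"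
    have "h \<in> V"
      using Vadd[OF u Vc[OF Vsum[OF F(1), of "inner_L2 u"], of "-1"]] by (simp add: h_def)
    note res = orthonormal_residual[OF F(2) Vcont[OF u], folded h_def]
    have hc: "cont h" by (rule Vcont[OF \<open>h \<in> V\<close>])
    have "sq_norm h \<noteq> 0" using sq_norm_eq_0[OF hc, of x] neq by (auto simp: h_def)
    then have pos: "sq_norm h > 0" using sq_norm_nonneg[of h] by linarith
    define c where "c = complex_of_real (1 / sqrt (sq_norm h))"
    have cc: "c * cnj c * sq_norm h = 1"
      using pos by (simp add: c_def flip: of_real_mult) 
    define h' where "h' = (\<lambda>x. c * h x)"
    have h'V: "h' \<in> V" unfolding h'_def by (rule Vc[OF \<open>h \<in> V\<close>])
    have hh: "inner_L2 h' h' = 1"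
      using cc by (simp add: h'_def inner_L2_cmult_left inner_L2_cmult_right inner_L2_self[OF hc] mult.assoc)
    have he: "inner_L2 h' e = 0" "inner_L2 e h' = 0" if "e \<in> F" for e
      using res(2)[OF that] inner_L2_commute[of e h'] by (auto simp: h'_def inner_L2_cmult_left)
    have "h' \<notin> F" using he(1)[of h'] hh by auto
    have "orthonormal (insert h' F)"
      using F(2) hh he Vcont[OF h'V] by (auto simp: orthonormal_def)
    moreover have "insert h' F \<subseteq> V" using h'V F(1) by auto
    ultimately have "card (insert h' F) \<le> n" using V(2) by (auto simp: on_def)
    then show False using \<open>h' \<notin> F\<close> F(2,3) by (simp add: orthonormal_def)
  qed
  \<comment> \<open>By the choice of \<open>n\<close>, a maximal system of \<open>V'\<close> has
    \<open>n\<close> elements as well, so it is maximal in \<open>V\<close> and spans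
    \<open>V\<close>.\<close>
  have minimal: "V \<subseteq> V'" if V': "inv V'" "V' \<subseteq> V" for V'
  proof
    fix u assume u: "u \<in> V"
    obtain n' where n': "on V' n'" using ex_on V' VE by (meson order.trans)
    have "n \<le> n'" unfolding n_def using V'(1) n' by (intro Least_le) blast
    obtain F where F: "F \<subseteq> V'" "orthonormal F" "card F = n'" using n' by (auto simp: on_def)
    then have "n' \<le> n" using V(2) V'(2) by (auto simp: on_def)
    with \<open>n \<le> n'\<close> F have "card F = n" by simp
    have "F \<subseteq> V" using F(1) V'(2) by blast
    then have u_eq: "u = (\<lambda>x. \<Sum>e\<in>F. inner_L2 u e * e x)"
      by (intro ext expand F \<open>card F = n\<close> u)
    have sum':  "(\<lambda>x. \<Sum>e\<in>G. f e * e x) \<in> V'" if "G \<subseteq> V'" for G f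
    proof -
      have add': "(\<lambda>x. u x + w x) \<in> V'" if "u \<in> V'" "w \<in> V'" for u w
        using V'(1) that unfolding inv_def by blast
      have c': "(\<lambda>x. c * u x) \<in> V'" if "u \<in> V'" for c u
        using V'(1) that unfolding inv_def by blast
      obtain u where "u \<in> V'" using V'(1) unfolding inv_def by blast
      from c'[OF this, of 0] have "(\<lambda>_. 0) \<in> V'" by simp
      then show ?thesis using that
        by (induction G rule: infinite_finite_induct) (auto intro!: add' c')
    qed
    show "u \<in> V'" by (subst u_eq) (rule sum'[OF F(1)])
  qed
  obtain F where F: "F \<subseteq> V" "orthonormal F" "card F = n" using V(2) by (auto simp: on_def)
  have "\<exists>\<mu>. \<forall>u\<in>V. \<forall>x. u (x + b) = \<mu> * u x" for b
  proof -
    obtain w where w: "w \<in> V" "w \<noteq> (\<lambda>_. 0)" using nz by blast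
    have "finite F" using F(2) by (simp add: orthonormal_def)
    have ex: "\<exists>c. \<forall>x. u x = (\<Sum>e\<in>F. c e * e x)" if "u \<in> V" for u
      by (rule exI[of _ "inner_L2 u"]) (use expand[OF F that] in blast)
    from shift_eigenvector[of V w F b, OF Vcont Vadd Vc Vt w \<open>finite F\<close> F(1) ex]
    obtain \<mu> u where u: "u \<in> V" "u \<noteq> (\<lambda>_. 0)" "\<And>x. u (x + b) = \<mu> * u x" by blast
    \<comment> \<open>Invariance under any other translation by \<open>b'\<close> comes from
      commutativity of the group.\<close>
    define V' where "V' = {u \<in> V. \<forall>x. u (x + b) = \<mu> * u x}"
    have "inv V'"
      unfolding inv_def
    proof (intro conjI ballI allI)
      show "V' \<subseteq> E" using VE by (auto simp: V'_def)
      show "\<exists>u\<in>V'. u \<noteq> (\<lambda>_. 0)" using u unfolding V'_def by blast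
      show "(\<lambda>x. f x + g x) \<in> V'" if "f \<in> V'" "g \<in> V'" for f g
        using that Vadd[of f g] unfolding V'_def by (simp add: distrib_left)
      show "(\<lambda>x. d * f x) \<in> V'" if "f \<in> V'" for f d
        using that Vc[of f d] unfolding V'_def by simp
      show "(\<lambda>x. f (x + b')) \<in> V'" if "f \<in> V'" for f b'
      proof -
        have "f (x + b + b') = \<mu> * f (x + b')" for x
        proof -
          have "f ((x + b') + b) = \<mu> * f (x + b')" using that unfolding V'_def by blast
          then show ?thesis by (simp only: add.assoc add.commute[of b])
        qed
        then show ?thesis using that Vt[of f b'] unfolding V'_def by simp
      qed
    qed
    then have "V \<subseteq> V'" by (rule minimal) (auto simp: V'_def)
    then show ?thesis by (auto simp: V'_def)
  qed
  then obtain c where c: "\<And>b u x. u \<in> V \<Longrightarrow> u (x + b) = c b * u x" by metis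
  obtain u where u: "u \<in> V" "u \<noteq> (\<lambda>_. 0)" using nz by blast
  have uc: "cont u" by (rule Vcont[OF u(1)])
  have ux: "u x = c x * u 0" for x using c[OF u(1), of 0 x] by simp
  have u0: "u 0 \<noteq> 0"
  proof
    assume "u 0 = 0"
    then have "u x = 0" for x using ux[of x] by simp
    then show False using u(2) by blast
  qed
  \<comment> \<open>As a multiple of \<open>u\<close> the function \<open>c\<close> is continuous
    and itself lies in \<open>V\<close>, hence in the eigenspace.\<close>
  have c_eq: "c = (\<lambda>x. (1 / u 0) * u x)"
  proof
    show "c x = (1 / u 0) * u x" for x using ux[of x] u0 by (simp add: field_simps)
  qed
  have cc: "cont c" unfolding c_eq using uc by (intro continuous_intros)
  have cmult: "c (x + y) = c x * c y" for x y
  proof -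
    have "c (x + y) * u 0 = c x * c y * u 0"
      using c[OF u(1), of x y] ux[of "x + y"] ux[of x] by (metis mult.assoc mult.commute)
    then show ?thesis using u0 by simp
  qed
  have "cmod (c b) = 1" for b
  proof -
    have "sq_norm u \<noteq> 0" using sq_norm_eq_0[OF uc, of 0] u0 by auto
    have "sq_norm u = sq_norm (\<lambda>x. u (x + b))" using sq_norm_translate[OF uc] by simp
    also have "\<dots> = (cmod (c b))\<^sup>2 * sq_norm u" unfolding c[OF u(1)] by (rule sq_norm_cmult)
    finally have "(cmod (c b))\<^sup>2 = 1" using \<open>sq_norm u \<noteq> 0\<close> by simp
    then show ?thesis by (simp add: power2_eq_1_iff) (use norm_ge_zero[of "c b"] in linarith)
  qed
  then have "c \<in> characters" using cc cmult by (auto simp: characters_def)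
  moreover have "c \<in> V" unfolding c_eq by (rule Vc[OF u(1)])
  then have "K (K c) x = of_real S * c x" for x using VE by (auto simp: E_def)
  ultimately show ?thesis using that S by blast
qed

end

section \<open>Urysohn functions and separation of points\<close>

lemma Urysohn_compact_group:
  fixes S T :: "'a::compact_ab_group set"
  assumes "closed S" "closed T" "S \<inter> T = {}"
  obtains f :: "'a \<Rightarrow> real" where "continuous_on UNIV f" "\<And>x. 0 \<le> f x" "\<And>x. f x \<le> 1"
    "\<And>x. x \<in> S \<Longrightarrow> f x = 1" "\<And>x. x \<in> T \<Longrightarrow> f x = 0"
proof -
  have "Hausdorff_space (euclidean :: 'a topology)"
    unfolding Hausdorff_space_def disjnt_def using hausdorff by auto
  then have "normal_space (euclidean :: 'a topology)"
    using compact_group by (intro compact_Hausdorff_or_regular_imp_normal_space)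
      (auto simp: compact_space_def)
  then obtain f where f: "continuous_map euclidean (top_of_set {0..1::real}) f" "f ` T \<subseteq> {0}" "f ` S \<subseteq> {1}"
    using Urysohn_lemma[of euclidean T S 0 1] assms by (auto simp: disjnt_def Int_commute)
  then have "continuous_on UNIV f" "\<And>x. f x \<in> {0..1}"
    by (auto simp: continuous_map_in_subtopology)
  then show ?thesis using that[of f] f by (auto simp: image_subset_iff)
qed

theorem characters_separate:
  fixes a :: "'a::compact_ab_group"
  assumes "a \<noteq> 0"
  obtains c where "c \<in> characters" "c a \<noteq> 1"
proof -
  obtain f :: "'a \<Rightarrow> real" where f: "continuous_on UNIV f" "f 0 = 1" "f a = 0"
    using Urysohn_compact_group[of "{0}" "{a}"] assms by (metis disjoint_insert(1) closed_singleton inf_bot_right insertCI singletonD)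
  \<comment> \<open>Multiplying by the reflection makes \<open>r\<close> even and forces a zero at
    \<open>- a\<close> as well as at \<open>a\<close>.\<close>
  define r where "r x = complex_of_real (f x * f (- x))" for x
  have rc: "cont r" unfolding r_def
    by (intro continuous_intros f(1) continuous_on_compose2[OF f(1)]) auto
  have rr: "r (-x) = r x" "cnj (r x) = r x" for x by (auto simp: r_def)
  \<comment> \<open>Minus the symmetric second difference of \<open>r\<close> with step
    \<open>a\<close>. It is again real and even, and \<open>k 0 = 2\<close> since \<open>r\<close>
    vanishes at \<open>a\<close> and \<open>- a\<close>.\<close>
  define k where "k x = 2 * r x - r (x - a) - r (x + a)" for x
  have kc: "cont k" unfolding k_def
    by (intro continuous_intros rc continuous_on_compose2[OF rc]) auto
  obtain B where B: "0 < B" "\<And>x. cmod (k x) \<le> B" using continuous_bounded[OF kc] by blast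
  have herm: "k (- x) = cnj (k x)" for x
  proof -
    have "- x - a = - (x + a)" "- x + a = - (x - a)" by simp_all
    then show ?thesis by (simp only: k_def rr complex_cnj_diff complex_cnj_mult complex_cnj_numeral) simp
  qed
  interpret hermitian_kernel k B
    by unfold_locales (use kc B herm in auto)
  have "k 0 \<noteq> 0" using f rr(1)[of a] by (simp add: k_def r_def)
  from character_exists[OF this] obtain c S
    where c: "c \<in> characters" "0 < S" "\<And>x. K (K c) x = of_real S * c x" by metis
  have cc: "cont c" and cm: "\<And>x y. c (x + y) = c x * c y" and cn: "\<And>x. cmod (c x) = 1"
    using c(1) by (auto simp: characters_def)
  have "c a \<noteq> 1"
  proof
    assume ca: "c a = 1"
    then have inv: "c (x + a) = c x" for x by (simp add: cm)
    have inv': "c (x - a) = c x" for x using inv[of "x - a"] by simp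
    \<comment> \<open>Translating the variable of integration by \<open>a\<close> changes neither
      \<open>c\<close> nor the measure, so the three convolutions of \<open>r\<close> with
      \<open>c\<close> agree, and the weights 2, -1, -1 cancel.\<close>
    have "K c x = 0" for x
    proof -
      have int: "integrable haar (\<lambda>y. r (x' - y) * c y)" for x'
        by (intro continuous_integrable continuous_intros cont_reflect rc cc)
      have bm: "(\<lambda>y. r (x' - y) * c y) \<in> borel_measurable borel" for x'
        by (intro borel_measurable_continuous_UNIV continuous_intros cont_reflect rc cc)
      have 1: "(LINT y|haar. r (x + a - y) * c y) = (LINT y|haar. r (x - y) * c y)"
        using integral_translate[OF bm, of "x + a" a] inv by (simp add: algebra_simps)
      have 2: "(LINT y|haar. r (x - a - y) * c y) = (LINT y|haar. r (x - y) * c y)"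
        using integral_translate[OF bm, of "x - a" "- a"] inv' by (simp add: algebra_simps)
      have "K c x = (LINT y|haar. 2 * (r (x - y) * c y) - r (x - a - y) * c y - r (x + a - y) * c y)"
        unfolding K_def k_def by (intro Bochner_Integration.integral_cong) (auto simp: algebra_simps)
      also have "\<dots> = 2 * (LINT y|haar. r (x - y) * c y) - (LINT y|haar. r (x - a - y) * c y) - (LINT y|haar. r (x + a - y) * c y)"
        using int by (subst Bochner_Integration.integral_diff Bochner_Integration.integral_diff, simp, simp)+ simp
      finally show ?thesis unfolding 1 2 by simp
    qed
    then have "K c = (\<lambda>_. 0)" by auto
    then have "of_real S * c 0 = 0" using c(3)[of 0] by (simp add: K_def)
    then show False using c(2) cn[of 0] by auto
  qed
  then show ?thesis using that c(1) by blast
qed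

section \<open>Density of trigonometric polynomials\<close>

lemma character_cont: "\<gamma> \<in> characters \<Longrightarrow> cont \<gamma>"
  and character_norm: "\<gamma> \<in> characters \<Longrightarrow> cmod (\<gamma> x) = 1"
  and character_add: "\<gamma> \<in> characters \<Longrightarrow> \<gamma> (x + y) = \<gamma> x * \<gamma> y"
  by (auto simp: characters_def)

lemma character_bmeas: "\<gamma> \<in> characters \<Longrightarrow> bmeas \<gamma>"
  by (intro borel_measurable_continuous_UNIV character_cont)

lemma character_nonzero: "\<gamma> \<in> characters \<Longrightarrow> \<gamma> x \<noteq> 0"
  using character_norm[of \<gamma> x] by auto

lemma character_one: "(\<lambda>_. 1) \<in> characters"
  by (auto simp: characters_def)

lemma character_mult: "\<gamma> \<in> characters \<Longrightarrow> \<delta> \<in> characters \<Longrightarrow> (\<lambda>x. \<gamma> x * \<delta> x) \<in> characters"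
  by (auto simp: characters_def norm_mult intro!: continuous_intros)

lemma character_cnj: "\<gamma> \<in> characters \<Longrightarrow> (\<lambda>x. cnj (\<gamma> x)) \<in> characters"
  by (auto simp: characters_def intro!: continuous_intros)

lemma character_mult_cnj: "\<gamma> \<in> characters \<Longrightarrow> \<gamma> x * cnj (\<gamma> x) = 1"
  using character_norm[of \<gamma> x] by (simp flip: complex_norm_square)

text \<open>Translation by \<open>a\<close> multiplies the integral by \<open>\<gamma> a\<close>, so
  it is 0 as soon as some \<open>\<gamma> a\<close> differs from 1.\<close>

lemma integral_character:
  assumes "\<gamma> \<in> characters"
  shows "(LINT x|haar. \<gamma> x) = (if \<gamma> = (\<lambda>_. 1) then 1 else 0)"
proof (cases "\<gamma> = (\<lambda>_. 1)")
  case False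
  then obtain a where a: "\<gamma> a \<noteq> 1" by auto
  have "(LINT x|haar. \<gamma> x) = (LINT x|haar. \<gamma> (a + x))"
    by (rule integral_translate[symmetric]) (rule character_bmeas[OF assms])
  also have "\<dots> = \<gamma> a * (LINT x|haar. \<gamma> x)"
    by (simp add: character_add[OF assms])
  finally show ?thesis using a False by simp
qed simp

lemma character_orthogonal:
  assumes "\<gamma> \<in> characters" "\<delta> \<in> characters"
  shows "(LINT x|haar. \<gamma> x * cnj (\<delta> x)) = (if \<gamma> = \<delta> then 1 else 0)"
proof -
  have "(\<lambda>x. \<gamma> x * cnj (\<delta> x)) = (\<lambda>_. 1) \<longleftrightarrow> \<gamma> = \<delta>"
  proof
    assume eq: "(\<lambda>x. \<gamma> x * cnj (\<delta> x)) = (\<lambda>_. 1)"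
    show "\<gamma> = \<delta>"
    proof
      fix x
      have "\<gamma> x = \<gamma> x * (\<delta> x * cnj (\<delta> x))" using assms by (simp add: character_mult_cnj)
      also have "\<dots> = (\<gamma> x * cnj (\<delta> x)) * \<delta> x" by (simp add: ac_simps)
      finally show "\<gamma> x = \<delta> x" using fun_cong[OF eq, of x] by simp
    qed
  qed (use assms in \<open>simp add: character_mult_cnj\<close>)
  then show ?thesis
    using integral_character[OF character_mult[OF assms(1) character_cnj[OF assms(2)]]] by simp
qed

text \<open>Trigonometric polynomials as functions. The inductive form suits the proof that they
  form a conjugation-invariant algebra; \<open>trig_fun_trig_poly\<close> returns to the form
  \<open>trig_poly M c\<close> with pairwise distinct characters.\<close>

inductive_set trig_fun :: "('a::compact_ab_group \<Rightarrow> complex) set" where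
  zero: "(\<lambda>_. 0) \<in> trig_fun"
| char: "\<gamma> \<in> characters \<Longrightarrow> f \<in> trig_fun \<Longrightarrow> (\<lambda>x. c * \<gamma> x + f x) \<in> trig_fun"

lemma trig_fun_add: "f \<in> trig_fun \<Longrightarrow> g \<in> trig_fun \<Longrightarrow> (\<lambda>x. f x + g x) \<in> trig_fun"
proof (induction rule: trig_fun.induct)
  case (char \<gamma> f c)
  then show ?case using trig_fun.char[of \<gamma> "\<lambda>x. f x + g x" c] by (simp add: add.assoc)
qed simp

lemma trig_fun_cmult_char:
  assumes "\<delta> \<in> characters"
  shows "f \<in> trig_fun \<Longrightarrow> (\<lambda>x. d * \<delta> x * f x) \<in> trig_fun"
proof (induction rule: trig_fun.induct)
  case (char \<gamma> f c)
  then show ?case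
    using trig_fun.char[OF character_mult[OF assms char(1)] char(3), of "d * c"]
    by (simp add: algebra_simps)
qed (simp add: trig_fun.zero)

lemma trig_fun_mult: "f \<in> trig_fun \<Longrightarrow> g \<in> trig_fun \<Longrightarrow> (\<lambda>x. f x * g x) \<in> trig_fun"
proof (induction rule: trig_fun.induct)
  case (char \<gamma> f c)
  then show ?case
    using trig_fun_add[OF trig_fun_cmult_char[OF char(1) char(4), of c] char(3)[OF char(4)]]
    by (simp add: algebra_simps)
qed (simp add: trig_fun.zero)

lemma trig_fun_cnj: "f \<in> trig_fun \<Longrightarrow> (\<lambda>x. cnj (f x)) \<in> trig_fun"
proof (induction rule: trig_fun.induct)
  case (char \<gamma> f c)
  then show ?case
    using trig_fun.char[OF character_cnj[OF char(1)] char(3), of "cnj c"] by simp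
qed (simp add: trig_fun.zero)

lemma trig_fun_char: "\<gamma> \<in> characters \<Longrightarrow> (\<lambda>x. c * \<gamma> x) \<in> trig_fun"
  using trig_fun.char[OF _ trig_fun.zero, of \<gamma> c] by simp

lemma trig_fun_const: "(\<lambda>_. c) \<in> trig_fun"
  using trig_fun_char[OF character_one, of c] by simp

lemma trig_fun_cmult: "f \<in> trig_fun \<Longrightarrow> (\<lambda>x. c * f x) \<in> trig_fun"
  by (rule trig_fun_mult[OF trig_fun_const])

lemma trig_fun_cont: "f \<in> trig_fun \<Longrightarrow> cont f"
proof (induction rule: trig_fun.induct)
  case (char \<gamma> f c)
  then show ?case using character_cont[OF char(1)] by (intro continuous_intros)
qed simp

lemma trig_poly_insert_sum:
  assumes "finite M" "\<gamma> \<in> M"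
  shows "trig_poly M (c(\<gamma> := c \<gamma> + d)) = scale_L0 d (L0_of \<gamma>) + trig_poly M c"
proof -
  have "trig_poly M (c(\<gamma> := c \<gamma> + d)) = scale_L0 (c \<gamma> + d) (L0_of \<gamma>) + (\<Sum>\<delta>\<in>M - {\<gamma>}. scale_L0 (c \<delta>) (L0_of \<delta>))"
    unfolding trig_poly_def by (subst sum.remove[OF assms]) (auto intro!: sum.cong)
  also have "\<dots> = scale_L0 d (L0_of \<gamma>) + trig_poly M c"
    unfolding trig_poly_def sum.remove[OF assms, of "\<lambda>\<delta>. scale_L0 (c \<delta>) (L0_of \<delta>)"]
    by (simp add: L0.scale_left_distrib algebra_simps)
  finally show ?thesis .
qed

lemma trig_poly_mono:
  assumes "finite M'" "M \<subseteq> M'"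
  shows "trig_poly M c = trig_poly M' (\<lambda>\<gamma>. if \<gamma> \<in> M then c \<gamma> else 0)"
  unfolding trig_poly_def using assms
  by (intro sum.mono_neutral_cong_left) auto

lemma trig_fun_trig_poly:
  "f \<in> trig_fun \<Longrightarrow> \<exists>M c. finite M \<and> M \<subseteq> characters \<and> L0_of f = trig_poly M c"
proof (induction rule: trig_fun.induct)
  case zero
  show ?case by (rule exI[of _ "{}"]) (simp add: trig_poly_def L0_of_0)
next
  case (char \<gamma> f d)
  then obtain M c where M: "finite M" "M \<subseteq> characters" "L0_of f = trig_poly M c" by blast
  define c' where "c' = (\<lambda>\<delta>. if \<delta> \<in> M then c \<delta> else 0)"
  have bf: "bmeas f" "bmeas \<gamma>"
    using char by (auto intro: borel_measurable_continuous_UNIV trig_fun_cont character_bmeas)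
  have "L0_of f = trig_poly (insert \<gamma> M) c'"
    unfolding M(3) c'_def by (rule trig_poly_mono) (use M in auto)
  then have "L0_of (\<lambda>x. d * \<gamma> x + f x) = trig_poly (insert \<gamma> M) (c'(\<gamma> := c' \<gamma> + d))"
    using M(1) bf by (simp add: trig_poly_insert_sum L0_of_scale flip: L0_of_add)
  then show ?case using M char(1) by (intro exI[of _ "insert \<gamma> M"]) auto
qed

text \<open>The real Stone-Weierstrass theorem is applied separately to the real and imaginary parts
  of \<open>u\<close>, in the ring of real functions that are trigonometric polynomials.\<close>

lemma trig_fun_dense_uniform:
  fixes u :: "'a::compact_ab_group \<Rightarrow> complex"
  assumes u: "cont u" and e: "0 < e"
  obtains f where "f \<in> trig_fun" "\<And>x. cmod (u x - f x) < e"
proof -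
  define R where "R = {g :: 'a \<Rightarrow> real. (\<lambda>x. complex_of_real (g x)) \<in> trig_fun}"
  have Re: "(\<lambda>x. Re (f x)) \<in> R" if "f \<in> trig_fun" for f
  proof -
    have "(\<lambda>x. complex_of_real (Re (f x))) = (\<lambda>x. (1/2) * (f x + cnj (f x)))"
      by (auto simp: complex_add_cnj)
    then show ?thesis unfolding R_def mem_Collect_eq
      by (simp only:) (intro trig_fun_cmult trig_fun_add trig_fun_cnj that)
  qed
  interpret function_ring_on R UNIV
  proof
    show "continuous_on UNIV g" if "g \<in> R" for g
    proof -
      have "continuous_on UNIV (\<lambda>x. Re (complex_of_real (g x)))"
        using that unfolding R_def by (intro continuous_intros trig_fun_cont) auto
      then show ?thesis by simp
    qed
    show "\<exists>f\<in>R. f x \<noteq> f y" if "x \<noteq> y" for x y :: 'a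
    proof -
      have "x - y \<noteq> 0" using that by simp
      from characters_separate[OF this] obtain c where c: "c \<in> characters" "c (x - y) \<noteq> 1" .
      have "c x = c (x - y) * c y" using character_add[OF c(1), of "x - y" y] by simp
      then have "c x \<noteq> c y" using c(2) character_nonzero[OF c(1), of y] by auto
      \<comment> \<open>The imaginary part is written as the real part of \<open>- \<i> * c\<close>,
        so that both separating functions come from \<open>Re\<close>.\<close>
      then have "Re (1 * c x) \<noteq> Re (1 * c y) \<or> Re (- \<i> * c x) \<noteq> Re (- \<i> * c y)"
        by (simp add: complex_eq_iff)
      moreover have "(\<lambda>x. Re (1 * c x)) \<in> R" by (rule Re[OF trig_fun_char[OF c(1)]])
      moreover have "(\<lambda>x. Re (- \<i> * c x)) \<in> R" by (rule Re[OF trig_fun_char[OF c(1)]])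
      ultimately show ?thesis by (elim disjE) (erule bexI[rotated], assumption)+
    qed
  qed (auto simp: R_def trig_fun_const trig_fun_add trig_fun_mult compact_group)
  have "continuous_on UNIV (\<lambda>x. Re (u x))" "continuous_on UNIV (\<lambda>x. Im (u x))"
    using u by (auto intro!: continuous_intros)
  note SW = this[THEN Stone_Weierstrass_basic, of "e / 2"]
  obtain g where g: "g \<in> R" "\<forall>x\<in>UNIV. \<bar>Re (u x) - g x\<bar> < e / 2" using SW(1) e by auto
  obtain h where h: "h \<in> R" "\<forall>x\<in>UNIV. \<bar>Im (u x) - h x\<bar> < e / 2" using SW(2) e by auto
  show ?thesis
  proof (rule that)
    show "(\<lambda>x. complex_of_real (g x) + \<i> * complex_of_real (h x)) \<in> trig_fun"
      using g(1) h(1) by (intro trig_fun_add trig_fun_cmult) (auto simp: R_def)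
    fix x
    show "cmod (u x - (complex_of_real (g x) + \<i> * complex_of_real (h x))) < e"
      using cmod_le[of "u x - (complex_of_real (g x) + \<i> * complex_of_real (h x))"] g(2)[rule_format, of x] h(2)[rule_format, of x] by simp
  qed
qed

section \<open>Continuous functions are dense in \<open>Lp r\<close>\<close>

definition cont_approx :: "real \<Rightarrow> 'a::compact_ab_group L0 \<Rightarrow> bool" where
  "cont_approx r f \<longleftrightarrow> (\<forall>e>0. \<exists>g. cont g \<and> Lp_norm r (f - L0_of g) < e)"

lemma cont_in_Lp:
  assumes "cont g" "0 \<le> r"
  shows "L0_of g \<in> Lp r"
proof -
  obtain B where "\<And>x. cmod (g x) \<le> B" using continuous_bounded[OF assms(1)] by blast
  then show ?thesis
    using borel_measurable_continuous_UNIV[OF assms(1)] assms(2) finite_measure_haar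
    by (subst L0_of_in_Lp) (auto intro!: p_integrable_bounded[where C = B])
qed

lemma cont_approx_add:
  assumes r: "1 \<le> r" and fg: "f \<in> Lp r" "g \<in> Lp r" "cont_approx r f" "cont_approx r g"
  shows "cont_approx r (f + g)"
  unfolding cont_approx_def
proof (intro allI impI)
  fix e :: real assume "0 < e"
  then have "e / 2 > 0" by simp
  then obtain u v where u: "cont u" "Lp_norm r (f - L0_of u) < e / 2"
    and v: "cont v" "Lp_norm r (g - L0_of v) < e / 2"
    using fg(3,4) unfolding cont_approx_def by metis
  have "f + g - L0_of (\<lambda>x. u x + v x) = (f - L0_of u) + (g - L0_of v)"
    using u(1) v(1) by (simp add: borel_measurable_continuous_UNIV flip: L0_of_add)
  then have eq: "Lp_norm r (f + g - L0_of (\<lambda>x. u x + v x)) = Lp_norm r ((f - L0_of u) + (g - L0_of v))"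
    by (rule arg_cong)
  have "Lp_norm r (f + g - L0_of (\<lambda>x. u x + v x)) \<le> Lp_norm r (f - L0_of u) + Lp_norm r (g - L0_of v)"
    unfolding eq using r u v fg by (intro Lp_norm_add Lp_diff cont_in_Lp) auto
  also have "\<dots> < e" using u v by simp
  finally show "\<exists>h. cont h \<and> Lp_norm r (f + g - L0_of h) < e"
    using u v by (intro exI[of _ "\<lambda>x. u x + v x"]) (auto intro: continuous_intros)
qed

lemma cont_approx_scale:
  assumes r: "1 \<le> r" and f: "cont_approx r f"
  shows "cont_approx r (scale_L0 c f)"
  unfolding cont_approx_def
proof (intro allI impI)
  fix e :: real assume "0 < e"
  have c: "cmod c + 1 > 0" by (simp add: add_nonneg_pos)
  then have "e / (cmod c + 1) > 0" using \<open>0 < e\<close> by simp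
  then obtain u where u: "cont u" "Lp_norm r (f - L0_of u) < e / (cmod c + 1)"
    using f unfolding cont_approx_def by metis
  have "scale_L0 c f - L0_of (\<lambda>x. c * u x) = scale_L0 c (f - L0_of u)"
    using u(1) by (simp add: borel_measurable_continuous_UNIV L0.scale_right_diff_distrib flip: L0_of_scale)
  then have "Lp_norm r (scale_L0 c f - L0_of (\<lambda>x. c * u x)) = cmod c * Lp_norm r (f - L0_of u)"
    using r by (simp add: Lp_norm_scale)
  also have "\<dots> \<le> (cmod c + 1) * Lp_norm r (f - L0_of u)" by (intro mult_right_mono) auto
  also have "\<dots> < e" using u(2) c by (simp add: field_simps)
  finally show "\<exists>h. cont h \<and> Lp_norm r (scale_L0 c f - L0_of h) < e"
    using u by (intro exI[of _ "\<lambda>x. c * u x"]) (auto intro: continuous_intros)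
qed

text \<open>Inner regularity is available for open sets. The compact set \<open>K\<close> therefore
  approximates the open \<open>U\<close> containing \<open>A\<close> rather than \<open>A\<close>
  itself, and a Urysohn function for \<open>K\<close> inside \<open>U\<close> can differ from the
  indicator of \<open>A\<close> only on \<open>U - A\<close> and \<open>U - K\<close>.\<close>

lemma cont_approx_indicator:
  fixes A :: "'a::compact_ab_group set"
  assumes A: "A \<in> sets borel" and r: "1 \<le> r"
  shows "cont_approx r (L0_of (indicator A))"
  unfolding cont_approx_def
proof (intro allI impI)
  fix e :: real assume e: "0 < e"
  \<comment> \<open>The two exceptional sets together measure at most
    \<open>2 * d = e powr r / 2\<close>, which leaves the strict inequality.\<close>
  define d where "d = e powr r / 4"
  have d: "d > 0" using e by (simp add: d_def)
  have fin: "emeasure haar X \<noteq> \<infinity>" for X :: "'a set" by simp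
  have "emeasure haar A < emeasure haar A + ennreal d"
    using d fin by (simp add: ennreal_add_left_cancel_less[of _ 0 "ennreal d", simplified] less_top)
  then obtain U where U: "open U" "A \<subseteq> U" "emeasure haar U < emeasure haar A + ennreal d"
    using haar_outer_regular[OF A] by (auto simp: INF_less_iff)
  have U_less: "measure haar U < measure haar A + d"
    using U(3) d by (simp add: haar.emeasure_eq_measure ennreal_less_iff flip: ennreal_plus)
  have "\<exists>K. compact K \<and> K \<subseteq> U \<and> measure haar U - d < measure haar K"
  \<comment> \<open>A negative bound would be truncated to 0 by \<open>ennreal\<close>; then the
    empty set serves as \<open>K\<close>.\<close>
  proof (cases "measure haar U - d < 0")
    case True
    then show ?thesis by (intro exI[of _ "{}"]) auto
  next
    case False
    have "ennreal (measure haar U - d) < emeasure haar U"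
      using d False by (subst haar.emeasure_eq_measure) (simp add: ennreal_less_iff)
    then obtain K where "compact K" "K \<subseteq> U" "ennreal (measure haar U - d) < emeasure haar K"
      using haar_inner_regular[OF U(1)] by (auto simp: less_SUP_iff)
    then show ?thesis using False by (auto simp: haar.emeasure_eq_measure ennreal_less_iff)
  qed
  then obtain K where K: "compact K" "K \<subseteq> U" "measure haar U - d < measure haar K" by blast
  have "closed K" using K(1) by (rule compact_imp_closed)
  then obtain f :: "'a \<Rightarrow> real" where f: "continuous_on UNIV f" "\<And>x. 0 \<le> f x" "\<And>x. f x \<le> 1"
      "\<And>x. x \<in> K \<Longrightarrow> f x = 1" "\<And>x. x \<in> - U \<Longrightarrow> f x = 0"
    using Urysohn_compact_group[of K "- U"] U(1) K(2) by (auto simp: closed_Compl)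
  define g where "g x = complex_of_real (f x)" for x
  have g: "cont g" unfolding g_def by (intro continuous_intros f(1))
  have [measurable]: "A \<in> sets haar" "U \<in> sets haar" "K \<in> sets haar"
    using A U(1) \<open>closed K\<close> by (auto simp: sets_haar)
  have pw: "cmod (indicator A x - g x) powr r \<le> indicator (U - A) x + indicator (U - K) x" for x
  proof -
    consider "x \<notin> U" | "x \<in> U" "x \<notin> A \<or> x \<notin> K" | "x \<in> A" "x \<in> K" using U(2) by blast
    then show ?thesis
    proof cases
      case 1 then show ?thesis using U(2) f(5)[of x] by (auto simp: g_def indicator_def)
    next
      case 2
      have "cmod (indicator A x - g x) \<le> 1"
      proof (cases "x \<in> A")
        case True
        then have "indicator A x - g x = of_real (1 - f x)" by (simp add: g_def)
        then show ?thesis using f(2,3)[of x] by (simp only: norm_of_real)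
      qed (use f(2,3)[of x] in \<open>simp add: g_def\<close>)
      then have "cmod (indicator A x - g x) powr r \<le> 1" using r by (simp add: powr_le1)
      also have "1 \<le> (indicator (U - A) x + indicator (U - K) x :: real)" using 2 by (auto simp: indicator_def)
      finally show ?thesis .
    next
      case 3 then show ?thesis using f(4)[of x] by (auto simp: g_def indicator_def)
    qed
  qed
  have bm: "bmeas (indicator A :: 'a \<Rightarrow> complex)" "bmeas g"
    using A g by (auto intro: borel_measurable_continuous_UNIV)
  have lp: "L0_of (indicator A) - L0_of g \<in> Lp r"
  proof (rule Lp_diff[OF r _ cont_in_Lp[OF g]])
    show "L0_of (indicator A :: 'a \<Rightarrow> complex) \<in> Lp r"
      using bm r finite_measure_haar by (subst L0_of_in_Lp) (auto intro!: p_integrable_bounded[where C = 1] simp: indicator_def)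
  qed (use r in simp)
  have "pnorm haar r (\<lambda>x. indicator A x - g x) \<le> (2 * d) powr (1 / r)"
  proof (subst pnorm_le_iff)
    have "(LINT x|haar. cmod (indicator A x - g x) powr r) \<le> (LINT x|haar. indicator (U - A) x + indicator (U - K) x)"
    proof (intro integral_mono pw)
      have "bmeas (\<lambda>x. indicator A x - g x)" using bm by simp
      with lp show "integrable haar (\<lambda>x. cmod (indicator A x - g x) powr r)"
        using bm by (simp add: L0_of_diff L0_of_in_Lp p_integrable_def)
    qed (auto intro!: integrable_real_indicator simp: less_top[symmetric])
    also have "\<dots> = measure haar (U - A) + measure haar (U - K)"
      by (subst Bochner_Integration.integral_add) (auto intro!: integrable_real_indicator simp: less_top[symmetric])
    also have "\<dots> = (measure haar U - measure haar A) + (measure haar U - measure haar K)"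
      using U(2) K(2) by (simp add: haar.finite_measure_Diff)
    also have "\<dots> \<le> 2 * d" using U_less K(3) by simp
    also have "\<dots> = ((2 * d) powr (1 / r)) powr r" using d r by (simp add: powr_powr)
    finally show "(LINT x|haar. cmod (indicator A x - g x) powr r) \<le> ((2 * d) powr (1 / r)) powr r" .
  qed (use r in auto)
  also have "\<dots> < (e powr r) powr (1 / r)"
    using d r e by (intro powr_less_mono2) (auto simp: d_def)
  also have "\<dots> = e" using e r by (simp add: powr_powr)
  finally show "\<exists>g. cont g \<and> Lp_norm r (L0_of (indicator A) - L0_of g) < e"
    using g bm by (intro exI[of _ g]) (simp add: L0_of_diff Lp_norm_L0_of)
qed

text \<open>Indicators give simple functions by linearity, and dominated convergence gives the
  rest.\<close>

lemma Lp_cont_approx: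
  fixes f :: "'a::compact_ab_group L0"
  assumes r: "1 \<le> r" and f: "f \<in> Lp r"
  shows "cont_approx r f"
proof -
  obtain h where h: "bmeas h" "p_integrable haar r h" "f = L0_of h" using f by (rule Lp_cases)
  have simple: "L0_of s \<in> Lp r \<and> cont_approx r (L0_of s)" if s: "simple_function haar s" for s :: "'a \<Rightarrow> complex"
  proof -
    have fin: "finite (range s)" using s by (simp add: simple_function_def)
    have A: "s -` {y} \<in> sets borel" for y
      using simple_functionD(2)[OF s, of "{y}"] by (simp add: sets_haar)
    have "s = (\<lambda>x. \<Sum>y\<in>range s. y * indicator (s -` {y}) x)"
      using fin by (auto simp: indicator_def if_distrib sum.delta cong: if_cong)
    then have "L0_of s = L0_of (\<lambda>x. \<Sum>y\<in>range s. y * indicator (s -` {y}) x)" by (rule arg_cong)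
    also have "\<dots> = (\<Sum>y\<in>range s. scale_L0 y (L0_of (indicator (s -` {y}))))"
      using A by (simp add: L0_of_scale L0_of_sum)
    finally have eq: "L0_of s = (\<Sum>y\<in>range s. scale_L0 y (L0_of (indicator (s -` {y}))))" .
    have ind: "L0_of (indicator (s -` {y}) :: 'a \<Rightarrow> complex) \<in> Lp r" for y
      using A r finite_measure_haar by (subst L0_of_in_Lp) (auto intro!: p_integrable_bounded[where C = 1] simp: indicator_def)
    have "(\<Sum>y\<in>Y. scale_L0 y (L0_of (indicator (s -` {y})))) \<in> Lp r \<and> cont_approx r (\<Sum>y\<in>Y. scale_L0 y (L0_of (indicator (s -` {y}))))" if "finite Y" for Y
      using that
    proof (induction Y rule: finite_induct)
      case empty
      have "cont_approx r 0" using cont_in_Lp[of "\<lambda>_. 0" r] r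
        unfolding cont_approx_def by (intro allI impI exI[of _ "\<lambda>_. 0"]) (simp flip: L0_of_0)
      then show ?case by simp
    next
      case (insert y Y)
      then show ?case
        using r ind A by (auto intro!: Lp_add cont_approx_add Lp_scale cont_approx_scale cont_approx_indicator)
    qed
    then show ?thesis unfolding eq using fin by blast
  qed
  have hm: "h \<in> borel_measurable haar" using h(1) by simp
  obtain F where F: "\<And>i. simple_function haar (F i)" "\<And>x. (\<lambda>i. F i x) \<longlonglongrightarrow> h x" "\<And>i x. cmod (F i x) \<le> 2 * cmod (h x)"
    using borel_measurable_implies_sequence_metric[OF hm, of 0] by (auto simp: dist_norm)
  have [measurable]: "F i \<in> borel_measurable haar" for i
    by (rule borel_measurable_simple_function[OF F(1)])
  have Fm: "bmeas (F i)" for i using borel_measurable_simple_function[OF F(1)] by simp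
  have "(\<lambda>i. LINT x|haar. cmod (h x - F i x) powr r) \<longlonglongrightarrow> (LINT x|(haar :: 'a measure). 0)"
  proof (rule integral_dominated_convergence)
    \<comment> \<open>The 3 is 1 for \<open>h\<close> plus 2 from the bound on the simple functions
      \<open>F i\<close>.\<close>
    show "integrable haar (\<lambda>x. 3 powr r * cmod (h x) powr r)" using h(2) by (simp add: p_integrable_def)
    show "AE x in haar. (\<lambda>i. cmod (h x - F i x) powr r) \<longlonglongrightarrow> 0"
    proof (rule AE_I2)
      fix x
      have "(\<lambda>i. cmod (h x - F i x) powr r) \<longlonglongrightarrow> cmod (h x - h x) powr r"
        using r by (intro tendsto_powr' tendsto_intros F(2)) auto
      then show "(\<lambda>i. cmod (h x - F i x) powr r) \<longlonglongrightarrow> 0" using r by simp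
    qed
    show "AE x in haar. norm (cmod (h x - F i x) powr r) \<le> 3 powr r * cmod (h x) powr r" for i
    proof (rule AE_I2)
      fix x
      have "cmod (h x - F i x) \<le> 3 * cmod (h x)"
        using norm_triangle_ineq4[of "h x" "F i x"] F(3)[of i x] by simp
      then have "cmod (h x - F i x) powr r \<le> (3 * cmod (h x)) powr r" using r by (intro powr_mono2) auto
      then show "norm (cmod (h x - F i x) powr r) \<le> 3 powr r * cmod (h x) powr r" by (simp add: powr_mult)
    qed
  qed (use hm in measurable)
  then have lim: "(\<lambda>i. LINT x|haar. cmod (h x - F i x) powr r) \<longlonglongrightarrow> 0" by simp
  show ?thesis unfolding cont_approx_def
  proof (intro allI impI)
    fix e :: real assume e: "0 < e"
    have "\<forall>\<^sub>F i in sequentially. (LINT x|haar. cmod (h x - F i x) powr r) < (e / 2) powr r"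
      by (rule order_tendstoD(2)[OF lim]) (use e in simp)
    then obtain i where "(LINT x|haar. cmod (h x - F i x) powr r) < (e / 2) powr r"
      by (auto simp: eventually_sequentially)
    then have "pnorm haar r (\<lambda>x. h x - F i x) \<le> e / 2" using e r by (subst pnorm_le_iff) auto
    then have 1: "Lp_norm r (f - L0_of (F i)) \<le> e / 2" using h Fm by (simp add: L0_of_diff Lp_norm_L0_of)
    obtain g where g: "cont g" "Lp_norm r (L0_of (F i) - L0_of g) < e / 2"
      using simple[OF F(1)] e unfolding cont_approx_def by (meson half_gt_zero)
    have "f - L0_of g = (f - L0_of (F i)) + (L0_of (F i) - L0_of g)" by simp
    also have "Lp_norm r \<dots> \<le> Lp_norm r (f - L0_of (F i)) + Lp_norm r (L0_of (F i) - L0_of g)"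
      using r f g simple[OF F(1), of i] cont_in_Lp[OF g(1), of r] by (intro Lp_norm_add Lp_diff) auto
    also have "\<dots> < e" using 1 g(2) by simp
    finally show "\<exists>g. cont g \<and> Lp_norm r (f - L0_of g) < e" using g by blast
  qed
qed

lemma sup_norm_Lp:
  assumes "cont g" "\<And>x. cmod (g x) \<le> C" "1 \<le> r"
  shows "Lp_norm r (L0_of g) \<le> C"
proof -
  have C: "0 \<le> C" using assms(2)[of 0] norm_ge_zero[of "g 0"] by linarith
  have bm: "bmeas g" by (rule borel_measurable_continuous_UNIV[OF assms(1)])
  have "(LINT x|haar. cmod (g x) powr r) \<le> (LINT x|(haar::'a measure). C powr r)"
  proof (rule integral_mono)
    show "integrable haar (\<lambda>x. cmod (g x) powr r)"
      using cont_in_Lp[OF assms(1), of r] assms(3) bm by (simp add: L0_of_in_Lp p_integrable_def)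
  qed (use assms C in \<open>auto intro!: powr_mono2\<close>)
  then have "(LINT x|haar. cmod (g x) powr r) \<le> C powr r" by simp
  then show ?thesis using bm C assms(3) by (simp add: Lp_norm_L0_of pnorm_le_iff)
qed

theorem trig_poly_dense:
  fixes f :: "'a::compact_ab_group L0"
  assumes r: "1 \<le> r" and f: "f \<in> Lp r" and e: "0 < e"
  obtains M c where "finite M" "M \<subseteq> characters" "Lp_norm r (f - trig_poly M c) < e"
proof -
  have "e / 2 > 0" using e by simp
  then obtain g where g: "cont g" "Lp_norm r (f - L0_of g) < e / 2"
    using Lp_cont_approx[OF r f] unfolding cont_approx_def by blast
  obtain h where h: "h \<in> trig_fun" "\<And>x. cmod (g x - h x) < e / 2"
    using trig_fun_dense_uniform[OF g(1) \<open>e / 2 > 0\<close>] by blast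
  obtain M c where M: "finite M" "M \<subseteq> characters" "L0_of h = trig_poly M c"
    using trig_fun_trig_poly[OF h(1)] by blast
  have hc: "cont h" by (rule trig_fun_cont[OF h(1)])
  have "Lp_norm r (L0_of (\<lambda>x. g x - h x)) \<le> e / 2"
    using h g hc r by (intro sup_norm_Lp) (auto intro: continuous_intros less_imp_le)
  then have 2: "Lp_norm r (L0_of g - L0_of h) \<le> e / 2"
    using g hc by (simp add: L0_of_diff borel_measurable_continuous_UNIV)
  have "f - L0_of h = (f - L0_of g) + (L0_of g - L0_of h)" by simp
  also have "Lp_norm r \<dots> \<le> Lp_norm r (f - L0_of g) + Lp_norm r (L0_of g - L0_of h)"
    using r f g hc by (intro Lp_norm_add Lp_diff cont_in_Lp) auto
  also have "\<dots> < e" using 2 g(2) by simp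
  finally show ?thesis using that M by simp
qed

section \<open>The Riesz projection\<close>

definition pairing :: "'a::compact_ab_group L0 \<Rightarrow> 'a L0 \<Rightarrow> complex" where
  "pairing f g = integral_L0 (f * cnj_L0 g)"

text \<open>Additivity requires integrable products, as the integral of a nonintegrable class is 0
  by convention.\<close>

lemma pairing_add_left:
  "f * cnj_L0 h \<in> Lp 1 \<Longrightarrow> g * cnj_L0 h \<in> Lp 1 \<Longrightarrow> pairing (f + g) h = pairing f h + pairing g h"
  by (simp add: pairing_def distrib_right integral_L0_add)

lemma pairing_diff_left:
  "f * cnj_L0 h \<in> Lp 1 \<Longrightarrow> g * cnj_L0 h \<in> Lp 1 \<Longrightarrow> pairing (f - g) h = pairing f h - pairing g h"
  by (simp add: pairing_def left_diff_distrib integral_L0_diff)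

lemma pairing_scale_left: "pairing (scale_L0 c f) h = c * pairing f h"
  by (simp add: pairing_def scale_L0_mult_left integral_L0_scale)

lemma pairing_scale_right: "pairing f (scale_L0 c h) = cnj c * pairing f h"
  by (simp add: pairing_def cnj_L0_scale scale_L0_mult_right integral_L0_scale)

lemma integral_cnj_L0: "integral_L0 (cnj_L0 f) = cnj (integral_L0 f)"
  by (rule L0_of_cases[of f]) (simp add: cnj_L0_of integral_L0_of)

lemma pairing_commute: "pairing g f = cnj (pairing f g)"
  by (simp add: pairing_def cnj_L0_mult mult.commute flip: integral_cnj_L0)

lemma pairing_sum_left:
  assumes "\<And>i. i \<in> I \<Longrightarrow> f i * cnj_L0 h \<in> Lp 1"
  shows "pairing (\<Sum>i\<in>I. f i) h = (\<Sum>i\<in>I. pairing (f i) h)"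
  unfolding pairing_def sum_distrib_right using assms by (rule integral_L0_sum)

lemma pairing_sum_right:
  assumes "\<And>i. i \<in> I \<Longrightarrow> f * cnj_L0 (h i) \<in> Lp 1"
  shows "pairing f (\<Sum>i\<in>I. h i) = (\<Sum>i\<in>I. pairing f (h i))"
  unfolding pairing_def cnj_L0_sum sum_distrib_left using assms by (rule integral_L0_sum)

lemma fourier_pairing:
  assumes "\<gamma> \<in> characters"
  shows "fourier f \<gamma> = pairing f (L0_of \<gamma>)"
proof -
  obtain f' where f': "bmeas f'" "f = L0_of f'" by (rule L0_of_cases)
  have "bmeas \<gamma>" by (rule character_bmeas[OF assms])
  moreover from this f'(1) have "bmeas (\<lambda>x. f' x * cnj (\<gamma> x))"
    by (intro borel_measurable_times bmeas_cnj)
  ultimately show ?thesis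
    using f' fourier_L0_of[OF f'(1) assms] by (simp add: pairing_def cnj_L0_of L0_of_mult integral_L0_of)
qed

lemma mult_character_Lp:
  assumes "\<gamma> \<in> characters"
  shows "L0_of \<gamma> * f \<in> Lp p \<longleftrightarrow> f \<in> Lp p" and "Lp_norm p (L0_of \<gamma> * f) = Lp_norm p f"
proof -
  obtain f' where f': "bmeas f'" "f = L0_of f'" by (rule L0_of_cases)
  have b: "bmeas \<gamma>" by (rule character_bmeas[OF assms])
  have [simp]: "cmod (\<gamma> x * f' x) = cmod (f' x)" for x
    by (simp add: norm_mult character_norm[OF assms])
  show "L0_of \<gamma> * f \<in> Lp p \<longleftrightarrow> f \<in> Lp p" "Lp_norm p (L0_of \<gamma> * f) = Lp_norm p f"
    using f' b by (simp_all add: L0_of_mult L0_of_in_Lp Lp_norm_L0_of p_integrable_def pnorm_def)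
qed

lemma cnj_character_L0: "\<gamma> \<in> characters \<Longrightarrow> cnj_L0 (L0_of \<gamma>) = L0_of (\<lambda>x. cnj (\<gamma> x))"
  by (rule cnj_L0_of[OF character_bmeas])

lemma Lp_mult_cnj_character:
  assumes "\<gamma> \<in> characters" "f \<in> Lp p"
  shows "f * cnj_L0 (L0_of \<gamma>) \<in> Lp p"
  using assms mult_character_Lp(1)[OF character_cnj[OF assms(1)], of f p]
  by (simp add: cnj_character_L0 mult.commute)

lemma character_mult_cnj_L0:
  assumes "\<gamma> \<in> characters"
  shows "L0_of \<gamma> * cnj_L0 (L0_of \<gamma>) = 1"
  using character_bmeas[OF assms] character_mult_cnj[OF assms]
  by (simp add: cnj_L0_of L0_of_mult L0_of_1)

lemma pairing_mult_character:
  assumes "\<gamma> \<in> characters"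
  shows "pairing (L0_of \<gamma> * f) (L0_of \<gamma> * g) = pairing f g"
proof -
  have "L0_of \<gamma> * f * cnj_L0 (L0_of \<gamma> * g) = (L0_of \<gamma> * cnj_L0 (L0_of \<gamma>)) * (f * cnj_L0 g)"
    by (simp add: cnj_L0_mult ac_simps)
  then show ?thesis by (simp add: pairing_def character_mult_cnj_L0[OF assms])
qed

lemma fourier_norm_le_1:
  assumes "\<gamma> \<in> characters" "f \<in> Lp 1"
  shows "cmod (fourier f \<gamma>) \<le> Lp_norm 1 f"
proof -
  have "cmod (fourier f \<gamma>) \<le> Lp_norm 1 (f * cnj_L0 (L0_of \<gamma>))"
    unfolding fourier_pairing[OF assms(1)] pairing_def
    by (intro integral_L0_norm Lp_mult_cnj_character assms)
  also have "\<dots> = Lp_norm 1 f"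
    using mult_character_Lp(2)[OF character_cnj[OF assms(1)], of 1 f]
    by (simp add: cnj_character_L0 assms(1) mult.commute)
  finally show ?thesis .
qed

lemma fourier_norm_le:
  assumes "\<gamma> \<in> characters" "f \<in> Lp p" "1 < p"
  shows "cmod (fourier f \<gamma>) \<le> Lp_norm p f"
  using fourier_norm_le_1[OF assms(1)] Lp_imp_L1[OF assms(3,2)] by force

lemma fourier_add:
  "\<gamma> \<in> characters \<Longrightarrow> f \<in> Lp 1 \<Longrightarrow> g \<in> Lp 1 \<Longrightarrow> fourier (f + g) \<gamma> = fourier f \<gamma> + fourier g \<gamma>"
  by (simp add: fourier_pairing pairing_add_left Lp_mult_cnj_character)

lemma fourier_diff:
  "\<gamma> \<in> characters \<Longrightarrow> f \<in> Lp 1 \<Longrightarrow> g \<in> Lp 1 \<Longrightarrow> fourier (f - g) \<gamma> = fourier f \<gamma> - fourier g \<gamma>"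
  by (simp add: fourier_pairing pairing_diff_left Lp_mult_cnj_character)

lemma fourier_scale: "\<gamma> \<in> characters \<Longrightarrow> fourier (scale_L0 c f) \<gamma> = c * fourier f \<gamma>"
  by (simp add: fourier_pairing pairing_scale_left)

lemma character_Lp: "\<gamma> \<in> characters \<Longrightarrow> 0 \<le> p \<Longrightarrow> L0_of \<gamma> \<in> Lp p"
  by (intro cont_in_Lp character_cont)

lemma fourier_character:
  assumes "\<gamma> \<in> characters" "\<delta> \<in> characters"
  shows "fourier (L0_of \<gamma>) \<delta> = (if \<gamma> = \<delta> then 1 else 0)"
  using fourier_L0_of[OF character_bmeas[OF assms(1)] assms(2)] character_orthogonal[OF assms] by simp

lemma trig_poly_Lp:
  assumes "M \<subseteq> characters" "1 \<le> p"
  shows "trig_poly M c \<in> Lp p"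
  unfolding trig_poly_def
proof (rule L0.subspace_sum[OF Lp_subspace[OF assms(2)]])
  fix \<gamma> assume "\<gamma> \<in> M"
  then show "scale_L0 (c \<gamma>) (L0_of \<gamma>) \<in> Lp p"
    using assms by (intro Lp_scale character_Lp) auto
qed

lemma fourier_trig_poly:
  assumes "finite M" "M \<subseteq> characters" "\<delta> \<in> characters"
  shows "fourier (trig_poly M c) \<delta> = (if \<delta> \<in> M then c \<delta> else 0)"
proof -
  have "fourier (trig_poly M c) \<delta> = (\<Sum>\<gamma>\<in>M. c \<gamma> * fourier (L0_of \<gamma>) \<delta>)"
    unfolding fourier_pairing[OF assms(3)] trig_poly_def
    using assms by (subst pairing_sum_left)
      (auto simp: pairing_scale_left intro!: Lp_mult_cnj_character Lp_scale character_Lp)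
  also have "\<dots> = (\<Sum>\<gamma>\<in>M. if \<gamma> = \<delta> then c \<gamma> else 0)"
    using assms by (intro sum.cong) (auto simp: fourier_character)
  finally show ?thesis using assms by simp
qed

lemma mult_character_trig_poly:
  assumes \<psi>: "\<psi> \<in> characters" and M: "M \<subseteq> characters"
  shows "\<exists>c'. L0_of \<psi> * trig_poly M c = trig_poly ((\<lambda>\<gamma> x. \<psi> x * \<gamma> x) ` M) c'"
proof -
  let ?s = "\<lambda>\<gamma> x. \<psi> x * \<gamma> x" and ?u = "\<lambda>\<gamma> x. cnj (\<psi> x) * \<gamma> x"
  have u: "?u (?s \<gamma>) = \<gamma>" for \<gamma>
  proof
    have "cnj (\<psi> x) * (\<psi> x * \<gamma> x) = (\<psi> x * cnj (\<psi> x)) * \<gamma> x" for x by (simp only: ac_simps)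
    then show "cnj (\<psi> x) * (\<psi> x * \<gamma> x) = \<gamma> x" for x by (simp only: character_mult_cnj[OF \<psi>] mult_1)
  qed
  have inj: "inj_on ?s M" by (rule inj_on_inverseI[where g = ?u]) (rule u)
  have "L0_of \<psi> * trig_poly M c = (\<Sum>\<gamma>\<in>M. scale_L0 (c \<gamma>) (L0_of (?s \<gamma>)))"
    unfolding trig_poly_def sum_distrib_left
    using M \<psi> by (intro sum.cong) (auto simp: scale_L0_mult_right L0_of_mult character_bmeas subset_iff)
  also have "\<dots> = trig_poly (?s ` M) (c \<circ> ?u)"
    unfolding trig_poly_def sum.reindex[OF inj] by (simp add: u)
  finally show ?thesis by blast
qed

text \<open>Riemann-Lebesgue: an approximating polynomial has finite spectrum, which an injective
  sequence of characters eventually leaves; from then on the coefficient is bounded by the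
  approximation error.\<close>

lemma fourier_tendsto_0:
  fixes f :: "'a::compact_ab_group L0"
  assumes f: "f \<in> Lp 1" and \<delta>: "inj \<delta>" "\<And>n::nat. \<delta> n \<in> characters"
  shows "(\<lambda>n. fourier f (\<delta> n)) \<longlonglongrightarrow> 0"
proof (rule LIMSEQ_I)
  fix e :: real assume e: "0 < e"
  obtain M c where M: "finite M" "M \<subseteq> characters" "Lp_norm 1 (f - trig_poly M c) < e"
    using trig_poly_dense[OF order.refl f e] .
  have "finite (\<delta> -` M)" using M(1) \<delta>(1) by (rule finite_vimageI)
  then obtain N where N: "\<And>n. n \<ge> N \<Longrightarrow> \<delta> n \<notin> M"
    by (metis finite_nat_set_iff_bounded not_less vimageI)
  have "cmod (fourier f (\<delta> n)) < e" if "n \<ge> N" for n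
  proof -
    have tp: "trig_poly M c \<in> Lp 1" by (rule trig_poly_Lp[OF M(2)]) simp
    have "fourier f (\<delta> n) = fourier (f - trig_poly M c) (\<delta> n)"
      using fourier_diff[OF \<delta>(2) f tp] fourier_trig_poly[OF M(1,2) \<delta>(2)] N[OF that] by simp
    also have "cmod \<dots> \<le> Lp_norm 1 (f - trig_poly M c)"
      using f tp by (intro fourier_norm_le_1 \<delta> Lp_diff) auto
    finally show ?thesis using M(3) by simp
  qed
  then show "\<exists>no. \<forall>n\<ge>no. norm (fourier f (\<delta> n) - 0) < e" by auto
qed

section \<open>Extension of the Riesz projection\<close>

lemma trig_poly_add:
  assumes "finite M" "finite M'"
  shows "trig_poly M c + trig_poly M' c' =
    trig_poly (M \<union> M') (\<lambda>\<gamma>. (if \<gamma> \<in> M then c \<gamma> else 0) + (if \<gamma> \<in> M' then c' \<gamma> else 0))"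
  unfolding trig_poly_mono[of "M \<union> M'" M c, OF finite_UnI[OF assms] Un_upper1]
    trig_poly_mono[of "M \<union> M'" M' c', OF finite_UnI[OF assms] Un_upper2]
  by (simp add: trig_poly_def L0.scale_left_distrib sum.distrib)

lemma trig_poly_add_Int:
  assumes "finite M" "finite M'"
  shows "trig_poly (M \<inter> T) c + trig_poly (M' \<inter> T) c' =
    trig_poly ((M \<union> M') \<inter> T) (\<lambda>\<gamma>. (if \<gamma> \<in> M then c \<gamma> else 0) + (if \<gamma> \<in> M' then c' \<gamma> else 0))"
proof -
  have "trig_poly (M \<inter> T) c + trig_poly (M' \<inter> T) c' = trig_poly ((M \<inter> T) \<union> (M' \<inter> T))
      (\<lambda>\<gamma>. (if \<gamma> \<in> M \<inter> T then c \<gamma> else 0) + (if \<gamma> \<in> M' \<inter> T then c' \<gamma> else 0))"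
    using assms by (intro trig_poly_add) auto
  also have "\<dots> = trig_poly ((M \<union> M') \<inter> T) (\<lambda>\<gamma>. (if \<gamma> \<in> M then c \<gamma> else 0) + (if \<gamma> \<in> M' then c' \<gamma> else 0))"
    unfolding trig_poly_def by (intro sum.cong) auto
  finally show ?thesis .
qed

lemma trig_poly_scale: "scale_L0 d (trig_poly M c) = trig_poly M (\<lambda>\<gamma>. d * c \<gamma>)"
  by (simp add: trig_poly_def L0.scale_sum_right)

text \<open>Extension by density through graphs. \<open>Q\<close> is the graph of the projection on
  polynomials and \<open>R\<close> its closure. \<open>R\<close> is linear and inherits the norm
  bound, hence is single-valued; completeness makes it defined everywhere.\<close>

lemma riesz_projection_exists:
  fixes T :: "('a::compact_ab_group \<Rightarrow> complex) set"
  assumes p: "1 < p" and rb: "riesz_bounded p T"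
  shows "\<exists>P. bounded_op (Lp p) (Hp p T) (Lp_norm p) P \<and>
     (\<forall>M c. finite M \<and> M \<subseteq> characters \<longrightarrow> P (trig_poly M c) = trig_poly (M \<inter> T) c)"
proof -
  have p1: "1 \<le> p" and p0: "0 < p" using p by auto
  define Q where "Q u v \<longleftrightarrow> (\<exists>M c. finite M \<and> M \<subseteq> characters \<and> u = trig_poly M c \<and> v = trig_poly (M \<inter> T) c)"
    for u v :: "'a L0"
  obtain C0 where C0: "\<And>M c. finite M \<Longrightarrow> M \<subseteq> characters \<Longrightarrow>
      Lp_norm p (trig_poly (M \<inter> T) c) \<le> C0 * Lp_norm p (trig_poly M c)"
    using rb unfolding riesz_bounded_def by blast
  \<comment> \<open>The constant in \<open>riesz_bounded\<close> may be negative; later estimates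
    multiply inequalities by it.\<close>
  define C where "C = max C0 0"
  have C: "0 \<le> C" by (simp add: C_def)
  have Q_Lp: "u \<in> Lp p" "v \<in> Lp p" if "Q u v" for u v
  proof -
    from that obtain M c where M: "finite M" "M \<subseteq> characters" "u = trig_poly M c" "v = trig_poly (M \<inter> T) c"
      by (auto simp: Q_def)
    have "M \<inter> T \<subseteq> characters" using M(2) by blast
    then show "u \<in> Lp p" "v \<in> Lp p" unfolding M(3,4) using M(2) p1 by (auto intro!: trig_poly_Lp)
  qed
  have Q_le: "Lp_norm p v \<le> C * Lp_norm p u" if "Q u v" for u v
  proof -
    have "Lp_norm p v \<le> C0 * Lp_norm p u" using that C0 by (auto simp: Q_def)
    also have "\<dots> \<le> C * Lp_norm p u" by (intro mult_right_mono) (auto simp: C_def)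
    finally show ?thesis .
  qed
  have Q_add: "Q (u + u') (v + v')" if uv: "Q u v" "Q u' v'" for u v u' v'
  proof -
    from uv obtain M c M' c' where "finite M" "M \<subseteq> characters" "u = trig_poly M c" "v = trig_poly (M \<inter> T) c"
      "finite M'" "M' \<subseteq> characters" "u' = trig_poly M' c'" "v' = trig_poly (M' \<inter> T) c'"
      unfolding Q_def by blast
    then show ?thesis
      unfolding Q_def using trig_poly_add[of M M' c c'] trig_poly_add_Int[of M M' T c c']
      by (intro exI[of _ "M \<union> M'"] exI conjI) auto
  qed
  have Q_scale: "Q (scale_L0 d u) (scale_L0 d v)" if "Q u v" for u v d
  proof -
    from that obtain M c where M: "finite M" "M \<subseteq> characters" "u = trig_poly M c" "v = trig_poly (M \<inter> T) c"
      by (auto simp: Q_def)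
    show ?thesis unfolding Q_def
      by (intro exI[of _ M] exI[of _ "\<lambda>\<gamma>. d * c \<gamma>"]) (simp add: M trig_poly_scale)
  qed
  have Q_diff: "Q (u - u') (v - v')" if "Q u v" "Q u' v'" for u v u' v'
    using Q_add[OF that(1) Q_scale[OF that(2), of "-1"]] by (simp add: scale_minus_one)
  define R where "R f g \<longleftrightarrow> g \<in> Lp p \<and> (\<forall>e>0. \<exists>u v. Q u v \<and> Lp_norm p (f - u) < e \<and> Lp_norm p (g - v) < e)"
    for f g :: "'a L0"
  have R_Q: "R u v" if "Q u v" for u v
    unfolding R_def
    by (intro conjI allI impI Q_Lp(2)[OF that] exI[of _ u] exI[of _ v] that) auto
  have R_add: "R (f + f') (g + g')" if R: "R f g" "R f' g'" and f: "f \<in> Lp p" "f' \<in> Lp p" for f f' g g'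
    unfolding R_def
  proof (intro conjI allI impI)
    show "g + g' \<in> Lp p" using R p1 by (auto simp: R_def intro: Lp_add)
    fix e :: real assume "0 < e"
    then have "e / 2 > 0" by simp
    then obtain u v u' v' where Q: "Q u v" "Q u' v'"
      and l: "Lp_norm p (f - u) < e / 2" "Lp_norm p (g - v) < e / 2" "Lp_norm p (f' - u') < e / 2" "Lp_norm p (g' - v') < e / 2"
      using R unfolding R_def by metis
    have "Lp_norm p ((f - u) + (f' - u')) \<le> Lp_norm p (f - u) + Lp_norm p (f' - u')"
      using p1 f Q_Lp[OF Q(1)] Q_Lp[OF Q(2)] by (intro Lp_norm_add Lp_diff)
    moreover have "Lp_norm p ((g - v) + (g' - v')) \<le> Lp_norm p (g - v) + Lp_norm p (g' - v')"
      using p1 R Q_Lp[OF Q(1)] Q_Lp[OF Q(2)] by (intro Lp_norm_add Lp_diff) (auto simp: R_def)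
    ultimately show "\<exists>u v. Q u v \<and> Lp_norm p (f + f' - u) < e \<and> Lp_norm p (g + g' - v) < e"
      using l Q_add[OF Q] by (intro exI[of _ "u + u'"] exI[of _ "v + v'"]) (simp add: add_diff_add)
  qed
  have R_scale: "R (scale_L0 d f) (scale_L0 d g)" if R: "R f g" for f g d
    unfolding R_def
  proof (intro conjI allI impI)
    show "scale_L0 d g \<in> Lp p" using R by (auto simp: R_def intro: Lp_scale)
    fix e :: real assume e: "0 < e"
    have d: "cmod d + 1 > 0" by (simp add: add_nonneg_pos)
    then have "e / (cmod d + 1) > 0" using e by simp
    then obtain u v where Q: "Q u v" and l: "Lp_norm p (f - u) < e / (cmod d + 1)" "Lp_norm p (g - v) < e / (cmod d + 1)"
      using R unfolding R_def by metis
    have "Lp_norm p (scale_L0 d x) < e" if "Lp_norm p x < e / (cmod d + 1)" for x :: "'a L0"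
    proof -
      have "Lp_norm p (scale_L0 d x) \<le> (cmod d + 1) * Lp_norm p x"
        using p0 by (simp add: Lp_norm_scale mult_right_mono)
      also have "\<dots> < e" using that d by (simp add: field_simps)
      finally show ?thesis .
    qed
    from this[OF l(1)] this[OF l(2)]
    show "\<exists>u v. Q u v \<and> Lp_norm p (scale_L0 d f - u) < e \<and> Lp_norm p (scale_L0 d g - v) < e"
      using Q_scale[OF Q, of d] by (intro exI[of _ "scale_L0 d u"] exI[of _ "scale_L0 d v"])
        (simp add: L0.scale_right_diff_distrib)
  qed
  have R_le: "Lp_norm p g \<le> C * Lp_norm p f" if R: "R f g" and f: "f \<in> Lp p" for f g
  proof (rule field_le_epsilon)
    fix e :: real assume e: "0 < e"
    have "C + 1 > 0" using C by simp
    then have "e / (C + 1) > 0" using e by simp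
    then obtain u v where Q: "Q u v" and l: "Lp_norm p (f - u) < e / (C + 1)" "Lp_norm p (g - v) < e / (C + 1)"
      using R unfolding R_def by metis
    note uv = Q_Lp[OF Q]
    have g: "g \<in> Lp p" using R by (simp add: R_def)
    have "Lp_norm p g = Lp_norm p ((g - v) + v)" by simp
    also have "\<dots> \<le> Lp_norm p (g - v) + Lp_norm p v" using p1 uv g by (intro Lp_norm_add Lp_diff)
    also have "Lp_norm p v \<le> C * Lp_norm p u" by (rule Q_le[OF Q])
    also have "Lp_norm p u = Lp_norm p (f - (f - u))" by simp
    also have "\<dots> \<le> Lp_norm p f + Lp_norm p (f - u)" using p1 uv f by (intro Lp_norm_diff Lp_diff)
    also have "Lp_norm p (g - v) + C * (Lp_norm p f + Lp_norm p (f - u))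
        \<le> e / (C + 1) + C * (Lp_norm p f + e / (C + 1))"
      using l C by (intro add_mono mult_left_mono) auto
    also have "\<dots> = C * Lp_norm p f + (C + 1) * (e / (C + 1))" by (simp add: algebra_simps add_divide_distrib)
    also have "(C + 1) * (e / (C + 1)) = e" using \<open>C + 1 > 0\<close> by simp
    finally show "Lp_norm p g \<le> C * Lp_norm p f + e" using C by (simp add: mult_left_mono)
  qed
  \<comment> \<open>The difference of two values is related to 0, and the norm bound makes it
    0.\<close>
  have R_unique: "g = g'" if R: "R f g" "R f g'" and f: "f \<in> Lp p" for f g g'
  proof -
    have "R (f + scale_L0 (-1) f) (g + scale_L0 (-1) g')"
      by (intro R_add R R_scale f Lp_scale)
    then have R0: "R 0 (g - g')" by (simp add: scale_minus_one)
    have "Lp_norm p (g - g') = 0" using R_le[OF R0 Lp_0] Lp_norm_nonneg[of p "g - g'"] by simp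
    moreover have "g - g' \<in> Lp p" using R0 by (simp add: R_def)
    ultimately have "g - g' = 0" using Lp_norm_eq_0[OF p0, of "g - g'"] by blast
    then show ?thesis by simp
  qed
  have R_ex: "\<exists>g. R f g" if f: "f \<in> Lp p" for f
  proof -
    have "\<exists>u v. Q u v \<and> Lp_norm p (f - u) < 1 / real (Suc n)" for n
      by (rule trig_poly_dense[OF p1 f, of "1 / real (Suc n)"]) (auto simp: Q_def)
    then obtain u v where Q: "\<And>n. Q (u n) (v n)" and lu: "\<And>n. Lp_norm p (f - u n) < 1 / real (Suc n)"
      by metis
    note uv = Q_Lp[OF Q]
    have vv: "Lp_norm p (v m - v n) \<le> C * (1 / real (Suc m) + 1 / real (Suc n))" for m n
    proof -
      have "Lp_norm p (v m - v n) \<le> C * Lp_norm p (u m - u n)" by (rule Q_le[OF Q_diff[OF Q Q]])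
      also have "u m - u n = (f - u n) - (f - u m)" by simp
      also have "C * Lp_norm p \<dots> \<le> C * (Lp_norm p (f - u n) + Lp_norm p (f - u m))"
        using p1 f uv C by (intro mult_left_mono Lp_norm_diff Lp_diff)
      also have "\<dots> \<le> C * (1 / real (Suc m) + 1 / real (Suc n))"
        using lu[of m] lu[of n] C by (intro mult_left_mono) auto
      finally show ?thesis .
    qed
    \<comment> \<open>The images of the approximating polynomials form a Cauchy sequence, by the
      bound on differences.\<close>
    obtain g where g: "g \<in> Lp p" "(\<lambda>n. Lp_norm p (v n - g)) \<longlonglongrightarrow> 0"
    proof (rule Lp_complete[OF p, of v])
      show "v n \<in> Lp p" for n by (rule uv)
      fix e :: real assume e: "0 < e"
      have "(\<lambda>n. C * (1 / real (Suc n))) \<longlonglongrightarrow> C * 0"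
        by (intro tendsto_intros LIMSEQ_Suc[OF lim_1_over_n])
      then have "\<forall>\<^sub>F n in sequentially. C * (1 / real (Suc n)) < e / 2"
        by (rule order_tendstoD) (use e in simp)
      then obtain N where N: "\<And>n. n \<ge> N \<Longrightarrow> C * (1 / real (Suc n)) < e / 2"
        by (auto simp: eventually_sequentially)
      have "Lp_norm p (v m - v n) < e" if "m \<ge> N" "n \<ge> N" for m n
        using vv[of m n] N[OF that(1)] N[OF that(2)] unfolding distrib_left by linarith
      then show "\<exists>N. \<forall>m\<ge>N. \<forall>n\<ge>N. Lp_norm p (v m - v n) < e" by blast
    qed
    have "R f g" unfolding R_def
    proof (intro conjI allI impI g)
      fix e :: real assume e: "0 < e"
      have "\<forall>\<^sub>F n in sequentially. 1 / real (Suc n) < e"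
        by (rule order_tendstoD(2)[OF LIMSEQ_Suc[OF lim_1_over_n]]) (rule e)
      moreover have "\<forall>\<^sub>F n in sequentially. Lp_norm p (v n - g) < e"
        by (rule order_tendstoD(2)[OF g(2)]) (rule e)
      ultimately have "\<forall>\<^sub>F n in sequentially. Lp_norm p (f - u n) < e \<and> Lp_norm p (g - v n) < e"
        by eventually_elim (use lu Lp_norm_minus_commute[OF p0, of g] in \<open>auto intro: less_trans\<close>)
      then show "\<exists>u v. Q u v \<and> Lp_norm p (f - u) < e \<and> Lp_norm p (g - v) < e"
        using Q by (auto simp: eventually_sequentially)
    qed
    then show ?thesis ..
  qed
  define P where "P f = (SOME g. R f g)" for f
  have RP: "R f (P f)" if "f \<in> Lp p" for f
    unfolding P_def by (rule someI_ex[OF R_ex[OF that]])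
  have "bounded_op (Lp p) (Hp p T) (Lp_norm p) P"
    unfolding bounded_op_def
  proof (intro conjI ballI allI)
    fix f :: "'a L0" assume f: "f \<in> Lp p"
    have g: "P f \<in> Lp p" using RP[OF f] by (simp add: R_def)
    show "P f \<in> Hp p T"
      unfolding Hp_def
    proof (safe intro!: g)
      fix \<gamma> assume \<gamma>: "\<gamma> \<in> (characters :: ('a \<Rightarrow> complex) set)" "\<gamma> \<notin> T"
      \<comment> \<open>The coefficient at a character outside \<open>T\<close> vanishes for the
        images of polynomials and is continuous in the norm.\<close>
      have "cmod (fourier (P f) \<gamma>) \<le> e" if "0 < e" for e
      proof -
        obtain u v where Q: "Q u v" "Lp_norm p (P f - v) < e"
          using RP[OF f] \<open>0 < e\<close> unfolding R_def by metis
        have "fourier v \<gamma> = 0"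
        proof -
          from Q(1) obtain M c where M: "finite M" "M \<subseteq> characters" "v = trig_poly (M \<inter> T) c" by (auto simp: Q_def)
          then show ?thesis using \<gamma> by (subst M(3), subst fourier_trig_poly) auto
        qed
        then have "fourier (P f) \<gamma> = fourier (P f - v) \<gamma>"
          using fourier_diff[OF \<gamma>(1), of "P f" v] Lp_imp_L1(1)[OF p g] Lp_imp_L1(1)[OF p Q_Lp(2)[OF Q(1)]] by simp
        also have "cmod \<dots> \<le> Lp_norm p (P f - v)"
          by (rule fourier_norm_le[OF \<gamma>(1) Lp_diff[OF p1 g Q_Lp(2)[OF Q(1)]] p])
        finally show ?thesis using Q(2) by simp
      qed
      then have "cmod (fourier (P f) \<gamma>) \<le> 0 + e" if "0 < e" for e using that by simp
      then have "cmod (fourier (P f) \<gamma>) \<le> 0" by (rule field_le_epsilon)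
      then show "fourier (P f) \<gamma> = 0" by simp
    qed
  next
    fix f g :: "'a L0" assume fg: "f \<in> Lp p" "g \<in> Lp p"
    show "P (f + g) = P f + P g"
      by (rule R_unique[OF RP[OF Lp_add] R_add[OF RP RP] Lp_add]) (rule fg p1)+
  next
    fix c and f :: "'a L0" assume f: "f \<in> Lp p"
    show "P (scale_L0 c f) = scale_L0 c (P f)"
      by (rule R_unique[OF RP[OF Lp_scale[OF f]] R_scale[OF RP[OF f]] Lp_scale[OF f]])
  next
    show "\<exists>C. \<forall>f\<in>Lp p. Lp_norm p (P f) \<le> C * Lp_norm p f"
      by (intro exI[of _ C] ballI R_le RP)
  qed
  moreover have "P (trig_poly M c) = trig_poly (M \<inter> T) c" if M: "finite M" "M \<subseteq> characters" for M c
  proof -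
    have tp: "trig_poly M c \<in> Lp p" by (rule trig_poly_Lp[OF M(2) p1])
    have "Q (trig_poly M c) (trig_poly (M \<inter> T) c)" unfolding Q_def using M by blast
    from R_unique[OF RP[OF tp] R_Q[OF this] tp] show ?thesis .
  qed
  ultimately show ?thesis by blast
qed

section \<open>Consequences of the Baire category theorem\<close>

lemma riesz_projection_spec:
  assumes p: "1 < p" and rb: "riesz_bounded p T"
  shows "bounded_op (Lp p) (Hp p T) (Lp_norm p) (riesz_projection p T)"
    and "finite M \<Longrightarrow> M \<subseteq> characters \<Longrightarrow> riesz_projection p T (trig_poly M c) = trig_poly (M \<inter> T) c"
  using someI_ex[OF riesz_projection_exists[OF assms], folded riesz_projection_def] by blast+

lemma bounded_op_pos_bound:
  assumes "bounded_op Y Z (Lp_norm p) A"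
  obtains C where "0 < C" "\<And>f. f \<in> Y \<Longrightarrow> Lp_norm p (A f) \<le> C * Lp_norm p f"
proof -
  obtain C where C: "\<forall>f\<in>Y. Lp_norm p (A f) \<le> C * Lp_norm p f"
    using assms unfolding bounded_op_def by blast
  have "Lp_norm p (A f) \<le> (\<bar>C\<bar> + 1) * Lp_norm p f" if "f \<in> Y" for f
  proof -
    have "C * Lp_norm p f \<le> (\<bar>C\<bar> + 1) * Lp_norm p f" by (intro mult_right_mono) auto
    with C that show ?thesis by (meson order.trans)
  qed
  then show ?thesis using that[of "\<bar>C\<bar> + 1"] by simp
qed

lemma bounded_op_diff:
  assumes A: "bounded_op Y Z N A" and Y: "L0.subspace Y" "f \<in> Y" "g \<in> Y"
  shows "A (f - g) = A f - A g"
proof -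
  have "A (f + scale_L0 (-1) g) = A f + scale_L0 (-1) (A g)"
    using A Y L0.subspace_scale[OF Y(1,3)] unfolding bounded_op_def by metis
  then show ?thesis by (simp add: scale_minus_one)
qed

text \<open>Closedness in all of \<open>Lp p\<close>, expressed by sequences. With
  \<open>Lp_complete\<close> it makes \<open>R\<close> a complete metric space.\<close>

definition Lp_closed :: "real \<Rightarrow> 'a::compact_ab_group L0 set \<Rightarrow> bool" where
  "Lp_closed p R \<longleftrightarrow> R \<subseteq> Lp p \<and>
     (\<forall>f g. (\<forall>n. f n \<in> R) \<longrightarrow> g \<in> Lp p \<longrightarrow> (\<lambda>n::nat. Lp_norm p (f n - g)) \<longlonglongrightarrow> 0 \<longrightarrow> g \<in> R)"

lemma Metric_space_Lp:
  assumes p: "1 \<le> p" and R: "R \<subseteq> Lp p"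
  shows "Metric_space R (\<lambda>f g. Lp_norm p (f - g))"
proof
  have p0: "0 < p" using p by simp
  fix x y z :: "'a L0"
  show "Lp_norm p (x - y) = Lp_norm p (y - x)" by (rule Lp_norm_minus_commute[OF p0])
  assume xyz: "x \<in> R" "y \<in> R"
  then have xy: "x - y \<in> Lp p" using R p by (intro Lp_diff) auto
  show "Lp_norm p (x - y) = 0 \<longleftrightarrow> x = y"
    using Lp_norm_eq_0[OF p0 xy] by simp
  assume "z \<in> R"
  then have yz: "y - z \<in> Lp p" using xyz R p by (intro Lp_diff) auto
  show "Lp_norm p (x - z) \<le> Lp_norm p (x - y) + Lp_norm p (y - z)"
    using Lp_norm_add[OF p xy yz] by simp
qed simp

text \<open>
  The Baire category half of the open mapping theorem, with \<open>S r\<close> in the role of the image of the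
  ball of radius \<open>r\<close>.
\<close>

lemma Baire_approx:
  fixes R :: "'a::compact_ab_group L0 set" and S :: "real \<Rightarrow> 'a L0 set"
  assumes p: "1 < p" and sub: "L0.subspace R" and cl: "Lp_closed p R"
    and SR: "\<And>r. S r \<subseteq> R" and S0: "0 \<in> S 0"
    and Sdiff: "\<And>r s u v. u \<in> S r \<Longrightarrow> v \<in> S s \<Longrightarrow> u - v \<in> S (r + s)"
    and Sscale: "\<And>r c u. u \<in> S r \<Longrightarrow> 0 < c \<Longrightarrow> scale_L0 (complex_of_real c) u \<in> S (c * r)"
    and cover: "\<And>u. u \<in> R \<Longrightarrow> \<exists>n::nat. u \<in> S (real n)"
  obtains C where "0 \<le> C" "\<And>g e. g \<in> R \<Longrightarrow> 0 < e \<Longrightarrow> \<exists>u\<in>S (C * Lp_norm p g). Lp_norm p (g - u) < e"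
proof -
  have p1: "1 \<le> p" and p0: "0 < p" using p by auto
  have RL: "R \<subseteq> Lp p" using cl by (simp add: Lp_closed_def)
  interpret M: Metric_space R "\<lambda>f g. Lp_norm p (f - g)"
    by (rule Metric_space_Lp[OF p1 RL])
  have complete: "M.mcomplete"
    unfolding M.mcomplete_def
  proof (intro allI impI)
    fix \<sigma> assume "M.MCauchy \<sigma>"
    then have \<sigma>: "\<And>n. \<sigma> n \<in> R" and cau: "\<And>e. 0 < e \<Longrightarrow> \<exists>N. \<forall>n n'. N \<le> n \<longrightarrow> N \<le> n' \<longrightarrow> Lp_norm p (\<sigma> n - \<sigma> n') < e"
      unfolding M.MCauchy_def by auto
    have \<sigma>L: "\<sigma> n \<in> Lp p" for n using \<sigma> RL by blast
    have cau': "\<exists>N. \<forall>m\<ge>N. \<forall>n\<ge>N. Lp_norm p (\<sigma> m - \<sigma> n) < e" if "0 < e" for e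
      using cau[OF that] by blast
    obtain g where g: "g \<in> Lp p" "(\<lambda>n. Lp_norm p (\<sigma> n - g)) \<longlonglongrightarrow> 0"
      using Lp_complete[of p \<sigma>, OF p \<sigma>L cau'] by blast
    then have "g \<in> R" using cl \<sigma> unfolding Lp_closed_def by blast
    then have "limitin M.mtopology \<sigma> g sequentially"
      using g(2) \<sigma> by (simp add: M.limitin_metric_dist_null)
    then show "\<exists>x. limitin M.mtopology \<sigma> x sequentially" ..
  qed
  have "\<exists>n::nat. M.mtopology interior_of (M.mtopology closure_of S (real n)) \<noteq> {}"
  proof (rule ccontr)
    assume neg: "\<not> ?thesis"
    let ?G = "range (\<lambda>n::nat. M.mtopology closure_of S (real n))"
    have "M.mtopology interior_of \<Union>?G = {}"
    proof (rule M.metric_Baire_category_alt[OF complete])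
      show "closedin M.mtopology T \<and> M.mtopology interior_of T = {}" if "T \<in> ?G" for T
        using that neg by (auto simp: closedin_closure_of)
    qed simp
    moreover have "\<Union>?G = R"
    proof
      show "\<Union>?G \<subseteq> R" using closure_of_subset_topspace[of M.mtopology] by auto
      show "R \<subseteq> \<Union>?G"
      proof
        fix u assume "u \<in> R"
        then obtain n :: nat where "u \<in> S (real n)" using cover by blast
        moreover have "S (real n) \<subseteq> M.mtopology closure_of S (real n)"
          using SR by (intro closure_of_subset) simp
        ultimately show "u \<in> \<Union>?G" by blast
      qed
    qed
    ultimately have "R = {}" using interior_of_topspace[of M.mtopology] by simp
    then show False using L0.subspace_0[OF sub] by simp
  qed
  then obtain n :: nat and x where "x \<in> M.mtopology interior_of (M.mtopology closure_of S (real n))" by blast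
  then obtain \<rho> where x: "x \<in> R" and \<rho>: "0 < \<rho>" "M.mball x \<rho> \<subseteq> M.mtopology closure_of S (real n)"
    unfolding M.metric_interior_of by blast
  have near: "\<exists>u\<in>S (real n). Lp_norm p (y - u) < e" if y: "y \<in> R" "Lp_norm p (x - y) < \<rho>" and e: "0 < e" for y e
  proof -
    have "y \<in> M.mball x \<rho>" using x y by (simp add: M.in_mball)
    with \<rho>(2) have "y \<in> M.mtopology closure_of S (real n)" by blast
    then show ?thesis using e unfolding M.metric_closure_of by (auto simp: M.in_mball)
  qed
  \<comment> \<open>Below, \<open>u - v\<close> lies in \<open>S (2 * n)\<close>, and undoing the
    scaling by \<open>t\<close> multiplies the radius by
    \<open>2 * Lp_norm p g / \<rho>\<close>.\<close>
  define C where "C = 4 * real n / \<rho>"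
  have C: "0 \<le> C" using \<rho> by (simp add: C_def)
  show ?thesis
  proof (rule that[OF C])
    fix g and e :: real assume g: "g \<in> R" and e: "0 < e"
    have gL: "g \<in> Lp p" using g RL by blast
    show "\<exists>u\<in>S (C * Lp_norm p g). Lp_norm p (g - u) < e"
    proof (cases "Lp_norm p g = 0")
      case True
      then have "g = 0" using Lp_norm_eq_0[OF p0 gL] by simp
      then show ?thesis using S0 e by (intro bexI[of _ 0]) auto
    next
      case False
      then have pos: "Lp_norm p g > 0" using Lp_norm_nonneg[of p g] by linarith
      \<comment> \<open>This scales \<open>g\<close> to norm \<open>\<rho> / 2\<close>, so that
        \<open>x\<close> and \<open>x + t * g\<close> both lie in the ball where
        \<open>S (real n)\<close> is dense; subtracting their approximations eliminates the centre
        \<open>x\<close>.\<close>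
      define t where "t = \<rho> / (2 * Lp_norm p g)"
      have t: "t > 0" using pos \<rho> by (simp add: t_def)
      let ?tg = "scale_L0 (complex_of_real t) g"
      have tgR: "?tg \<in> R" using sub g by (rule L0.subspace_scale)
      have "Lp_norm p ?tg = t * Lp_norm p g" using p0 t by (simp add: Lp_norm_scale del: of_real_divide)
      then have tgn: "Lp_norm p ?tg = \<rho> / 2" using pos by (simp add: t_def)
      have te: "t * e / 2 > 0" using t e by simp
      have "x + ?tg \<in> R" using sub x tgR by (rule L0.subspace_add)
      moreover have "Lp_norm p (x - (x + ?tg)) < \<rho>" using tgn \<rho> p0 by (simp add: Lp_norm_uminus)
      ultimately obtain u where u: "u \<in> S (real n)" "Lp_norm p (x + ?tg - u) < t * e / 2"
        using near te by blast
      have "Lp_norm p (x - x) < \<rho>" using \<rho> by simp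
      then obtain v where v: "v \<in> S (real n)" "Lp_norm p (x - v) < t * e / 2"
        using near[OF x _ te] by blast
      have uvL: "u \<in> Lp p" "v \<in> Lp p" "x \<in> Lp p" "?tg \<in> Lp p" using u v x tgR SR RL by blast+
      have "?tg - (u - v) = (x + ?tg - u) - (x - v)" by simp
      also have "Lp_norm p \<dots> \<le> Lp_norm p (x + ?tg - u) + Lp_norm p (x - v)"
        using p1 uvL by (intro Lp_norm_diff Lp_diff Lp_add)
      also have "\<dots> < t * e" using u v by simp
      finally have d: "Lp_norm p (?tg - (u - v)) < t * e" .
      let ?w = "scale_L0 (complex_of_real (1 / t)) (u - v)"
      have "?w \<in> S ((1 / t) * (real n + real n))"
        using Sdiff[OF u(1) v(1)] t by (intro Sscale) auto
      also have "(1 / t) * (real n + real n) = C * Lp_norm p g"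
        using pos \<rho> by (simp add: t_def C_def field_simps)
      finally have w: "?w \<in> S (C * Lp_norm p g)" .
      have "g - ?w = scale_L0 (complex_of_real (1 / t)) (?tg - (u - v))"
        using t by (simp add: L0.scale_right_diff_distrib)
      then have "Lp_norm p (g - ?w) = (1 / t) * Lp_norm p (?tg - (u - v))"
        using p0 t by (simp only: Lp_norm_scale norm_of_real) simp
      also have "\<dots> < e" using d t by (simp add: field_simps)
      finally show ?thesis using w by blast
    qed
  qed
qed

section \<open>Ranges completed by a finite-dimensional space\<close>

definition lin_comb :: "'a::compact_ab_group L0 set \<Rightarrow> ('a L0 \<Rightarrow> complex) \<Rightarrow> 'a L0" where
  "lin_comb B c = (\<Sum>b\<in>B. scale_L0 (c b) b)"

lemma lin_comb_diff: "lin_comb B c - lin_comb B d = lin_comb B (\<lambda>b. c b - d b)"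
  by (simp add: lin_comb_def L0.scale_left_diff_distrib sum_subtractf)

lemma lin_comb_scale: "scale_L0 a (lin_comb B c) = lin_comb B (\<lambda>b. a * c b)"
  by (simp add: lin_comb_def L0.scale_sum_right)

lemma lin_comb_Lp: "1 \<le> p \<Longrightarrow> B \<subseteq> Lp p \<Longrightarrow> lin_comb B c \<in> Lp p"
  unfolding lin_comb_def by (rule L0.subspace_sum[OF Lp_subspace]) (auto intro: Lp_scale)

lemma lin_comb_subspace: "L0.subspace Y \<Longrightarrow> B \<subseteq> Y \<Longrightarrow> lin_comb B c \<in> Y"
  unfolding lin_comb_def by (rule L0.subspace_sum) (auto intro: L0.subspace_scale)

lemma coefficient_bound: "finite B \<Longrightarrow> \<exists>n::nat. \<forall>b\<in>B. cmod (c b) \<le> real n"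
proof (induction B rule: finite_induct)
  case (insert b B)
  then obtain n where n: "\<forall>b\<in>B. cmod (c b) \<le> real n" by blast
  obtain m :: nat where "cmod (c b) \<le> real m" using real_arch_simple by blast
  with n show ?case by (intro exI[of _ "max m n"]) (auto simp: le_max_iff_disj of_nat_max)
qed simp

text \<open>Baire's theorem for the map sending \<open>(f, c)\<close> to
  \<open>A f + lin_comb B c\<close>, controlling \<open>f\<close> and the coefficients at once. It
  has three uses: with \<open>B = {}\<close> for the open mapping theorem, with \<open>B\<close>
  representing a finite-dimensional quotient for \<open>Phi_minus\<close>, and with
  \<open>A = 0\<close> to bound coordinates in the kernel for \<open>Phi_plus\<close>.\<close>

lemma range_plus_span_approx:
  fixes Y R B :: "'a::compact_ab_group L0 set"
  assumes p: "1 < p" and Y: "L0.subspace Y" "Y \<subseteq> Lp p" and R: "L0.subspace R" "Lp_closed p R"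
    and AR: "\<And>f. f \<in> Y \<Longrightarrow> A f \<in> R"
    and Adiff: "\<And>f g. f \<in> Y \<Longrightarrow> g \<in> Y \<Longrightarrow> A (f - g) = A f - A g"
    and Ascale: "\<And>c f. f \<in> Y \<Longrightarrow> A (scale_L0 c f) = scale_L0 c (A f)"
    and B: "finite B" "B \<subseteq> R" and cover: "\<And>u. u \<in> R \<Longrightarrow> \<exists>f\<in>Y. u - A f \<in> L0.span B"
  obtains C where "0 \<le> C" "\<And>g e. g \<in> R \<Longrightarrow> 0 < e \<Longrightarrow>
    \<exists>f c. f \<in> Y \<and> Lp_norm p f \<le> C * Lp_norm p g \<and> (\<forall>b\<in>B. cmod (c b) \<le> C * Lp_norm p g) \<and>
      Lp_norm p (g - (A f + lin_comb B c)) < e"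
proof -
  have p1: "1 \<le> p" using p by simp
  have A0: "A 0 = 0" using Ascale[OF L0.subspace_0[OF Y(1)], of 0] by simp
  define S where "S r = {A f + lin_comb B c | f c. f \<in> Y \<and> Lp_norm p f \<le> r \<and> (\<forall>b\<in>B. cmod (c b) \<le> r)}" for r
  obtain C where C: "0 \<le> C" "\<And>g e. g \<in> R \<Longrightarrow> 0 < e \<Longrightarrow> \<exists>u\<in>S (C * Lp_norm p g). Lp_norm p (g - u) < e"
  proof (rule Baire_approx[OF p R, of S])
    show "S r \<subseteq> R" for r
      unfolding S_def using AR lin_comb_subspace[OF R(1) B(2)] L0.subspace_add[OF R(1)] by auto
    show "0 \<in> S 0" unfolding S_def using A0 L0.subspace_0[OF Y(1)]
      by (intro CollectI exI[of _ 0] exI[of _ "\<lambda>_. 0"]) (auto simp: lin_comb_def)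
    show "u - v \<in> S (r + s)" if uv: "u \<in> S r" "v \<in> S s" for r s u v
    proof -
      from uv(1) obtain f c where fc: "f \<in> Y" "Lp_norm p f \<le> r" "\<forall>b\<in>B. cmod (c b) \<le> r" "u = A f + lin_comb B c"
        by (auto simp: S_def)
      from uv(2) obtain g d where gd: "g \<in> Y" "Lp_norm p g \<le> s" "\<forall>b\<in>B. cmod (d b) \<le> s" "v = A g + lin_comb B d"
        by (auto simp: S_def)
      have "Lp_norm p (f - g) \<le> Lp_norm p f + Lp_norm p g" using fc gd Y(2) by (intro Lp_norm_diff p1) auto
      then have 1: "Lp_norm p (f - g) \<le> r + s" using fc gd by linarith
      have "cmod (c b - d b) \<le> r + s" if "b \<in> B" for b
      proof -
        have "cmod (c b) \<le> r" "cmod (d b) \<le> s" using that fc(3) gd(3) by auto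
        then show ?thesis using norm_triangle_ineq4[of "c b" "d b"] by linarith
      qed
      moreover have "u - v = A (f - g) + lin_comb B (\<lambda>b. c b - d b)"
        using Adiff[OF fc(1) gd(1)] by (simp add: fc(4) gd(4) flip: lin_comb_diff)
      ultimately show ?thesis unfolding S_def using 1 L0.subspace_diff[OF Y(1) fc(1) gd(1)] by blast
    qed
    show "scale_L0 (complex_of_real t) u \<in> S (t * r)" if u: "u \<in> S r" and t: "0 < t" for r t u
    proof -
      from u obtain f c where fc: "f \<in> Y" "Lp_norm p f \<le> r" "\<forall>b\<in>B. cmod (c b) \<le> r" "u = A f + lin_comb B c"
        by (auto simp: S_def)
      have "scale_L0 (complex_of_real t) u = A (scale_L0 (complex_of_real t) f) + lin_comb B (\<lambda>b. complex_of_real t * c b)"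
        using fc by (simp add: L0.scale_right_distrib Ascale lin_comb_scale)
      moreover have "Lp_norm p (scale_L0 (complex_of_real t) f) \<le> t * r" using fc(2) t p by (simp add: Lp_norm_scale)
      moreover have "\<forall>b\<in>B. cmod (complex_of_real t * c b) \<le> t * r" using fc(3) t by (simp add: norm_mult)
      ultimately show ?thesis unfolding S_def using L0.subspace_scale[OF Y(1) fc(1)] by blast
    qed
    show "\<exists>n::nat. u \<in> S (real n)" if "u \<in> R" for u
    proof -
      from cover[OF that] obtain f where f: "f \<in> Y" "u - A f \<in> L0.span B" by blast
      from f(2) obtain c where c: "u - A f = lin_comb B c" unfolding L0.span_finite[OF B(1)] lin_comb_def by auto
      obtain n :: nat where n: "\<forall>b\<in>B. cmod (c b) \<le> real n" using coefficient_bound[OF B(1)] by blast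
      obtain m :: nat where m: "Lp_norm p f \<le> real m" using real_arch_simple by blast
      have "u = A f + lin_comb B c" using c by (simp add: algebra_simps)
      then have "u \<in> S (real (max m n))"
        unfolding S_def using f(1) m n by (auto simp: of_nat_max le_max_iff_disj)
      then show ?thesis by blast
    qed
  qed blast
  show ?thesis
  proof (rule that[OF C(1)])
    fix g and e :: real assume "g \<in> R" "0 < e"
    from C(2)[OF this] show "\<exists>f c. f \<in> Y \<and> Lp_norm p f \<le> C * Lp_norm p g \<and>
        (\<forall>b\<in>B. cmod (c b) \<le> C * Lp_norm p g) \<and> Lp_norm p (g - (A f + lin_comb B c)) < e"
      unfolding S_def by blast
  qed
qed

lemma Lp_norm_tendsto:
  assumes p: "1 \<le> p" and f: "\<And>n::nat. f n \<in> Lp p" "g \<in> Lp p" "(\<lambda>n. Lp_norm p (f n - g)) \<longlonglongrightarrow> 0"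
  shows "(\<lambda>n. Lp_norm p (f n)) \<longlonglongrightarrow> Lp_norm p g"
proof -
  have "\<bar>Lp_norm p (f n) - Lp_norm p g\<bar> \<le> Lp_norm p (f n - g)" for n
  proof -
    have "Lp_norm p (f n - g + g) \<le> Lp_norm p (f n - g) + Lp_norm p g"
      using p f by (intro Lp_norm_add Lp_diff)
    moreover have "Lp_norm p (f n - (f n - g)) \<le> Lp_norm p (f n) + Lp_norm p (f n - g)"
      using p f by (intro Lp_norm_diff Lp_diff)
    ultimately show ?thesis by simp
  qed
  then have "(\<lambda>n. Lp_norm p (f n) - Lp_norm p g) \<longlonglongrightarrow> 0"
    by (intro Lim_null_comparison[OF _ f(3)]) auto
  then show ?thesis by (simp add: LIM_zero_iff)
qed

text \<open>Successive approximation: the residual is at least halved relative to its previous bound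
  at each step, and the corrections form a convergent series in \<open>Y\<close>.\<close>

lemma open_mapping_Lp:
  fixes A :: "'a::compact_ab_group L0 \<Rightarrow> 'a L0"
  assumes p: "1 < p" and Y: "L0.subspace Y" "Lp_closed p Y" and A: "bounded_op Y Y (Lp_norm p) A"
    and R: "Lp_closed p (A ` Y)"
  obtains C where "0 \<le> C" "\<And>g. g \<in> A ` Y \<Longrightarrow> \<exists>f\<in>Y. A f = g \<and> Lp_norm p f \<le> C * Lp_norm p g"
proof -
  have p1: "1 \<le> p" and p0: "0 < p" using p by auto
  have YL: "Y \<subseteq> Lp p" using Y(2) by (simp add: Lp_closed_def)
  have AY: "A f \<in> Y" if "f \<in> Y" for f using A that by (simp add: bounded_op_def)
  have Asc: "A (scale_L0 c f) = scale_L0 c (A f)" if "f \<in> Y" for c f using A that by (simp add: bounded_op_def)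
  have Aadd: "A (f + g) = A f + A g" if "f \<in> Y" "g \<in> Y" for f g using A that by (simp add: bounded_op_def)
  have A0: "A 0 = 0" using Asc[OF L0.subspace_0[OF Y(1)], of 0] by simp
  have sub: "L0.subspace (A ` Y)"
  proof (rule L0.subspaceI)
    show "0 \<in> A ` Y" using A0 L0.subspace_0[OF Y(1)] by (metis imageI)
    show "x + y \<in> A ` Y" if "x \<in> A ` Y" "y \<in> A ` Y" for x y
      using that Aadd L0.subspace_add[OF Y(1)] by (auto simp: image_iff) metis
    show "scale_L0 c x \<in> A ` Y" if "x \<in> A ` Y" for c x
      using that Asc L0.subspace_scale[OF Y(1)] by (auto simp: image_iff) metis
  qed
  obtain C where C: "0 \<le> C" "\<And>g e. g \<in> A ` Y \<Longrightarrow> 0 < e \<Longrightarrow>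
      \<exists>f c. f \<in> Y \<and> Lp_norm p f \<le> C * Lp_norm p g \<and> (\<forall>b\<in>{}. cmod (c b) \<le> C * Lp_norm p g) \<and>
        Lp_norm p (g - (A f + lin_comb {} c)) < e"
  proof (rule range_plus_span_approx[OF p Y(1) YL sub R, of A "{}"])
    show "\<exists>f\<in>Y. u - A f \<in> L0.span {}" if "u \<in> A ` Y" for u using that by auto
  qed (auto simp: Asc bounded_op_diff[OF A Y(1)])
  show ?thesis
  \<comment> \<open>The \<open>k\<close>-th correction has norm at most
    \<open>C * Lp_norm p g / 2 ^ k\<close>, and the geometric series sums to 2.\<close>
  proof (rule that[of "2 * C"])
    show "0 \<le> 2 * C" using C by simp
    fix g assume g: "g \<in> A ` Y"
    let ?n = "Lp_norm p g"
    show "\<exists>f\<in>Y. A f = g \<and> Lp_norm p f \<le> 2 * C * ?n"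
    proof (cases "?n = 0")
      case True
      have "g \<in> Lp p" using g AY YL by blast
      then have "g = 0" using True Lp_norm_eq_0[OF p0] by blast
      then show ?thesis using A0 L0.subspace_0[OF Y(1)] by (intro bexI[of _ 0]) auto
    next
      case False
      then have n: "?n > 0" using Lp_norm_nonneg[of p g] by linarith
      have "\<exists>f. f \<in> Y \<and> Lp_norm p f \<le> C * Lp_norm p y \<and> Lp_norm p (y - A f) < ?n / 2 ^ k" if "y \<in> A ` Y" for y and k :: nat
      proof -
        have "?n / 2 ^ k > 0" using n by simp
        from C(2)[OF that this] show ?thesis by (auto simp: lin_comb_def)
      qed
      then obtain F where F: "\<And>y k. y \<in> A ` Y \<Longrightarrow> F y k \<in> Y"
        "\<And>y k. y \<in> A ` Y \<Longrightarrow> Lp_norm p (F y k) \<le> C * Lp_norm p y"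
        "\<And>y k. y \<in> A ` Y \<Longrightarrow> Lp_norm p (y - A (F y k)) < ?n / 2 ^ k" by metis
      \<comment> \<open>\<open>y k\<close> is the part of \<open>g\<close> not yet reached. The
        index \<open>Suc k\<close> passed to \<open>F\<close> makes the next residual smaller than
        \<open>?n / 2 ^ Suc k\<close>.\<close>
      define y where "y = rec_nat g (\<lambda>k x. x - A (F x (Suc k)))"
      have y0: "y 0 = g" and yS: "\<And>k. y (Suc k) = y k - A (F (y k) (Suc k))" by (auto simp: y_def)
      have yR: "y k \<in> A ` Y" for k
      proof (induction k)
        case (Suc k)
        then show ?case unfolding yS using F(1) by (intro L0.subspace_diff[OF sub]) auto
      qed (simp add: y0 g)
      have yn: "Lp_norm p (y k) \<le> ?n / 2 ^ k" for k
      proof (cases k)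
        case (Suc j)
        show ?thesis unfolding Suc yS using F(3)[OF yR, of j "Suc j"] by simp
      qed (simp add: y0)
      define f where "f k = F (y k) (Suc k)" for k
      have fY: "f k \<in> Y" for k unfolding f_def by (rule F(1)[OF yR])
      have fn: "Lp_norm p (f k) \<le> C * ?n * (1/2) ^ k" for k
      proof -
        have "Lp_norm p (f k) \<le> C * Lp_norm p (y k)" unfolding f_def by (rule F(2)[OF yR])
        also have "\<dots> \<le> C * (?n / 2 ^ k)" using yn C by (intro mult_left_mono) auto
        finally show ?thesis by (simp add: power_divide)
      qed
      define G where "G k = (\<Sum>i<k. f i)" for k
      have GY: "G k \<in> Y" for k unfolding G_def by (rule L0.subspace_sum[OF Y(1)]) (rule fY)
      have AG: "g - A (G k) = y k" for k
      proof (induction k)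
        case 0 then show ?case by (simp add: G_def A0 y0)
      next
        case (Suc k)
        have "A (G (Suc k)) = A (G k) + A (f k)"
          unfolding G_def sum.lessThan_Suc using Aadd[OF GY[of k] fY[of k]] by (simp add: G_def)
        then show ?case using Suc by (simp add: yS f_def algebra_simps)
      qed
      \<comment> \<open>The bound inside subtracts the tail so that the induction on
        \<open>k\<close> goes through.\<close>
      have geo: "(\<Sum>i\<in>{m..<k}. (1/2::real) ^ i) \<le> 2 * (1/2) ^ m" for m k
      proof -
        have "(\<Sum>i\<in>{m..<k}. (1/2::real) ^ i) \<le> 2 * (1/2) ^ m - (if m \<le> k then 2 * (1/2) ^ k else 0)"
          by (induction k) (auto simp: not_le le_Suc_eq atLeastLessThanSuc)
        also have "\<dots> \<le> 2 * (1/2) ^ m" by simp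
        finally show ?thesis .
      qed
      have Gd: "Lp_norm p (G k - G m) \<le> C * ?n * (2 * (1/2) ^ m)" if "m \<le> k" for m k
      proof -
        have "G k - G m = (\<Sum>i\<in>{m..<k}. f i)"
          unfolding G_def lessThan_atLeast0 using sum_diff_nat_ivl[of 0 m k f] that by simp
        also have "Lp_norm p \<dots> \<le> (\<Sum>i\<in>{m..<k}. Lp_norm p (f i))"
          using fY YL by (intro Lp_norm_sum p1) auto
        also have "\<dots> \<le> (\<Sum>i\<in>{m..<k}. C * ?n * (1/2) ^ i)" by (intro sum_mono fn)
        also have "\<dots> = C * ?n * (\<Sum>i\<in>{m..<k}. (1/2) ^ i)" by (simp add: sum_distrib_left)
        also have "\<dots> \<le> C * ?n * (2 * (1/2) ^ m)" using C n geo by (intro mult_left_mono) auto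
        finally show ?thesis .
      qed
      have GL: "G k \<in> Lp p" for k using GY YL by blast
      have cau: "\<exists>N. \<forall>m\<ge>N. \<forall>k\<ge>N. Lp_norm p (G m - G k) < e" if e: "0 < e" for e
      proof -
        have "(\<lambda>m. C * ?n * (2 * (1/2) ^ m)) \<longlonglongrightarrow> C * ?n * (2 * 0)"
          by (intro tendsto_intros LIMSEQ_power_zero) auto
        then have "\<forall>\<^sub>F m in sequentially. C * ?n * (2 * (1/2) ^ m) < e"
          by (rule order_tendstoD) (use e in simp)
        then obtain N where N: "\<And>m. m \<ge> N \<Longrightarrow> C * ?n * (2 * (1/2) ^ m) < e"
          by (auto simp: eventually_sequentially)
        have "Lp_norm p (G m - G k) < e" if "m \<ge> N" "k \<ge> N" for m k
        proof (cases "m \<le> k")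
          case True
          then show ?thesis using Gd[OF True] N[OF that(1)] Lp_norm_minus_commute[OF p0, of "G m" "G k"] by simp
        next
          case False
          then show ?thesis using Gd[of k m] N[OF that(2)] by simp
        qed
        then show ?thesis by blast
      qed
      obtain h where h: "h \<in> Lp p" "(\<lambda>k. Lp_norm p (G k - h)) \<longlonglongrightarrow> 0"
        using Lp_complete[of p G, OF p GL cau] by blast
      have hY: "h \<in> Y" using Y(2) GY h unfolding Lp_closed_def by blast
      have "Lp_norm p h \<le> 2 * C * ?n"
      proof (rule LIMSEQ_le_const2[OF Lp_norm_tendsto[OF p1 GL h]])
        have "Lp_norm p (G k) \<le> 2 * C * ?n" for k using Gd[of 0 k] by (simp add: G_def)
        then show "\<exists>N. \<forall>k\<ge>N. Lp_norm p (G k) \<le> 2 * C * ?n" by blast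
      qed
      moreover have "A h = g"
      proof -
        from bounded_op_pos_bound[OF A]
        obtain K where K: "0 < K" "\<And>f. f \<in> Y \<Longrightarrow> Lp_norm p (A f) \<le> K * Lp_norm p f" by metis
        have gL: "g \<in> Lp p" using g AY YL by blast
        have AhL: "A h \<in> Lp p" using AY[OF hY] YL by blast
        have le: "Lp_norm p (g - A h) \<le> ?n * (1/2) ^ k + K * Lp_norm p (G k - h)" for k
        proof -
          have "g - A h = y k + A (G k - h)"
            using bounded_op_diff[OF A Y(1) GY hY, of k] by (simp flip: AG)
          also have "Lp_norm p \<dots> \<le> Lp_norm p (y k) + Lp_norm p (A (G k - h))"
          proof (rule Lp_norm_add[OF p1])
            have "y k \<in> Y" using yR[of k] AY by auto
            then show "y k \<in> Lp p" using YL by (rule rev_subsetD)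
            show "A (G k - h) \<in> Lp p"
              by (rule subsetD[OF YL AY[OF L0.subspace_diff[OF Y(1) GY hY]]])
          qed
          also have "\<dots> \<le> ?n * (1/2) ^ k + K * Lp_norm p (G k - h)"
            using yn[of k] K(2)[OF L0.subspace_diff[OF Y(1) GY hY]] by (intro add_mono) (auto simp: power_divide)
          finally show ?thesis .
        qed
        have "(\<lambda>k. ?n * (1/2) ^ k + K * Lp_norm p (G k - h)) \<longlonglongrightarrow> ?n * 0 + K * 0"
          by (intro tendsto_intros LIMSEQ_power_zero h) auto
        then have "Lp_norm p (g - A h) \<le> ?n * 0 + K * 0"
          by (rule LIMSEQ_le_const) (use le in blast)
        then have "Lp_norm p (g - A h) = 0" using Lp_norm_nonneg[of p "g - A h"] by simp
        then show ?thesis using Lp_norm_eq_0[OF p0 Lp_diff[OF p1 gL AhL]] by simp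
      qed
      ultimately show ?thesis using hY by blast
    qed
  qed
qed

section \<open>The pairing inequality\<close>

text \<open>Each character is a quotient of elements of \<open>T\<close>, so a product
  \<open>\<Xi>\<close> of denominators moves all of \<open>M\<close> into \<open>T\<close>.
  Multiplying further by powers of some \<open>\<tau>\<close> in \<open>T\<close> stays in
  \<open>T\<close> and yields infinitely many shifts.\<close>

lemma positive_cone_shift:
  fixes T :: "('a::compact_ab_group \<Rightarrow> complex) set"
  assumes nontriv: "(UNIV :: 'a set) \<noteq> {0}" and T: "positive_cone T"
    and M: "finite M" "M \<subseteq> characters"
  obtains \<psi> :: "nat \<Rightarrow> 'a \<Rightarrow> complex" where "inj \<psi>" "\<And>n. \<psi> n \<in> characters"
    "\<And>n \<gamma>. \<gamma> \<in> M \<Longrightarrow> (\<lambda>x. \<psi> n x * \<gamma> x) \<in> T"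
proof -
  have TX: "T \<subseteq> characters" and T1: "(\<lambda>_. 1) \<in> T"
    and Tm: "\<And>\<xi> \<gamma>. \<xi> \<in> T \<Longrightarrow> \<gamma> \<in> T \<Longrightarrow> (\<lambda>x. \<xi> x * \<gamma> x) \<in> T"
    and Ti: "T \<inter> (\<lambda>\<gamma> x. inverse (\<gamma> x)) ` T = {\<lambda>_. 1}"
    and XT: "characters = {\<lambda>x. inverse (\<xi> x) * \<gamma> x | \<xi> \<gamma>. \<xi> \<in> T \<and> \<gamma> \<in> T}"
    using T unfolding positive_cone_def by blast+
  have rep: "\<exists>\<xi>\<in>T. (\<lambda>x. \<xi> x * \<gamma> x) \<in> T" if "\<gamma> \<in> characters" for \<gamma>
  proof -
    from that XT obtain \<xi> \<eta> where \<xi>: "\<xi> \<in> T" "\<eta> \<in> T" "\<gamma> = (\<lambda>x. inverse (\<xi> x) * \<eta> x)" by blast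
    have "(\<lambda>x. \<xi> x * \<gamma> x) = \<eta>"
      using character_nonzero[OF subsetD[OF TX \<xi>(1)]] by (auto simp: \<xi>(3) mult.assoc[symmetric])
    then show ?thesis using \<xi>(1,2) by (intro bexI[of _ \<xi>]) simp_all
  qed
  have "\<exists>\<Xi>\<in>T. \<forall>\<gamma>\<in>M. (\<lambda>x. \<Xi> x * \<gamma> x) \<in> T"
    using M
  proof (induction M rule: finite_induct)
    case (insert \<gamma> M)
    then obtain \<Xi> \<xi> where \<Xi>: "\<Xi> \<in> T" "\<forall>\<gamma>\<in>M. (\<lambda>x. \<Xi> x * \<gamma> x) \<in> T"
      and \<xi>: "\<xi> \<in> T" "(\<lambda>x. \<xi> x * \<gamma> x) \<in> T" using rep[of \<gamma>] by auto
    show ?case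
    proof (rule bexI[OF ballI Tm[OF \<Xi>(1) \<xi>(1)]])
      fix \<delta> assume "\<delta> \<in> insert \<gamma> M"
      then consider "\<delta> = \<gamma>" | "\<delta> \<in> M" by blast
      then show "(\<lambda>x. \<Xi> x * \<xi> x * \<delta> x) \<in> T"
      proof cases
        case 1
        from Tm[OF \<Xi>(1) \<xi>(2)] show ?thesis by (simp only: 1 mult.assoc)
      next
        case 2
        from Tm[OF \<xi>(1) \<Xi>(2)[rule_format, OF 2]] show ?thesis by (simp only: mult_ac)
      qed
    qed
  qed (use T1 in blast)
  then obtain \<Xi> where \<Xi>: "\<Xi> \<in> T" "\<And>\<gamma>. \<gamma> \<in> M \<Longrightarrow> (\<lambda>x. \<Xi> x * \<gamma> x) \<in> T" by blast
  obtain a :: 'a where "a \<noteq> 0" using nontriv by blast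
  from characters_separate[OF this] obtain c where c: "c \<in> characters" "c a \<noteq> 1" .
  \<comment> \<open>A trivial cone would leave only the trivial character, against the separation of
    \<open>a\<close> from 0.\<close>
  have "\<exists>\<tau>\<in>T. \<tau> \<noteq> (\<lambda>_. 1)"
  proof (rule ccontr)
    assume "\<not> ?thesis"
    then have one: "\<tau> = (\<lambda>_. 1)" if "\<tau> \<in> T" for \<tau> using that by blast
    from c(1) XT obtain \<xi> \<eta> where \<xi>: "\<xi> \<in> T" "\<eta> \<in> T" "c = (\<lambda>x. inverse (\<xi> x) * \<eta> x)" by blast
    show False using c(2) unfolding \<xi>(3) one[OF \<xi>(1)] one[OF \<xi>(2)] by simp
  qed
  then obtain \<tau> where \<tau>: "\<tau> \<in> T" "\<tau> \<noteq> (\<lambda>_. 1)" by blast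
  have \<tau>X: "\<tau> \<in> characters" using \<tau> TX by blast
  have pow: "(\<lambda>x. \<tau> x ^ n) \<in> T" for n
  proof (induction n)
    case (Suc n)
    from Tm[OF \<tau>(1) Suc] show ?case by simp
  qed (simp add: T1)
  \<comment> \<open>If a positive power \<open>Suc m\<close> of \<open>\<tau>\<close> were 1, then
    \<open>\<tau>\<close> would be the inverse of its own power \<open>m\<close>, hence in
    \<open>T\<close> and in its inverse, hence trivial.\<close>
  have pow1: "n = 0" if "\<And>x. \<tau> x ^ n = 1" for n
  proof (rule ccontr)
    assume "n \<noteq> 0"
    then obtain m where m: "n = Suc m" by (cases n) auto
    have "inverse (\<tau> x ^ m) = \<tau> x" for x
      using that[of x] by (intro inverse_unique) (simp add: m mult.commute)
    then have "\<tau> = (\<lambda>x. inverse (\<tau> x ^ m))" by auto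
    then have "\<tau> \<in> (\<lambda>\<gamma> x. inverse (\<gamma> x)) ` T"
      using pow[of m] by (rule image_eqI[where f = "\<lambda>\<gamma> x. inverse (\<gamma> x)"])
    then show False using Ti \<tau> by blast
  qed
  define \<psi> where "\<psi> n x = \<Xi> x * \<tau> x ^ n" for n :: nat and x
  have \<psi>T: "\<psi> n \<in> T" for n
    using Tm[OF \<Xi>(1) pow[of n]] by (simp add: \<psi>_def[abs_def])
  show ?thesis
  proof (rule that)
    have le: "m = n" if "m \<le> n" "\<psi> m = \<psi> n" for m n
    proof -
      have "\<tau> x ^ (n - m) = 1" for x
      proof -
        have "\<Xi> x * \<tau> x ^ m = \<Xi> x * \<tau> x ^ n" using fun_cong[OF that(2), of x] by (simp add: \<psi>_def)
        then have "\<tau> x ^ m = \<tau> x ^ n"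
          using character_nonzero[OF subsetD[OF TX \<Xi>(1)], of x] by simp
        also have "\<dots> = \<tau> x ^ m * \<tau> x ^ (n - m)"
          using that(1) by (metis le_add_diff_inverse power_add)
        finally show ?thesis using character_nonzero[OF \<tau>X, of x] by simp
      qed
      from pow1[OF this] that(1) show ?thesis by simp
    qed
    show "inj \<psi>"
    proof (rule injI)
      fix m n assume "\<psi> m = \<psi> n"
      then show "m = n" using le[of m n] le[of n m] by (cases "m \<le> n") auto
    qed
    show "\<psi> n \<in> characters" for n using \<psi>T TX by blast
    fix n \<gamma> assume "\<gamma> \<in> M"
    from Tm[OF pow[of n] \<Xi>(2)[OF this]] show "(\<lambda>x. \<psi> n x * \<gamma> x) \<in> T"
      by (simp add: \<psi>_def mult_ac)
  qed
qed

lemma inj_mult_character: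
  assumes "inj \<psi>" "\<gamma> \<in> characters"
  shows "inj (\<lambda>n x. \<psi> n x * \<gamma> x)"
proof (rule injI)
  fix m n assume "(\<lambda>x. \<psi> m x * \<gamma> x) = (\<lambda>x. \<psi> n x * \<gamma> x)"
  then have "\<psi> m x * \<gamma> x = \<psi> n x * \<gamma> x" for x by (rule fun_cong)
  then have "\<psi> m = \<psi> n" using character_nonzero[OF assms(2)] by auto
  then show "m = n" using assms(1) by (simp add: inj_eq)
qed

section \<open>Hardy spaces as closed subspaces\<close>

lemma Hp_Lp: "Hp p T \<subseteq> Lp p"
  by (auto simp: Hp_def)

lemma Hp_subspace: "1 < p \<Longrightarrow> L0.subspace (Hp p T)"
proof (rule L0.subspaceI)
  assume p: "1 < p"
  show "0 \<in> Hp p T" by (auto simp: Hp_def fourier_pairing pairing_def)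
  show "x + y \<in> Hp p T" if "x \<in> Hp p T" "y \<in> Hp p T" for x y
    using that p fourier_add[OF _ Lp_imp_L1(1)[OF p] Lp_imp_L1(1)[OF p], of _ x y]
    by (auto simp: Hp_def Lp_add)
  show "scale_L0 c x \<in> Hp p T" if "x \<in> Hp p T" for c x
    using that by (auto simp: Hp_def Lp_scale fourier_scale)
qed

text \<open>Each Fourier coefficient is continuous for the norm.\<close>

lemma Hp_closed:
  assumes p: "1 < p"
  shows "Lp_closed p (Hp p T)"
  unfolding Lp_closed_def
proof (intro conjI allI impI Hp_Lp)
  fix f :: "nat \<Rightarrow> 'a L0" and g
  assume f: "\<forall>n. f n \<in> Hp p T" and g: "g \<in> Lp p" and lim: "(\<lambda>n. Lp_norm p (f n - g)) \<longlonglongrightarrow> 0"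
  have fL: "f n \<in> Lp p" for n using f Hp_Lp by blast
  have "fourier g \<gamma> = 0" if \<gamma>: "\<gamma> \<in> characters - T" for \<gamma>
  proof -
    have "cmod (fourier g \<gamma>) \<le> Lp_norm p (f n - g)" for n
    proof -
      have "fourier (f n - g) \<gamma> = - fourier g \<gamma>"
        using f \<gamma> fourier_diff[of \<gamma>, OF _ Lp_imp_L1(1)[OF p fL] Lp_imp_L1(1)[OF p g]] by (simp add: Hp_def)
      then show ?thesis
        using fourier_norm_le[OF _ Lp_diff[OF _ fL g] p, of \<gamma> n] \<gamma> p by simp
    qed
    then have "cmod (fourier g \<gamma>) \<le> 0" by (intro LIMSEQ_le_const[OF lim]) blast
    then show ?thesis by simp
  qed
  then show "g \<in> Hp p T" using g by (simp add: Hp_def)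
qed

lemma trig_poly_Hp:
  assumes "1 < p" "finite M" "M \<subseteq> T" "T \<subseteq> characters"
  shows "trig_poly M c \<in> Hp p T"
proof -
  have "M \<subseteq> characters" using assms by blast
  then show ?thesis
    using assms fourier_trig_poly[of M _ c] trig_poly_Lp[of M p c] unfolding Hp_def by fastforce
qed

lemma conj_exponent_sym: "1/p + 1/q = 1 \<Longrightarrow> 1/q + 1/p = (1::real)"
  by simp

lemma pairing_bound:
  assumes "f \<in> Lp p" "g \<in> Lp q" "1 < p" "1 < q" "1/p + 1/q = 1"
  shows "f * cnj_L0 g \<in> Lp 1" "cmod (pairing f g) \<le> Lp_norm p f * Lp_norm q g"
  using Hoelder_L0[of f p "cnj_L0 g" q] assms by (simp_all add: pairing_def Lp_cnj)

lemma pairing_trig_poly: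
  assumes p: "1 < p" and f: "f \<in> Lp p" and M: "M \<subseteq> characters"
  shows "pairing f (trig_poly M c) = (\<Sum>\<gamma>\<in>M. cnj (c \<gamma>) * fourier f \<gamma>)"
proof -
  have "f * cnj_L0 (scale_L0 (c \<gamma>) (L0_of \<gamma>)) \<in> Lp 1" if "\<gamma> \<in> M" for \<gamma>
  proof -
    have "\<gamma> \<in> characters" using that M by blast
    then have "f * cnj_L0 (L0_of \<gamma>) \<in> Lp 1"
      by (intro Lp_mult_cnj_character Lp_imp_L1(1)[OF p f])
    then show ?thesis by (simp add: cnj_L0_scale scale_L0_mult_right Lp_scale)
  qed
  then have "pairing f (trig_poly M c) = (\<Sum>\<gamma>\<in>M. pairing f (scale_L0 (c \<gamma>) (L0_of \<gamma>)))"
    unfolding trig_poly_def by (rule pairing_sum_right)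
  also have "\<dots> = (\<Sum>\<gamma>\<in>M. cnj (c \<gamma>) * fourier f \<gamma>)"
    using M by (intro sum.cong) (auto simp: pairing_scale_right fourier_pairing subset_iff)
  finally show ?thesis .
qed

lemma mult_character_trig_poly_eq:
  assumes "\<psi> \<in> characters" "M \<subseteq> characters"
  shows "L0_of \<psi> * trig_poly M c = (\<Sum>\<gamma>\<in>M. scale_L0 (c \<gamma>) (L0_of (\<lambda>x. \<psi> x * \<gamma> x)))"
  unfolding trig_poly_def sum_distrib_left
  using assms by (intro sum.cong) (auto simp: scale_L0_mult_right L0_of_mult character_bmeas subset_iff)

text \<open>The pairing is a finite sum of Fourier coefficients of \<open>f\<close> at
  \<open>\<psi> n * \<gamma>\<close>; for each fixed \<open>\<gamma>\<close> these characters are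
  pairwise distinct, so Riemann-Lebesgue applies.\<close>

lemma pairing_translates_tendsto_0:
  fixes f :: "'a::compact_ab_group L0"
  assumes p: "1 < p" and f: "f \<in> Lp p" and M: "M \<subseteq> characters"
    and \<psi>: "inj \<psi>" "\<And>n::nat. \<psi> n \<in> characters"
  shows "(\<lambda>n. pairing f (L0_of (\<psi> n) * trig_poly M c)) \<longlonglongrightarrow> 0"
proof -
  have f1: "f \<in> Lp 1" by (rule Lp_imp_L1(1)[OF p f])
  have eq: "pairing f (L0_of (\<psi> n) * trig_poly M c) = (\<Sum>\<gamma>\<in>M. cnj (c \<gamma>) * fourier f (\<lambda>x. \<psi> n x * \<gamma> x))" for n
  proof -
    have ch: "(\<lambda>x. \<psi> n x * \<gamma> x) \<in> characters" if "\<gamma> \<in> M" for \<gamma>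
      using that M \<psi>(2) by (intro character_mult) auto
    have "f * cnj_L0 (scale_L0 (c \<gamma>) (L0_of (\<lambda>x. \<psi> n x * \<gamma> x))) \<in> Lp 1" if "\<gamma> \<in> M" for \<gamma>
      using Lp_mult_cnj_character[OF ch[OF that] f1] by (simp add: cnj_L0_scale scale_L0_mult_right Lp_scale)
    then have "pairing f (L0_of (\<psi> n) * trig_poly M c) = (\<Sum>\<gamma>\<in>M. pairing f (scale_L0 (c \<gamma>) (L0_of (\<lambda>x. \<psi> n x * \<gamma> x))))"
      unfolding mult_character_trig_poly_eq[OF \<psi>(2) M] by (rule pairing_sum_right)
    also have "\<dots> = (\<Sum>\<gamma>\<in>M. cnj (c \<gamma>) * fourier f (\<lambda>x. \<psi> n x * \<gamma> x))"
      by (intro sum.cong) (auto simp: pairing_scale_right fourier_pairing ch)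
    finally show ?thesis .
  qed
  have "(\<lambda>n. \<Sum>\<gamma>\<in>M. cnj (c \<gamma>) * fourier f (\<lambda>x. \<psi> n x * \<gamma> x)) \<longlonglongrightarrow> (\<Sum>\<gamma>\<in>M. cnj (c \<gamma>) * 0)"
  proof (intro tendsto_sum tendsto_mult tendsto_const)
    fix \<gamma> assume "\<gamma> \<in> M"
    then have "\<gamma> \<in> characters" using M by blast
    then show "(\<lambda>n. fourier f (\<lambda>x. \<psi> n x * \<gamma> x)) \<longlonglongrightarrow> 0"
      using \<psi> by (intro fourier_tendsto_0 f1 inj_mult_character character_mult)
  qed
  then show ?thesis by (simp add: eq)
qed

text \<open>Clear on polynomials, and both sides are continuous in \<open>f\<close>; the difference
  is at most \<open>C + 1\<close> times the approximation error.\<close>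

lemma fourier_riesz_projection:
  fixes f :: "'a::compact_ab_group L0"
  assumes p: "1 < p" and rb: "riesz_bounded p T" and T: "T \<subseteq> characters" and f: "f \<in> Lp p" and \<gamma>: "\<gamma> \<in> T"
  shows "fourier (riesz_projection p T f) \<gamma> = fourier f \<gamma>"
proof -
  let ?P = "riesz_projection p T"
  note P = riesz_projection_spec[OF p rb]
  have p1: "1 \<le> p" using p by simp
  have \<gamma>X: "\<gamma> \<in> characters" using \<gamma> T by blast
  from bounded_op_pos_bound[OF P(1)]
  obtain C where C: "0 < C" "\<And>f. f \<in> Lp p \<Longrightarrow> Lp_norm p (?P f) \<le> C * Lp_norm p f" by metis
  have PL: "?P f \<in> Lp p" if "f \<in> Lp p" for f
    using P(1) that Hp_Lp unfolding bounded_op_def by blast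
  have "cmod (fourier (?P f) \<gamma> - fourier f \<gamma>) \<le> 0 + e" if e: "0 < e" for e
  proof -
    have "e / (C + 1) > 0" using e C(1) by simp
    from trig_poly_dense[OF p1 f this] obtain M c
      where M: "finite M" "M \<subseteq> characters" "Lp_norm p (f - trig_poly M c) < e / (C + 1)" .
    let ?u = "trig_poly M c"
    have u: "?u \<in> Lp p" by (rule trig_poly_Lp[OF M(2) p1])
    have fu: "f - ?u \<in> Lp p" by (rule Lp_diff[OF p1 f u])
    have "fourier (?P ?u) \<gamma> = fourier ?u \<gamma>"
    proof -
      have "finite (M \<inter> T)" "M \<inter> T \<subseteq> characters" using M by auto
      then show ?thesis
        unfolding P(2)[OF M(1,2)] using fourier_trig_poly[OF _ _ \<gamma>X] M(1,2) \<gamma> by simp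
    qed
    moreover have "?P (f - ?u) = ?P f - ?P ?u"
      by (rule bounded_op_diff[OF P(1) Lp_subspace[OF p1] f u])
    ultimately have "fourier (?P f) \<gamma> - fourier f \<gamma> = fourier (?P (f - ?u)) \<gamma> - fourier (f - ?u) \<gamma>"
      using fourier_diff[OF \<gamma>X Lp_imp_L1(1)[OF p PL[OF f]] Lp_imp_L1(1)[OF p PL[OF u]]]
        fourier_diff[OF \<gamma>X Lp_imp_L1(1)[OF p f] Lp_imp_L1(1)[OF p u]] by simp
    also have "cmod \<dots> \<le> cmod (fourier (?P (f - ?u)) \<gamma>) + cmod (fourier (f - ?u) \<gamma>)" by (rule norm_triangle_ineq4)
    also have "\<dots> \<le> C * Lp_norm p (f - ?u) + Lp_norm p (f - ?u)"
      by (intro add_mono fourier_norm_le[OF \<gamma>X fu p] order.trans[OF fourier_norm_le[OF \<gamma>X PL[OF fu] p] C(2)[OF fu]])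
    also have "\<dots> = (C + 1) * Lp_norm p (f - ?u)" by (simp add: algebra_simps)
    also have "\<dots> \<le> (C + 1) * (e / (C + 1))" using M(3) C(1) by (intro mult_left_mono) auto
    also have "\<dots> = e" using C(1) by simp
    finally show ?thesis by simp
  qed
  then have "cmod (fourier (?P f) \<gamma> - fourier f \<gamma>) \<le> 0" by (rule field_le_epsilon)
  then show ?thesis by simp
qed

text \<open>The projection is invisible to polynomials with spectrum in \<open>T\<close>. This is
  how \<open>toeplitz\<close> is replaced by multiplication with the symbol, without an adjoint of
  the projection.\<close>

lemma pairing_riesz_projection:
  fixes f :: "'a::compact_ab_group L0"
  assumes p: "1 < p" and rb: "riesz_bounded p T" and T: "T \<subseteq> characters" and f: "f \<in> Lp p" and M: "M \<subseteq> T"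
  shows "pairing (riesz_projection p T f) (trig_poly M c) = pairing f (trig_poly M c)"
proof -
  have MX: "M \<subseteq> characters" using M T by blast
  have PL: "riesz_projection p T f \<in> Lp p"
    using riesz_projection_spec(1)[OF p rb] f Hp_Lp unfolding bounded_op_def by blast
  show ?thesis
    unfolding pairing_trig_poly[OF p f MX] pairing_trig_poly[OF p PL MX]
    using fourier_riesz_projection[OF p rb T f] M by (intro sum.cong) auto
qed

text \<open>
  Both semi-Fredholm cases reduce to this inequality, tested on the
  indicator function of \<open>{|\<phi>| < \<epsilon>}\<close>.
\<close>

lemma invertible_if_pairing_bound:
  fixes \<phi> :: "'a::compact_ab_group L0"
  assumes pq: "1 < p" "1 < q" "1/p + 1/q = 1" and \<phi>: "\<phi> \<in> Linf" and C: "0 \<le> C"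
    and bound: "\<And>M c N d. finite M \<Longrightarrow> M \<subseteq> characters \<Longrightarrow> finite N \<Longrightarrow> N \<subseteq> characters \<Longrightarrow>
      cmod (pairing (trig_poly M c) (trig_poly N d)) \<le> C * Lp_norm p (\<phi> * trig_poly M c) * Lp_norm q (trig_poly N d)"
  shows "invertible_in_Linf \<phi>"
proof -
  have p1: "1 \<le> p" "1 \<le> q" "0 < p" "0 < q" using pq by auto
  obtain h where h: "bmeas h" "\<phi> = L0_of h" by (rule L0_of_cases)
  obtain K where K: "0 \<le> K" "\<And>p f. 0 < p \<Longrightarrow> f \<in> Lp p \<Longrightarrow> \<phi> * f \<in> Lp p"
    "\<And>p f. 0 < p \<Longrightarrow> f \<in> Lp p \<Longrightarrow> Lp_norm p (\<phi> * f) \<le> K * Lp_norm p f"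
    using Linf_mult[OF \<phi>] by blast
  \<comment> \<open>Both sides are continuous in \<open>f\<close> and \<open>g\<close>: the left by
    Hoelder's inequality, the right because multiplication by \<open>\<phi>\<close> is
    bounded.\<close>
  have ext: "cmod (pairing f g) \<le> C * Lp_norm p (\<phi> * f) * Lp_norm q g" if f: "f \<in> Lp p" and g: "g \<in> Lp q" for f g
  proof -
    have "\<exists>u. (\<exists>M c. finite M \<and> M \<subseteq> characters \<and> u = trig_poly M c) \<and> Lp_norm p (f - u) < 1 / real (Suc n)" for n
      by (rule trig_poly_dense[OF p1(1) f, of "1 / real (Suc n)"]) auto
    then obtain u where u: "\<And>n. \<exists>M c. finite M \<and> M \<subseteq> characters \<and> u n = trig_poly M c"
      and fu: "\<And>n. Lp_norm p (f - u n) < 1 / real (Suc n)" by metis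
    have "\<exists>u. (\<exists>M c. finite M \<and> M \<subseteq> characters \<and> u = trig_poly M c) \<and> Lp_norm q (g - u) < 1 / real (Suc n)" for n
      by (rule trig_poly_dense[OF p1(2) g, of "1 / real (Suc n)"]) auto
    then obtain v where v: "\<And>n. \<exists>M c. finite M \<and> M \<subseteq> characters \<and> v n = trig_poly M c"
      and gv: "\<And>n. Lp_norm q (g - v n) < 1 / real (Suc n)" by metis
    have uL: "u n \<in> Lp p" for n using u[of n] trig_poly_Lp[OF _ p1(1)] by auto
    have vL: "v n \<in> Lp q" for n using v[of n] trig_poly_Lp[OF _ p1(2)] by auto
    have small: "(\<lambda>n. x n) \<longlonglongrightarrow> 0" if "\<And>n. 0 \<le> x n" "\<And>n. x n < 1 / real (Suc n)" for x :: "nat \<Rightarrow> real"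
      by (rule tendsto_sandwich[OF always_eventually always_eventually tendsto_const LIMSEQ_Suc[OF lim_1_over_n]])
         (use that in \<open>auto intro: less_imp_le simp del: of_nat_Suc\<close>)
    have ulim: "(\<lambda>n. Lp_norm p (u n - f)) \<longlonglongrightarrow> 0"
      by (rule small) (use fu Lp_norm_minus_commute[OF p1(3), of f] in auto)
    have vlim: "(\<lambda>n. Lp_norm q (v n - g)) \<longlonglongrightarrow> 0"
      by (rule small) (use gv Lp_norm_minus_commute[OF p1(4), of g] in auto)
    have le: "cmod (pairing (u n) (v n)) \<le> C * Lp_norm p (\<phi> * u n) * Lp_norm q (v n)" for n
      using u[of n] v[of n] bound by auto
    have vn: "(\<lambda>n. Lp_norm q (v n)) \<longlonglongrightarrow> Lp_norm q g"
      by (rule Lp_norm_tendsto[OF p1(2) vL g vlim])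
    have "(\<lambda>n. Lp_norm p (\<phi> * u n - \<phi> * f)) \<longlonglongrightarrow> 0"
    proof (rule Lim_null_comparison)
      show "\<forall>\<^sub>F n in sequentially. norm (Lp_norm p (\<phi> * u n - \<phi> * f)) \<le> K * Lp_norm p (u n - f)"
        using K(3)[OF p1(3) Lp_diff[OF p1(1) uL f]] by (simp add: right_diff_distrib)
      show "(\<lambda>n. K * Lp_norm p (u n - f)) \<longlonglongrightarrow> 0"
        using tendsto_mult[OF tendsto_const[of K] ulim] by simp
    qed
    then have un: "(\<lambda>n. Lp_norm p (\<phi> * u n)) \<longlonglongrightarrow> Lp_norm p (\<phi> * f)"
      by (intro Lp_norm_tendsto p1 K uL f)
    have "(\<lambda>n. pairing (u n) (v n) - pairing f g) \<longlonglongrightarrow> 0"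
    proof (rule Lim_null_comparison)
      have "cmod (pairing (u n) (v n) - pairing f g) \<le> Lp_norm p (u n - f) * Lp_norm q (v n) + Lp_norm p f * Lp_norm q (v n - g)" for n
      proof -
        have "pairing (u n) (v n) - pairing f g = pairing (u n - f) (v n) + pairing f (v n - g)"
        proof -
          have 1: "pairing (u n - f) (v n) = pairing (u n) (v n) - pairing f (v n)"
            by (intro pairing_diff_left pairing_bound(1)[OF _ _ pq] uL vL f)
          have "pairing (v n - g) f = pairing (v n) f - pairing g f"
            by (intro pairing_diff_left pairing_bound(1)[OF _ _ pq(2,1) conj_exponent_sym[OF pq(3)]] g vL f)
          then have 2: "pairing f (v n - g) = pairing f (v n) - pairing f g"
            by (metis pairing_commute complex_cnj_diff)
          show ?thesis by (simp add: 1 2)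
        qed
        also have "cmod \<dots> \<le> cmod (pairing (u n - f) (v n)) + cmod (pairing f (v n - g))" by (rule norm_triangle_ineq)
        also have "\<dots> \<le> Lp_norm p (u n - f) * Lp_norm q (v n) + Lp_norm p f * Lp_norm q (v n - g)"
          by (intro add_mono pairing_bound(2)[OF _ _ pq] Lp_diff p1 uL vL f g)
        finally show ?thesis .
      qed
      then show "\<forall>\<^sub>F n in sequentially. norm (pairing (u n) (v n) - pairing f g) \<le>
          Lp_norm p (u n - f) * Lp_norm q (v n) + Lp_norm p f * Lp_norm q (v n - g)" by simp
      show "(\<lambda>n. Lp_norm p (u n - f) * Lp_norm q (v n) + Lp_norm p f * Lp_norm q (v n - g)) \<longlonglongrightarrow> 0"
        by (rule tendsto_eq_intros ulim vlim vn refl | simp)+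
    qed
    then have "(\<lambda>n. cmod (pairing (u n) (v n))) \<longlonglongrightarrow> cmod (pairing f g)"
      by (intro tendsto_norm) (simp add: LIM_zero_iff)
    moreover have "(\<lambda>n. C * Lp_norm p (\<phi> * u n) * Lp_norm q (v n)) \<longlonglongrightarrow> C * Lp_norm p (\<phi> * f) * Lp_norm q g"
      by (intro tendsto_intros un vn)
    ultimately show ?thesis by (rule LIMSEQ_le) (use le in blast)
  qed
  \<comment> \<open>With this choice \<open>C * \<epsilon> < 1\<close>, which is what forces the
    measure of \<open>A\<close> to be 0 below.\<close>
  define \<epsilon> where "\<epsilon> = 1 / (C + 1)"
  have \<epsilon>: "0 < \<epsilon>" "C * \<epsilon> < 1" using C by (auto simp: \<epsilon>_def)
  define A where "A = {x. cmod (h x) < \<epsilon>}"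
  have A: "A \<in> sets borel" unfolding A_def using h(1) by (intro borel_measurable_less[of _ borel, simplified]) auto
  define i where "i = L0_of (indicator A :: 'a \<Rightarrow> complex)"
  have bi: "bmeas (indicator A :: 'a \<Rightarrow> complex)" using A by simp
  have iL: "i \<in> Lp r" if "0 \<le> r" for r
    unfolding i_def using bi that finite_measure_haar
    by (subst L0_of_in_Lp) (auto intro!: p_integrable_bounded[where C = 1] simp: indicator_def)
  let ?m = "measure haar A"
  have int_ind: "(LINT x|haar. indicator A x) = ?m"
    using A by (simp add: sets_haar)
  have ni: "Lp_norm r i = ?m powr (1 / r)" if "0 < r" for r
  proof -
    have "(\<lambda>x. cmod (indicator A x :: complex) powr r) = (indicator A :: 'a \<Rightarrow> real)"
      using that by (auto simp: indicator_def)
    then show ?thesis unfolding i_def using bi int_ind by (simp add: Lp_norm_L0_of pnorm_def)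
  qed
  have nphi: "Lp_norm p (\<phi> * i) \<le> \<epsilon> * ?m powr (1 / p)"
  proof -
    have bhi: "bmeas (\<lambda>x. h x * indicator A x)" using h(1) bi by (intro borel_measurable_times)
    \<comment> \<open>The indicator is repeated so that one copy makes the multiplier bounded by
      \<open>\<epsilon>\<close> everywhere.\<close>
    have pi: "\<phi> * i = L0_of (\<lambda>x. (h x * indicator A x) * indicator A x)"
      unfolding i_def h(2) L0_of_mult[OF h(1) bi] by (rule arg_cong[of _ _ L0_of]) (auto simp: indicator_def)
    have "p_integrable haar p (indicator A :: 'a \<Rightarrow> complex)" using iL[of p] p1(3) bi by (simp add: i_def L0_of_in_Lp)
    from pnorm_bounded_mult(2)[OF this _ _ p1(3), of "\<lambda>x. h x * indicator A x" \<epsilon>] bhi \<epsilon>(1)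
    have "pnorm haar p (\<lambda>x. (h x * indicator A x) * indicator A x) \<le> \<epsilon> * pnorm haar p (indicator A)"
      by (auto simp: A_def indicator_def norm_mult)
    moreover have "Lp_norm p (\<phi> * i) = pnorm haar p (\<lambda>x. (h x * indicator A x) * indicator A x)"
      unfolding pi by (rule Lp_norm_L0_of[OF borel_measurable_times[OF bhi bi]])
    moreover have "pnorm haar p (indicator A) = ?m powr (1 / p)"
      using ni[OF p1(3)] Lp_norm_L0_of[OF bi, of p] by (simp only: i_def)
    ultimately show ?thesis by simp
  qed
  have "pairing i i = of_real ?m"
  proof -
    have "i * cnj_L0 i = L0_of (\<lambda>x. indicator A x * cnj (indicator A x))"
      unfolding i_def using bi by (simp add: cnj_L0_of L0_of_mult)
    also have "(\<lambda>x. indicator A x * cnj (indicator A x)) = (\<lambda>x. complex_of_real (indicator A x))"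
      by (auto simp: indicator_def)
    finally have "pairing i i = integral_L0 (L0_of (\<lambda>x. complex_of_real (indicator A x)))" by (simp add: pairing_def)
    also have "\<dots> = (LINT x|haar. complex_of_real (indicator A x))"
      using A by (intro integral_L0_of) simp
    also have "\<dots> = of_real ?m" using int_ind by simp
    finally show ?thesis .
  qed
  \<comment> \<open>As the exponents are conjugate, \<open>?m powr (1 / p) * ?m powr (1 / q)\<close>
    is \<open>?m\<close>, so the inequality becomes
    \<open>?m \<le> C * \<epsilon> * ?m\<close>.\<close>
  then have "?m = cmod (pairing i i)" by simp
  also have "\<dots> \<le> C * Lp_norm p (\<phi> * i) * Lp_norm q i" by (intro ext iL) (use p1 in auto)
  also have "\<dots> \<le> C * (\<epsilon> * ?m powr (1 / p)) * ?m powr (1 / q)"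
    unfolding ni[OF p1(4)] using nphi C by (intro mult_right_mono mult_left_mono) auto
  also have "\<dots> = (C * \<epsilon>) * ?m powr (1 / p + 1 / q)" by (simp add: powr_add)
  also have "\<dots> = (C * \<epsilon>) * ?m" unfolding pq(3) by simp
  finally have "(1 - C * \<epsilon>) * ?m \<le> 0" by (simp add: algebra_simps)
  then have "?m = 0" using \<epsilon>(2) by (simp add: mult_le_0_iff measure_le_0_iff)
  then have "emeasure haar A = 0" by (simp add: haar.emeasure_eq_measure)
  then have AE_ge: "AE x in haar. \<epsilon> \<le> cmod (h x)"
    using A by (intro AE_I[where N = A]) (auto simp: A_def sets_haar)
  \<comment> \<open>\<open>h\<close> vanishes only on a null set, so the value
    \<open>inverse 0 = 0\<close> does not affect the class.\<close>
  define g where "g = L0_of (\<lambda>x. inverse (h x))"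
  have bg: "bmeas (\<lambda>x. inverse (h x))" using h(1) by simp
  have "AE x in haar. cmod (inverse (h x)) \<le> 1 / \<epsilon>"
    using AE_ge by eventually_elim (use \<epsilon>(1) in \<open>auto simp: norm_inverse inverse_eq_divide norm_divide frac_le\<close>)
  then have "g \<in> Linf" unfolding g_def Linf_def using bg by (auto simp: in_Linf_L0_of)
  moreover have "\<phi> * g = 1"
  proof -
    have "AE x in haar. h x * inverse (h x) = 1"
      using AE_ge
    proof eventually_elim
      case (elim x)
      then have "h x \<noteq> 0" using \<epsilon>(1) by auto
      then show ?case by simp
    qed
    then show ?thesis unfolding g_def h(2) using h(1) bg by (simp add: L0_of_mult L0_of_1 L0_of_eq_iff)
  qed
  ultimately show ?thesis using \<phi> by (auto simp: invertible_in_Linf_def)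
qed

section \<open>Semi-Fredholm Toeplitz operators\<close>

text \<open>One \<open>n\<close> works for all coefficients bounded by \<open>D\<close>. This order
  of quantifiers matters, because the coefficients to which it is applied come from a decomposition
  that depends on \<open>n\<close>.\<close>

lemma lin_comb_pairing_eventually_small:
  fixes B :: "'a::compact_ab_group L0 set"
  assumes p: "1 < p" and B: "finite B" "B \<subseteq> Lp p" and M: "M \<subseteq> characters"
    and \<psi>: "inj \<psi>" "\<And>n::nat. \<psi> n \<in> characters" and D: "0 \<le> D" and e: "0 < e" and q: "1 < q" "1/p + 1/q = 1"
  obtains n where "\<And>c. (\<And>b. b \<in> B \<Longrightarrow> cmod (c b) \<le> D) \<Longrightarrow>
    cmod (pairing (lin_comb B c) (L0_of (\<psi> n) * trig_poly M a)) \<le> e"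
proof -
  let ?g = "\<lambda>n. L0_of (\<psi> n) * trig_poly M a"
  have "(\<lambda>n. \<Sum>b\<in>B. D * cmod (pairing b (?g n))) \<longlonglongrightarrow> (\<Sum>b\<in>B. D * cmod 0)"
    using B(2) by (intro tendsto_sum tendsto_mult tendsto_const tendsto_norm pairing_translates_tendsto_0[OF p _ M \<psi>]) auto
  then have "\<forall>\<^sub>F n in sequentially. (\<Sum>b\<in>B. D * cmod (pairing b (?g n))) < e"
    by (rule order_tendstoD) (use e in simp)
  then obtain n where n: "(\<Sum>b\<in>B. D * cmod (pairing b (?g n))) < e"
    by (auto simp: eventually_sequentially)
  have gL: "?g n \<in> Lp q"
    using mult_character_Lp(1)[OF \<psi>(2)] trig_poly_Lp[OF M] q by simp
  show ?thesis
  proof (rule that)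
    fix c assume c: "\<And>b. b \<in> B \<Longrightarrow> cmod (c b) \<le> D"
    have "pairing (lin_comb B c) (?g n) = (\<Sum>b\<in>B. c b * pairing b (?g n))"
      unfolding lin_comb_def using B(2)
      by (subst pairing_sum_left) (auto simp: pairing_scale_left intro!: pairing_bound(1)[OF _ gL p q] Lp_scale)
    also have "cmod \<dots> \<le> (\<Sum>b\<in>B. D * cmod (pairing b (?g n)))"
      by (rule sum_norm_le) (auto simp: norm_mult intro!: mult_right_mono c)
    finally show "cmod (pairing (lin_comb B c) (?g n)) \<le> e" using n by simp
  qed
qed

locale toeplitz_setting =
  fixes p q :: real and T :: "('a::compact_ab_group \<Rightarrow> complex) set" and \<phi> :: "'a L0"
  assumes pq: "1 < p" "1 < q" "1/p + 1/q = 1"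
    and nontriv: "(UNIV :: 'a set) \<noteq> {0}" and cone: "positive_cone T"
    and rb: "riesz_bounded p T" and phi: "\<phi> \<in> Linf"
begin

abbreviation Y where "Y \<equiv> Hp p T"
abbreviation P where "P \<equiv> riesz_projection p T"
abbreviation A where "A \<equiv> toeplitz p T \<phi>"

lemma p1: "1 \<le> p" "1 \<le> q" "0 < p" "0 < q"
  using pq by auto

lemma TX: "T \<subseteq> characters"
  using cone by (simp add: positive_cone_def)

lemma P_bound:
  obtains C where "0 < C" "\<And>f. f \<in> Lp p \<Longrightarrow> Lp_norm p (P f) \<le> C * Lp_norm p f"
  using bounded_op_pos_bound[OF riesz_projection_spec(1)[OF pq(1) rb]] by metis

lemma P_Y: "f \<in> Lp p \<Longrightarrow> P f \<in> Y"
  using riesz_projection_spec(1)[OF pq(1) rb] by (simp add: bounded_op_def)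

lemma Y_Lp: "f \<in> Y \<Longrightarrow> f \<in> Lp p"
  using Hp_Lp by blast

lemma phi_Lp: "f \<in> Lp p \<Longrightarrow> \<phi> * f \<in> Lp p"
  using Linf_mult[OF phi] p1 by metis

lemma pairing_P:
  assumes "f \<in> Lp p" "\<And>\<gamma>. \<gamma> \<in> M \<Longrightarrow> (\<lambda>x. \<psi> x * \<gamma> x) \<in> T" "\<psi> \<in> characters" "M \<subseteq> characters"
  shows "pairing (P f) (L0_of \<psi> * trig_poly M c) = pairing f (L0_of \<psi> * trig_poly M c)"
proof -
  obtain c' where "L0_of \<psi> * trig_poly M c = trig_poly ((\<lambda>\<gamma> x. \<psi> x * \<gamma> x) ` M) c'"
    using mult_character_trig_poly[OF assms(3,4)] by blast
  then show ?thesis using assms(2)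
    by (auto intro!: pairing_riesz_projection[OF pq(1) rb TX assms(1)])
qed

lemma Phi_minus_invertible:
  assumes "A \<in> Phi_minus Y (Lp_norm p)"
  shows "invertible_in_Linf \<phi>"
proof -
  have A: "bounded_op Y Y (Lp_norm p) A" and "finite_dim_quotient Y (A ` Y)"
    using assms by (auto simp: Phi_minus_def)
  then obtain B where B: "finite B" "B \<subseteq> Y" "\<And>y. y \<in> Y \<Longrightarrow> \<exists>b\<in>L0.span B. y - b \<in> A ` Y"
    unfolding finite_dim_quotient_def by blast
  have subY: "L0.subspace Y" by (rule Hp_subspace[OF pq(1)])
  have BL: "B \<subseteq> Lp p" using B(2) Hp_Lp by blast
  have AY: "A f \<in> Y" if "f \<in> Y" for f using A that by (simp add: bounded_op_def)
  have Asc: "A (scale_L0 c f) = scale_L0 c (A f)" if "f \<in> Y" for c f using A that by (simp add: bounded_op_def)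
  obtain C where C: "0 \<le> C" "\<And>g e. g \<in> Y \<Longrightarrow> 0 < e \<Longrightarrow>
      \<exists>f c. f \<in> Y \<and> Lp_norm p f \<le> C * Lp_norm p g \<and> (\<forall>b\<in>B. cmod (c b) \<le> C * Lp_norm p g) \<and>
        Lp_norm p (g - (A f + lin_comb B c)) < e"
  proof (rule range_plus_span_approx[OF pq(1) subY Hp_Lp subY Hp_closed[OF pq(1)], of A B])
    show "\<exists>f\<in>Y. u - A f \<in> L0.span B" if "u \<in> Y" for u
    proof -
      from B(3)[OF that] obtain b f where "b \<in> L0.span B" "f \<in> Y" "u - b = A f" by auto
      then show ?thesis by (intro bexI[of _ f]) (auto simp: algebra_simps)
    qed
  qed (use AY Asc bounded_op_diff[OF A subY] B in auto)
  obtain CP where CP: "0 < CP" "\<And>f. f \<in> Lp p \<Longrightarrow> Lp_norm p (P f) \<le> CP * Lp_norm p f"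
    using P_bound by metis
  \<comment> \<open>Moving \<open>\<phi>\<close> to the second argument of the pairing leaves the
    norm of \<open>cnj \<phi> * h\<close> with exponent \<open>q\<close>, so the criterion is used
    for the conjugate symbol with exchanged exponents.\<close>
  have "invertible_in_Linf (cnj_L0 \<phi>)"
  proof (rule invertible_if_pairing_bound[OF pq(2,1) conj_exponent_sym[OF pq(3)]])
    obtain h where "bmeas h" "\<phi> = L0_of h" by (rule L0_of_cases)
    then show "cnj_L0 \<phi> \<in> Linf" using phi by (simp add: Linf_def cnj_L0_of in_Linf_L0_of)
    show "0 \<le> C * CP" using C CP by simp
    fix M N :: "('a \<Rightarrow> complex) set" and c d
    assume M: "finite M" "M \<subseteq> characters" and N: "finite N" "N \<subseteq> characters"
    let ?h = "trig_poly M c" and ?g = "trig_poly N d"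
    have hL: "?h \<in> Lp q" and gL: "?g \<in> Lp p" using M N p1 by (auto intro: trig_poly_Lp)
    obtain \<psi> where \<psi>: "inj \<psi>" "\<And>n::nat. \<psi> n \<in> characters" "\<And>n \<gamma>. \<gamma> \<in> M \<Longrightarrow> (\<lambda>x. \<psi> n x * \<gamma> x) \<in> T"
      using positive_cone_shift[OF nontriv cone M] by metis
    \<comment> \<open>Bounds the norm of \<open>f\<close> and the coefficients below for every
      \<open>n\<close> at once, since multiplication by a character preserves the norm of
      \<open>?g\<close>.\<close>
    define D where "D = C * (CP * Lp_norm p ?g)"
    have D: "0 \<le> D" using C CP by (simp add: D_def)
    have "cmod (pairing ?g ?h) \<le> D * Lp_norm q (cnj_L0 \<phi> * ?h) + e" if e: "0 < e" for e
    proof -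
      \<comment> \<open>The approximation error contributes \<open>e' * Lp_norm q ?h\<close> and the
        finite-dimensional part \<open>e'\<close>; together they make \<open>e\<close>.\<close>
      define e' where "e' = e / (1 + Lp_norm q ?h)"
      have h1: "1 + Lp_norm q ?h > 0" by (simp add: add_pos_nonneg)
      have e': "e' > 0" using e h1 by (simp add: e'_def)
      obtain n where n: "\<And>c'. (\<And>b. b \<in> B \<Longrightarrow> cmod (c' b) \<le> D) \<Longrightarrow>
          cmod (pairing (lin_comb B c') (L0_of (\<psi> n) * ?h)) \<le> e'"
        using lin_comb_pairing_eventually_small[OF pq(1) B(1) BL M(2) \<psi>(1,2) D e' pq(2,3)] by metis
      let ?ch = "L0_of (\<psi> n) * ?h" and ?cg = "L0_of (\<psi> n) * ?g"
      have chL: "?ch \<in> Lp q" and cgL: "?cg \<in> Lp p" and nch: "Lp_norm q ?ch = Lp_norm q ?h"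
        using mult_character_Lp[OF \<psi>(2)] hL gL by simp_all
      have Pn: "Lp_norm p (P ?cg) \<le> CP * Lp_norm p ?g"
        using CP(2)[OF cgL] mult_character_Lp(2)[OF \<psi>(2)] by simp
      obtain f c' where fc: "f \<in> Y" "Lp_norm p f \<le> C * Lp_norm p (P ?cg)"
          "\<forall>b\<in>B. cmod (c' b) \<le> C * Lp_norm p (P ?cg)" "Lp_norm p (P ?cg - (A f + lin_comb B c')) < e'"
        using C(2)[OF P_Y[OF cgL] e'] by blast
      define u where "u = A f + lin_comb B c'"
      have u: "Lp_norm p (P ?cg - u) < e'" using fc(4) by (simp add: u_def)
      have "C * Lp_norm p (P ?cg) \<le> D" unfolding D_def using Pn C by (intro mult_left_mono)
      then have f: "f \<in> Y" "Lp_norm p f \<le> D" "\<And>b. b \<in> B \<Longrightarrow> cmod (c' b) \<le> D"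
        using fc(1-3) by (auto intro: order.trans)
      have fL: "f \<in> Lp p" and pfL: "\<phi> * f \<in> Lp p" and AfL: "A f \<in> Lp p"
        using f(1) Y_Lp AY phi_Lp by blast+
      have cL: "lin_comb B c' \<in> Lp p" by (rule lin_comb_Lp[OF p1(1) BL])
      have uL: "u \<in> Lp p" unfolding u_def by (rule Lp_add[OF p1(1) AfL cL])
      have PL: "P ?cg \<in> Lp p" by (rule Y_Lp[OF P_Y[OF cgL]])
      have "pairing ?g ?h = pairing ?cg ?ch" by (rule pairing_mult_character[OF \<psi>(2), symmetric])
      also have "\<dots> = pairing (P ?cg) ?ch" by (rule pairing_P[OF cgL \<psi>(3) \<psi>(2) M(2), symmetric])
      also have "\<dots> = pairing ((P ?cg - u) + (A f + lin_comb B c')) ?ch" by (simp add: u_def)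
      also have "\<dots> = pairing (P ?cg - u) ?ch + (pairing (A f) ?ch + pairing (lin_comb B c') ?ch)"
        by (subst pairing_add_left pairing_add_left, intro pairing_bound(1)[OF _ chL pq] Lp_diff Lp_add p1 PL uL AfL cL,
            intro pairing_bound(1)[OF _ chL pq] Lp_diff Lp_add p1 PL uL AfL cL)+ simp
      also have "pairing (A f) ?ch = pairing (\<phi> * f) ?ch"
        unfolding toeplitz_def by (rule pairing_P[OF pfL \<psi>(3) \<psi>(2) M(2)])
      also have "\<dots> = pairing f (cnj_L0 \<phi> * ?ch)"
        by (simp add: pairing_def cnj_L0_mult ac_simps)
      finally have eq: "pairing ?g ?h = pairing (P ?cg - u) ?ch + (pairing f (cnj_L0 \<phi> * ?ch) + pairing (lin_comb B c') ?ch)" .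
      have pch: "cnj_L0 \<phi> * ?ch = L0_of (\<psi> n) * (cnj_L0 \<phi> * ?h)" by (simp add: ac_simps)
      have phL: "cnj_L0 \<phi> * ?h \<in> Lp q"
        using Linf_mult[OF \<open>cnj_L0 \<phi> \<in> Linf\<close>] hL p1 by metis
      have "cmod (pairing (P ?cg - u) ?ch) \<le> Lp_norm p (P ?cg - u) * Lp_norm q ?ch"
        by (intro pairing_bound(2)[OF _ chL pq] Lp_diff p1 PL uL)
      also have "\<dots> \<le> e' * Lp_norm q ?h" unfolding nch using u by (intro mult_right_mono) auto
      finally have 1: "cmod (pairing (P ?cg - u) ?ch) \<le> e' * Lp_norm q ?h" .
      have "cmod (pairing f (cnj_L0 \<phi> * ?ch)) \<le> Lp_norm p f * Lp_norm q (cnj_L0 \<phi> * ?ch)"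
        unfolding pch by (intro pairing_bound(2)[OF fL _ pq]) (use mult_character_Lp(1)[OF \<psi>(2)] phL in simp)
      also have "Lp_norm q (cnj_L0 \<phi> * ?ch) = Lp_norm q (cnj_L0 \<phi> * ?h)"
        unfolding pch by (rule mult_character_Lp(2)[OF \<psi>(2)])
      also have "Lp_norm p f * \<dots> \<le> D * \<dots>" using f(2) by (intro mult_right_mono) auto
      finally have 2: "cmod (pairing f (cnj_L0 \<phi> * ?ch)) \<le> D * Lp_norm q (cnj_L0 \<phi> * ?h)" .
      have 3: "cmod (pairing (lin_comb B c') ?ch) \<le> e'" by (rule n[OF f(3)])
      have "cmod (pairing ?g ?h) \<le> e' * Lp_norm q ?h + (D * Lp_norm q (cnj_L0 \<phi> * ?h) + e')"
        unfolding eq by (intro order.trans[OF norm_triangle_ineq] add_mono 1 2 3)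
      also have "\<dots> = D * Lp_norm q (cnj_L0 \<phi> * ?h) + e' * (1 + Lp_norm q ?h)" by (simp add: algebra_simps)
      also have "e' * (1 + Lp_norm q ?h) = e" using h1 by (simp add: e'_def)
      finally show ?thesis .
    qed
    then have "cmod (pairing ?g ?h) \<le> D * Lp_norm q (cnj_L0 \<phi> * ?h)" by (rule field_le_epsilon)
    then show "cmod (pairing ?h ?g) \<le> C * CP * Lp_norm q (cnj_L0 \<phi> * ?h) * Lp_norm p ?g"
      unfolding pairing_commute[of ?h ?g] by (simp add: D_def mult_ac)
  qed
  then obtain g where g: "g \<in> Linf" "cnj_L0 \<phi> * g = 1" by (auto simp: invertible_in_Linf_def)
  have "cnj_L0 g \<in> Linf"
  proof -
    obtain h where "bmeas h" "g = L0_of h" by (rule L0_of_cases)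
    then show ?thesis using g(1) by (simp add: Linf_def cnj_L0_of in_Linf_L0_of)
  qed
  moreover have "\<phi> * cnj_L0 g = 1"
    using arg_cong[OF g(2), of cnj_L0] by (simp add: cnj_L0_mult L0_of_1 cnj_L0_of)
  ultimately show ?thesis using phi by (auto simp: invertible_in_Linf_def)
qed

lemma Phi_plus_invertible:
  assumes "A \<in> Phi_plus Y (Lp_norm p)"
  shows "invertible_in_Linf \<phi>"
proof -
  have A: "bounded_op Y Y (Lp_norm p) A"
    and cl: "closedin (Metric_space.mtopology Y (\<lambda>f g. Lp_norm p (f - g))) (A ` Y)"
    and fd: "finite_dim {f \<in> Y. A f = 0}"
    using assms by (auto simp: Phi_plus_def)
  have subY: "L0.subspace Y" by (rule Hp_subspace[OF pq(1)])
  have AY: "A f \<in> Y" if "f \<in> Y" for f using A that by (simp add: bounded_op_def)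
  have Asc: "A (scale_L0 c f) = scale_L0 c (A f)" if "f \<in> Y" for c f using A that by (simp add: bounded_op_def)
  have Aadd: "A (f + g) = A f + A g" if "f \<in> Y" "g \<in> Y" for f g using A that by (simp add: bounded_op_def)
  have A0: "A 0 = 0" using Asc[OF L0.subspace_0[OF subY], of 0] by simp
  interpret M: Metric_space Y "\<lambda>f g. Lp_norm p (f - g)"
    by (rule Metric_space_Lp[OF p1(1) Hp_Lp])
  \<comment> \<open>The hypothesis concerns the metric space \<open>Y\<close>; it passes to
    \<open>Lp p\<close> because \<open>Y\<close> is itself closed there.\<close>
  have R: "Lp_closed p (A ` Y)"
    unfolding Lp_closed_def
  proof (intro conjI allI impI)
    show "A ` Y \<subseteq> Lp p" using AY Y_Lp by (intro image_subsetI) simp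
    fix f :: "nat \<Rightarrow> 'a L0" and g assume f: "\<forall>n. f n \<in> A ` Y" and g: "g \<in> Lp p" "(\<lambda>n. Lp_norm p (f n - g)) \<longlonglongrightarrow> 0"
    have fY: "\<forall>n. f n \<in> Y"
    proof
      fix n
      from f obtain u where "u \<in> Y" "f n = A u" by (metis imageE)
      then show "f n \<in> Y" using AY by simp
    qed
    then have "g \<in> Y" using Hp_closed[OF pq(1), of T] g unfolding Lp_closed_def by blast
    then have "limitin M.mtopology f g sequentially" using fY g by (simp add: M.limitin_metric_dist_null)
    then show "g \<in> A ` Y" using cl f unfolding M.metric_closedin_iff_sequentially_closed by blast
  qed
  obtain C1 where C1: "0 \<le> C1" "\<And>g. g \<in> A ` Y \<Longrightarrow> \<exists>f\<in>Y. A f = g \<and> Lp_norm p f \<le> C1 * Lp_norm p g"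
    using open_mapping_Lp[OF pq(1) subY Hp_closed[OF pq(1)] A R] by metis
  define Z where "Z = {f \<in> Y. A f = 0}"
  have ZY: "Z \<subseteq> Y" by (auto simp: Z_def)
  have subZ: "L0.subspace Z"
    unfolding Z_def using subY A0 by (intro L0.subspaceI) (auto simp: Aadd Asc L0.subspace_0 L0.subspace_add L0.subspace_scale)
  from bounded_op_pos_bound[OF A]
  obtain K where K: "0 < K" "\<And>f. f \<in> Y \<Longrightarrow> Lp_norm p (A f) \<le> K * Lp_norm p f" by metis
  have Zcl: "Lp_closed p Z"
    unfolding Lp_closed_def
  proof (intro conjI allI impI)
    show "Z \<subseteq> Lp p" using ZY Hp_Lp by blast
    fix f :: "nat \<Rightarrow> 'a L0" and g assume f: "\<forall>n. f n \<in> Z" and g: "g \<in> Lp p" "(\<lambda>n. Lp_norm p (f n - g)) \<longlonglongrightarrow> 0"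
    have fY: "\<And>n. f n \<in> Y" using f ZY by blast
    then have gY: "g \<in> Y" using Hp_closed[OF pq(1), of T] g unfolding Lp_closed_def by blast
    have le: "Lp_norm p (A g) \<le> K * Lp_norm p (f n - g)" for n
    proof -
      have "A (f n - g) = - A g" using bounded_op_diff[OF A subY fY gY, of n] f by (simp add: Z_def)
      then have "Lp_norm p (A g) = Lp_norm p (A (f n - g))" by (simp add: Lp_norm_uminus p1)
      also have "\<dots> \<le> K * Lp_norm p (f n - g)" by (rule K(2)[OF L0.subspace_diff[OF subY fY gY]])
      finally show ?thesis .
    qed
    have "(\<lambda>n. K * Lp_norm p (f n - g)) \<longlonglongrightarrow> K * 0" by (intro tendsto_intros g)
    then have "Lp_norm p (A g) \<le> K * 0" by (rule LIMSEQ_le_const) (use le in blast)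
    then have "Lp_norm p (A g) = 0" using Lp_norm_nonneg[of p "A g"] by simp
    then have "A g = 0" using Lp_norm_eq_0[OF p1(3) Y_Lp[OF AY[OF gY]]] by blast
    then show "g \<in> Z" using gY by (simp add: Z_def)
  qed
  obtain B0 where B0: "finite B0" "Z \<subseteq> L0.span B0" using fd unfolding finite_dim_def Z_def by blast
  \<comment> \<open>The finite spanning set \<open>B0\<close> need not lie in the kernel
    \<open>Z\<close>. A maximal independent subset of \<open>Z\<close> does, and it is finite
    because \<open>B0\<close> spans.\<close>
  obtain B where B: "B \<subseteq> Z" "L0.independent B" "Z \<subseteq> L0.span B" by (rule L0.maximal_independent_subset)
  have finB: "finite B" using L0.independent_span_bound[OF B0(1) B(2)] B(1) B0(2) by blast
  have BL: "B \<subseteq> Lp p" using B(1) ZY Hp_Lp by blast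
  \<comment> \<open>With the zero operator on \<open>Z\<close> this says that kernel elements are,
    up to a small error, combinations of \<open>B\<close> with coefficients controlled by the
    norm.\<close>
  obtain C2 where C2: "0 \<le> C2" "\<And>g e. g \<in> Z \<Longrightarrow> 0 < e \<Longrightarrow>
      \<exists>f c. f \<in> Z \<and> Lp_norm p f \<le> C2 * Lp_norm p g \<and> (\<forall>b\<in>B. cmod (c b) \<le> C2 * Lp_norm p g) \<and>
        Lp_norm p (g - (0 + lin_comb B c)) < e"
  proof (rule range_plus_span_approx[OF pq(1) subZ order.trans[OF ZY Hp_Lp] subZ Zcl, of "\<lambda>_. 0" B])
    show "\<exists>f\<in>Z. u - 0 \<in> L0.span B" if "u \<in> Z" for u using that B(3) by auto
  qed (use L0.subspace_0[OF subZ] finB B(1) in auto)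
  obtain CP where CP: "0 < CP" "\<And>f. f \<in> Lp p \<Longrightarrow> Lp_norm p (P f) \<le> CP * Lp_norm p f"
    using P_bound by metis
  show ?thesis
  proof (rule invertible_if_pairing_bound[OF pq phi])
    show "0 \<le> C1 * CP" using C1 CP by simp
    fix M N :: "('a \<Rightarrow> complex) set" and c d
    assume M: "finite M" "M \<subseteq> characters" and N: "finite N" "N \<subseteq> characters"
    let ?h = "trig_poly M c" and ?g = "trig_poly N d"
    have hL: "?h \<in> Lp p" and gL: "?g \<in> Lp q" using M N p1 by (auto intro: trig_poly_Lp)
    have phL: "\<phi> * ?h \<in> Lp p" by (rule phi_Lp[OF hL])
    obtain \<psi> where \<psi>: "inj \<psi>" "\<And>n::nat. \<psi> n \<in> characters" "\<And>n \<gamma>. \<gamma> \<in> M \<Longrightarrow> (\<lambda>x. \<psi> n x * \<gamma> x) \<in> T"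
      using positive_cone_shift[OF nontriv cone M] by metis
    \<comment> \<open>Bounds the preimage \<open>f\<close> of \<open>A ?ch\<close> found below, for
      every \<open>n\<close>, because \<open>\<phi> * ?ch\<close> and \<open>\<phi> * ?h\<close>
      have equal norms. Only \<open>E\<close> survives in the final inequality.\<close>
    define E where "E = C1 * (CP * Lp_norm p (\<phi> * ?h))"
    have E: "0 \<le> E" using C1 CP by (simp add: E_def)
    \<comment> \<open>Bounds the coefficients of the kernel part \<open>?ch - f\<close>. It involves
      the norm of \<open>?h\<close> itself, which is harmless because this part is made small by the
      shift.\<close>
    define D where "D = C2 * (Lp_norm p ?h + E)"
    have D: "0 \<le> D" using C2 E by (simp add: D_def)
    have "cmod (pairing ?h ?g) \<le> E * Lp_norm q ?g + e" if e: "0 < e" for e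
    proof -
      define e' where "e' = e / (1 + Lp_norm q ?g)"
      have g1: "1 + Lp_norm q ?g > 0" by (simp add: add_pos_nonneg)
      have e': "e' > 0" using e g1 by (simp add: e'_def)
      obtain n where n: "\<And>c'. (\<And>b. b \<in> B \<Longrightarrow> cmod (c' b) \<le> D) \<Longrightarrow>
          cmod (pairing (lin_comb B c') (L0_of (\<psi> n) * ?g)) \<le> e'"
        using lin_comb_pairing_eventually_small[OF pq(1) finB BL N(2) \<psi>(1,2) D e' pq(2,3)] by metis
      let ?ch = "L0_of (\<psi> n) * ?h" and ?cg = "L0_of (\<psi> n) * ?g"
      have chL: "?ch \<in> Lp p" and cgL: "?cg \<in> Lp q" and nch: "Lp_norm p ?ch = Lp_norm p ?h" and ncg: "Lp_norm q ?cg = Lp_norm q ?g"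
        using mult_character_Lp[OF \<psi>(2)] hL gL by simp_all
      have chY: "?ch \<in> Y"
      proof -
        obtain c' where "?ch = trig_poly ((\<lambda>\<gamma> x. \<psi> n x * \<gamma> x) ` M) c'"
          using mult_character_trig_poly[OF \<psi>(2) M(2)] by blast
        moreover have "(\<lambda>\<gamma> x. \<psi> n x * \<gamma> x) ` M \<subseteq> T" using \<psi>(3) by blast
        ultimately show ?thesis using trig_poly_Hp[OF pq(1) finite_imageI[OF M(1)] _ TX] by simp
      qed
      have "\<phi> * ?ch = L0_of (\<psi> n) * (\<phi> * ?h)" by (simp add: ac_simps)
      then have nphi: "Lp_norm p (\<phi> * ?ch) = Lp_norm p (\<phi> * ?h)"
        by (simp only: mult_character_Lp(2)[OF \<psi>(2)])
      have nA: "Lp_norm p (A ?ch) \<le> CP * Lp_norm p (\<phi> * ?h)"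
        unfolding toeplitz_def using CP(2)[OF phi_Lp[OF chL]] nphi by simp
      \<comment> \<open>\<open>?ch\<close> is compared with a preimage of the same value of small
        norm; the equality \<open>A f = A ?ch\<close> is exact, so the difference lies in the
        kernel.\<close>
      obtain f where f: "f \<in> Y" "A f = A ?ch" "Lp_norm p f \<le> C1 * Lp_norm p (A ?ch)"
        using C1(2)[of "A ?ch"] chY by blast
      have fE: "Lp_norm p f \<le> E"
        using f(3) mult_left_mono[OF nA C1(1)] by (simp add: E_def)
      have fL: "f \<in> Lp p" by (rule Y_Lp[OF f(1)])
      let ?z = "?ch - f"
      have zZ: "?z \<in> Z"
        unfolding Z_def using L0.subspace_diff[OF subY chY f(1)] bounded_op_diff[OF A subY chY f(1)] f(2) by simp
      have nz: "Lp_norm p ?z \<le> Lp_norm p ?h + E"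
        using Lp_norm_diff[OF p1(1) chL fL] nch fE by simp
      obtain c' where c: "\<forall>b\<in>B. cmod (c' b) \<le> C2 * Lp_norm p ?z" "Lp_norm p (?z - lin_comb B c') < e'"
        using C2(2)[OF zZ e'] by auto
      define u where "u = lin_comb B c'"
      have u: "Lp_norm p (?z - u) < e'" using c(2) by (simp add: u_def)
      have "C2 * Lp_norm p ?z \<le> D" unfolding D_def using nz C2 by (intro mult_left_mono)
      then have c': "cmod (c' b) \<le> D" if "b \<in> B" for b
        using c(1) that by (auto intro: order.trans)
      have uL: "u \<in> Lp p" unfolding u_def by (rule lin_comb_Lp[OF p1(1) BL])
      have zL: "?z \<in> Lp p" by (rule Lp_diff[OF p1(1) chL fL])
      have zuL: "?z - u \<in> Lp p" by (rule Lp_diff[OF p1(1) zL uL])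
      note pb = pairing_bound[OF _ cgL pq]
      have "pairing ?h ?g = pairing ?ch ?cg" by (rule pairing_mult_character[OF \<psi>(2), symmetric])
      also have "\<dots> = pairing (f + ((?z - u) + u)) ?cg" by simp
      also have "\<dots> = pairing f ?cg + pairing ((?z - u) + u) ?cg"
        by (rule pairing_add_left[OF pb(1)[OF fL] pb(1)[OF Lp_add[OF p1(1) zuL uL]]])
      also have "pairing ((?z - u) + u) ?cg = pairing (?z - u) ?cg + pairing u ?cg"
        by (rule pairing_add_left[OF pb(1)[OF zuL] pb(1)[OF uL]])
      finally have eq: "pairing ?h ?g = pairing f ?cg + (pairing (?z - u) ?cg + pairing u ?cg)" .
      have 1: "cmod (pairing f ?cg) \<le> E * Lp_norm q ?g"
        using pb(2)[OF fL] mult_right_mono[OF fE Lp_norm_nonneg[of q ?g]] by (simp add: ncg)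
      have 2: "cmod (pairing (?z - u) ?cg) \<le> e' * Lp_norm q ?g"
        using pb(2)[OF zuL] mult_right_mono[OF less_imp_le[OF u] Lp_norm_nonneg[of q ?g]] by (simp add: ncg)
      have 3: "cmod (pairing u ?cg) \<le> e'" unfolding u_def by (rule n[OF c'])
      have "cmod (pairing ?h ?g) \<le> E * Lp_norm q ?g + (e' * Lp_norm q ?g + e')"
        unfolding eq by (intro order.trans[OF norm_triangle_ineq] add_mono 1 2 3)
      also have "\<dots> = E * Lp_norm q ?g + e' * (1 + Lp_norm q ?g)" by (simp add: algebra_simps)
      also have "e' * (1 + Lp_norm q ?g) = e" using g1 by (simp add: e'_def)
      finally show ?thesis .
    qed
    then have "cmod (pairing ?h ?g) \<le> E * Lp_norm q ?g" by (rule field_le_epsilon)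
    then show "cmod (pairing ?h ?g) \<le> C1 * CP * Lp_norm p (\<phi> * ?h) * Lp_norm q ?g"
      by (simp add: E_def mult_ac)
  qed
qed

end

theorem theorem3:
  fixes \<phi> :: "'a::compact_ab_group L0"
    and T :: "('a \<Rightarrow> complex) set"
    and p :: real
  assumes "connected (UNIV :: 'a set)"
    and "(UNIV :: 'a set) \<noteq> {0}"
    and "positive_cone T"
    and "1 < p"
    and "riesz_bounded p T"
    and "\<phi> \<in> Linf"
    and "semi_Fredholm (Hp p T) (Lp_norm p) (toeplitz p T \<phi>)"
  shows "invertible_in_Linf \<phi>"
proof -
  define q where "q = p / (p - 1)"
  have "1 < q" "1/p + 1/q = 1" using assms(4) by (auto simp: q_def field_simps)
  then interpret toeplitz_setting p q T \<phi>
    by unfold_locales (use assms in auto)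
  show ?thesis
    using assms(7) Phi_plus_invertible Phi_minus_invertible by (auto simp: semi_Fredholm_def)
qed

end
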